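(* Let $\alpha\in(0,1)$, $c_T\in C^{(1+\alpha/2)}([0,T_{max}])$ with $c_T\ge0$, and $m_0\in C^{(2+\alpha)}(\Gamma)$ with $m_0(v_0)=0$. Then there exists a unique classical solution $(u,m)$ of the mean field game system $$\left\{\begin{array}{ll} \partial_tu+\partial_x^2u+\frac12|\partial_xu|^2=0 & (x,s)\in\Gamma\times(0,T_{max}),\\ \partial_tm-\partial_x^2m+\partial_x(\partial_xu\,m)=0 & (x,s)\in\Gamma\times(0,T_{max}),\\ \sum_{j\in Inc_i}a_{ij}\partial_ju(v_i,s)=0 & (v_i,s)\in\Gamma_T\times(0,T_{max}),\\ \sum_{j\in Inc_i}a_{ij}[\partial_jm-m\,\partial_ju](v_i,s)=0 & (v_i,s)\in\Gamma_T\times(0,T_{max}),\\ m(x,0)=m_0(x),\quad u(x,T_{max})=c_T(T_{max}) & x\in\Gamma,\\ m(v_0,s)=0,\quad u(v_0,s)=c_T(s) & s\in[0,T_{max}]. \end{array}\right.$$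
   Context: Network. $\Gamma\subset\mathbb R^n$ is a network: a finite set of vertices $V=\{v_i\}_{i\in I}$ connected by finitely many continuous, non self-intersecting arcs (edges) $E=\{e_j\}_{j\in J}$, each parametrized by a smooth $\pi_j:[0,l_j]\to\mathbb R^n$, $l_j>0$. $Inc_i=\{j\in J: e_j \text{ is incident to } v_i\}$, $I_B=\{i:\#Inc_i=1\}$, $I_T=I\setminus I_B$, $\partial\Gamma=\{v_i: i\in I_B\}$ (boundary vertices), $\Gamma_T=\{v_i:i\in I_T\}$ (transition vertices). It is assumed that $\partial\Gamma=\{v_0\}$ is a single boundary vertex. The signed incidence matrix is $a_{ij}=1$ if $v_i\in e_j$ and $\pi_j(0)=v_i$, $a_{ij}=-1$ if $v_i\in e_j$ and $\pi_j(l_j)=v_i$, and $a_{ij}=0$ otherwise. A point $x\in e_j$ is identified with $y=\pi_j^{-1}(x)\in[0,l_j]$; for $u:\Gamma\to\mathbb R$, $u_j(y)=u(\pi_j(y))$; $\partial_x^\gamma u$ (inside $e_j$) and $\partial_j^\gamma u(v_i)$ (at a vertex, $j\in Inc_i$) denote $\frac{d^\gamma u_j}{dy^\gamma}$ at the corresponding $y$. $T_{max}>0$ is fixed. Function spaces. $C^{(q+\alpha)}([a,b])$ ($q\in\mathbb N$, $\alpha\in(0,1)$) is the usual Hölder space. $C^{(q+\alpha)}(\Gamma)=\{u\in C(\Gamma): u_j\in C^{(q+\alpha)}([0,l_j])\ \forall j\in J\}$. The diffusion coefficients $\nu_j$ of all edges are normalized to $1$. A classical solution on $\Gamma\times[0,T_{max}]$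 is a function continuous on $\Gamma\times[0,T_{max}]$ (in particular continuous across vertices), which on each edge is $C^{2,1}$ ($C^2$ in space up to the endpoints of the edge, $C^1$ in time) for times in $(0,T_{max})$ and satisfies all the equations pointwise. *)

theory Defs
  imports "HOL-Analysis.Analysis"
begin

section \<open>Derivatives and Hoelder spaces on a compact interval\<close>

text \<open>The derivative is taken within \<open>S\<close>, so it is one-sided at the endpoints of an interval.
  Its value is junk where the function is not differentiable within \<open>S\<close>.\<close>

definition iter_deriv :: "real set \<Rightarrow> nat \<Rightarrow> (real \<Rightarrow> 'a::real_normed_vector) \<Rightarrow> real \<Rightarrow> 'a" where
  "iter_deriv S k f = ((\<lambda>g t. vector_derivative g (at t within S)) ^^ k) f"

definition Ck_on :: "nat \<Rightarrow> real set \<Rightarrow> (real \<Rightarrow> 'a::real_normed_vector) \<Rightarrow> bool" where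
  "Ck_on q S f \<longleftrightarrow>
     (\<forall>k<q. \<forall>t\<in>S. iter_deriv S k f differentiable (at t within S)) \<and>
     continuous_on S (iter_deriv S q f)"

definition smooth_on :: "real set \<Rightarrow> (real \<Rightarrow> 'a::real_normed_vector) \<Rightarrow> bool" where
  "smooth_on S f \<longleftrightarrow> (\<forall>q. Ck_on q S f)"

definition holder :: "nat \<Rightarrow> real \<Rightarrow> real set \<Rightarrow> (real \<Rightarrow> real) \<Rightarrow> bool" where
  "holder q \<alpha> S f \<longleftrightarrow>
     Ck_on q S f \<and>
     (\<exists>C. \<forall>s\<in>S. \<forall>t\<in>S. \<bar>iter_deriv S q f s - iter_deriv S q f t\<bar> \<le> C * \<bar>s - t\<bar> powr \<alpha>)"

section \<open>Networks\<close>

record ('i, 'j, 'n::finite) network =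
  vertices :: "'i set"
  edges :: "'j set"
  vpos :: "'i \<Rightarrow> real ^ 'n"
  len :: "'j \<Rightarrow> real"
  param :: "'j \<Rightarrow> real \<Rightarrow> real ^ 'n"

definition vertex_points :: "('i, 'j, 'n::finite) network \<Rightarrow> (real ^ 'n) set" where
  "vertex_points N = vpos N ` vertices N"

definition arc_of :: "('i, 'j, 'n::finite) network \<Rightarrow> 'j \<Rightarrow> (real ^ 'n) set" where
  "arc_of N j = param N j ` {0..len N j}"

definition carrier_set :: "('i, 'j, 'n::finite) network \<Rightarrow> (real ^ 'n) set" where
  "carrier_set N = vertex_points N \<union> (\<Union>j\<in>edges N. arc_of N j)"

text \<open>Arcs run from vertex to vertex and meet the vertices, and each other, only there.
  Two arcs may share both endpoints; injectivity of the parametrization excludes loops.\<close>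

definition is_network :: "('i, 'j, 'n::finite) network \<Rightarrow> bool" where
  "is_network N \<longleftrightarrow>
     finite (vertices N) \<and> finite (edges N) \<and> inj_on (vpos N) (vertices N) \<and>
     (\<forall>j\<in>edges N.
        0 < len N j \<and>
        smooth_on {0..len N j} (param N j) \<and>
        inj_on (param N j) {0..len N j} \<and>
        arc_of N j \<inter> vertex_points N = {param N j 0, param N j (len N j)}) \<and>
     (\<forall>j\<in>edges N. \<forall>k\<in>edges N. j \<noteq> k \<longrightarrow> arc_of N j \<inter> arc_of N k \<subseteq> vertex_points N) \<and>
     connected (carrier_set N)"

definition Inc :: "('i, 'j, 'n::finite) network \<Rightarrow> 'i \<Rightarrow> 'j set" where
  "Inc N i = {j \<in> edges N. vpos N i \<in> arc_of N j}"

definition boundary_idx :: "('i, 'j, 'n::finite) network \<Rightarrow> 'i set" where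
  "boundary_idx N = {i \<in> vertices N. card (Inc N i) = 1}"

definition transition_idx :: "('i, 'j, 'n::finite) network \<Rightarrow> 'i set" where
  "transition_idx N = vertices N - boundary_idx N"

definition incidence :: "('i, 'j, 'n::finite) network \<Rightarrow> 'i \<Rightarrow> 'j \<Rightarrow> real" where
  "incidence N i j =
     (if vpos N i \<in> arc_of N j \<and> param N j 0 = vpos N i then 1
      else if vpos N i \<in> arc_of N j \<and> param N j (len N j) = vpos N i then - 1
      else 0)"

definition coord :: "('i, 'j, 'n::finite) network \<Rightarrow> 'j \<Rightarrow> real ^ 'n \<Rightarrow> real" where
  "coord N j = the_inv_into {0..len N j} (param N j)"

section \<open>Functions on networks\<close>

definition on_edge ::
    "('i, 'j, 'n::finite) network \<Rightarrow> (real ^ 'n \<Rightarrow> real) \<Rightarrow> 'j \<Rightarrow> real \<Rightarrow> real" where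
  "on_edge N u j y = u (param N j y)"

text \<open>Both the derivative inside an edge and the one-sided derivative along edge \<open>j\<close> at a vertex;
  at a vertex the value depends on \<open>j\<close>.\<close>

definition edge_deriv ::
    "('i, 'j, 'n::finite) network \<Rightarrow> nat \<Rightarrow> 'j \<Rightarrow> (real ^ 'n \<Rightarrow> real) \<Rightarrow> real ^ 'n \<Rightarrow> real" where
  "edge_deriv N \<gamma> j u x = iter_deriv {0..len N j} \<gamma> (on_edge N u j) (coord N j x)"

definition holder_network ::
    "nat \<Rightarrow> real \<Rightarrow> ('i, 'j, 'n::finite) network \<Rightarrow> (real ^ 'n \<Rightarrow> real) \<Rightarrow> bool" where
  "holder_network q \<alpha> N u \<longleftrightarrow>
     continuous_on (carrier_set N) u \<and>
     (\<forall>j\<in>edges N. holder q \<alpha> {0..len N j} (on_edge N u j))"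

definition time_deriv :: "(real ^ 'n::finite \<Rightarrow> real \<Rightarrow> real) \<Rightarrow> real ^ 'n \<Rightarrow> real \<Rightarrow> real" where
  "time_deriv u x s = vector_derivative (\<lambda>t. u x t) (at s)"

text \<open>The space derivatives up to order 2 and the time derivative exist and are jointly continuous
  on the closed edge times the open time interval.\<close>

definition C21_on_edge ::
    "('i, 'j, 'n::finite) network \<Rightarrow> real \<Rightarrow> (real ^ 'n \<Rightarrow> real \<Rightarrow> real) \<Rightarrow> 'j \<Rightarrow> bool" where
  "C21_on_edge N T u j \<longleftrightarrow>
     (\<forall>s\<in>{0<..<T}. Ck_on 2 {0..len N j} (on_edge N (\<lambda>x. u x s) j)) \<and>
     (\<forall>x\<in>arc_of N j. \<forall>s\<in>{0<..<T}. (\<lambda>t. u x t) differentiable (at s)) \<and>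
     (\<forall>k\<le>2. continuous_on ({0..len N j} \<times> {0<..<T})
        (\<lambda>(y, s). iter_deriv {0..len N j} k (on_edge N (\<lambda>x. u x s) j) y)) \<and>
     continuous_on ({0..len N j} \<times> {0<..<T}) (\<lambda>(y, s). time_deriv u (param N j y) s)"

definition classical ::
    "('i, 'j, 'n::finite) network \<Rightarrow> real \<Rightarrow> (real ^ 'n \<Rightarrow> real \<Rightarrow> real) \<Rightarrow> bool" where
  "classical N T u \<longleftrightarrow>
     continuous_on (carrier_set N \<times> {0..T}) (\<lambda>(x, s). u x s) \<and>
     (\<forall>j\<in>edges N. C21_on_edge N T u j)"

section \<open>The mean field game system\<close>

definition mfg_solution ::
    "('i, 'j, 'n::finite) network \<Rightarrow> 'i \<Rightarrow> real \<Rightarrow> (real \<Rightarrow> real) \<Rightarrow> (real ^ 'n \<Rightarrow> real) \<Rightarrow>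
     (real ^ 'n \<Rightarrow> real \<Rightarrow> real) \<Rightarrow> (real ^ 'n \<Rightarrow> real \<Rightarrow> real) \<Rightarrow> bool" where
  "mfg_solution N i0 T cT m0 u m \<longleftrightarrow>
     classical N T u \<and> classical N T m \<and>
     (\<forall>j\<in>edges N. \<forall>x\<in>arc_of N j. \<forall>s\<in>{0<..<T}.
        time_deriv u x s + edge_deriv N 2 j (\<lambda>z. u z s) x
          + 1 / 2 * \<bar>edge_deriv N 1 j (\<lambda>z. u z s) x\<bar>\<^sup>2 = 0) \<and>
     (\<forall>j\<in>edges N. \<forall>x\<in>arc_of N j. \<forall>s\<in>{0<..<T}.
        time_deriv m x s - edge_deriv N 2 j (\<lambda>z. m z s) x
          + edge_deriv N 1 j (\<lambda>z. edge_deriv N 1 j (\<lambda>z'. u z' s) z * m z s) x = 0) \<and>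
     (\<forall>i\<in>transition_idx N. \<forall>s\<in>{0<..<T}.
        (\<Sum>j\<in>Inc N i. incidence N i j * edge_deriv N 1 j (\<lambda>z. u z s) (vpos N i)) = 0) \<and>
     (\<forall>i\<in>transition_idx N. \<forall>s\<in>{0<..<T}.
        (\<Sum>j\<in>Inc N i. incidence N i j *
           (edge_deriv N 1 j (\<lambda>z. m z s) (vpos N i)
             - m (vpos N i) s * edge_deriv N 1 j (\<lambda>z. u z s) (vpos N i))) = 0) \<and>
     (\<forall>x\<in>carrier_set N. m x 0 = m0 x \<and> u x T = cT T) \<and>
     (\<forall>s\<in>{0..T}. m (vpos N i0) s = 0 \<and> u (vpos N i0) s = cT s)"

end

theory Submission
  imports Defs "HOL-Probability.Distributions"
begin

text \<open>The two equations decouple. If \<open>u\<close> solves the Hamilton-Jacobi equation, then \<open>w = exp (u / 2)\<close> solves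
the backward heat equation (Hopf-Cole), and if in addition \<open>m\<close> solves the Fokker-Planck equation, then
\<open>m / w\<close> solves the forward heat equation. Both vertex conditions turn into the Kirchhoff condition
that the outgoing derivatives sum to zero. Conversely \<open>u = 2 * ln w\<close> and \<open>m = w * p\<close> solve the system
whenever \<open>w\<close> and \<open>p\<close> solve the two heat problems and \<open>w\<close> is positive (\<open>solution_imp_heat\<close>,
\<open>mfg_solution_exists\<close>). What remains is the heat equation on a metric graph with Kirchhoff conditions
at the transition vertices and a Dirichlet condition at the boundary vertex.

Uniqueness, and the lower bound \<open>w \<ge> 1\<close>, come from the maximum principle \<open>heat_solution_maximum\<close>. At
a positive maximum over a vertex no outgoing derivative is positive, so by Kirchhoff all of them
vanish; the second derivative is then nonpositive as in the interior, and the equation, which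
holds up to the vertices, gives the contradiction.

Existence with zero Dirichlet data is the method of images (\<open>homogeneous_heat_solution_exists\<close>). The
initial datum of each edge is extended to the whole real line by reflecting at every vertex: beyond a
vertex of degree \<open>d\<close> the extension is \<open>2 / d\<close> times the sum of the extended data on the edges that meet
there, minus the datum of the edge itself, and just minus that datum at the Dirichlet vertex.
The extensions grow at most exponentially, so they may be convolved with the Gaussian. The sum of the
extended data at a vertex is even, and their differences are odd, which is Kirchhoff and
continuity; odd data at the Dirichlet vertex give the value zero.

For a Dirichlet datum with \<open>\<gamma> 0 = 0\<close> and derivative \<open>h\<close>, let \<open>Q\<close> be the solution for the initial datum \<open>1\<close>
and zero Dirichlet data. Duhamel's formula gives the solution as the convolution in time of \<open>1 - Q\<close>
with \<open>h\<close> (\<open>boundary_heat_solution_exists\<close>). The initial datum of \<open>1 - Q\<close> is, near an edge that leaves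
the Dirichlet vertex, a step function plus a part that vanishes near that edge. The second part gives
a kernel that is smooth up to time zero. The step gives the half-line problem \<open>half_line_solution\<close>,
whose kernel is an approximate identity in time as the boundary is approached; this is where
regularity up to the Dirichlet vertex is decided.\<close>

section \<open>Integrals that depend on a parameter\<close>

lemma has_real_derivative_integral_dominated:
  fixes f f' :: "real \<Rightarrow> 'a \<Rightarrow> real"
  assumes S: "convex S" "y \<in> S"
    and int: "\<And>x. x \<in> S \<Longrightarrow> integrable M (f x)"
    and der: "\<And>x z. x \<in> S \<Longrightarrow> ((\<lambda>x. f x z) has_real_derivative f' x z) (at x within S)"
    and meas: "f' y \<in> borel_measurable M"
    and bound: "\<And>x z. x \<in> S \<Longrightarrow> \<bar>f' x z\<bar> \<le> w z" and w: "integrable M w"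
  shows "((\<lambda>x. \<integral>z. f x z \<partial>M) has_real_derivative (\<integral>z. f' y z \<partial>M)) (at y within S)"
  unfolding has_field_derivative_iff tendsto_at_iff_sequentially
proof (intro allI impI)
  fix X :: "nat \<Rightarrow> real" assume X: "\<forall>i. X i \<in> S - {y}" and lim: "X \<longlonglongrightarrow> y"
  define q where "q = (\<lambda>n z. (f (X n) z - f y z) / (X n - y))"
  have "(\<lambda>n. \<integral>z. q n z \<partial>M) \<longlonglongrightarrow> (\<integral>z. f' y z \<partial>M)"
  proof (rule integral_dominated_convergence[OF meas _ w])
    show "q n \<in> borel_measurable M" for n
      using X S int unfolding q_def
      by (intro borel_measurable_divide borel_measurable_diff borel_measurable_integrable borel_measurable_const) auto
    have "(\<lambda>n. q n z) \<longlonglongrightarrow> f' y z" for z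
    proof -
      have "((\<lambda>x. (f x z - f y z) / (x - y)) \<longlongrightarrow> f' y z) (at y within S)"
        using der[OF S(2), of z] by (simp add: has_field_derivative_iff)
      then show ?thesis unfolding q_def tendsto_at_iff_sequentially o_def using X lim by blast
    qed
    then show "AE z in M. (\<lambda>n. q n z) \<longlonglongrightarrow> f' y z" by simp
    have "norm (q n z) \<le> w z" for n z
    proof -
      have "norm (f (X n) z - f y z) \<le> w z * norm (X n - y)"
        by (rule field_differentiable_bound[OF S(1), of "\<lambda>x. f x z" "\<lambda>x. f' x z"])
           (use X S der bound in auto)
      then show ?thesis using X unfolding q_def by (auto simp: divide_simps)
    qed
    then show "\<And>n. AE z in M. norm (q n z) \<le> w z" by simp
  qed
  moreover have "(\<integral>z. q n z \<partial>M) = ((\<integral>z. f (X n) z \<partial>M) - (\<integral>z. f y z \<partial>M)) / (X n - y)" for n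
    unfolding q_def using X S int by (subst Bochner_Integration.integral_diff[symmetric]) auto
  ultimately show "((\<lambda>x. ((\<integral>z. f x z \<partial>M) - (\<integral>z. f y z \<partial>M)) / (x - y)) \<circ> X) \<longlonglongrightarrow> (\<integral>z. f' y z \<partial>M)"
    by (simp add: o_def)
qed

lemma continuous_within_integral_dominated:
  fixes f :: "'b::metric_space \<Rightarrow> 'a \<Rightarrow> real"
  assumes meas: "\<And>x. x \<in> S \<Longrightarrow> f x \<in> borel_measurable M" and "x0 \<in> S"
    and cont: "\<And>z. continuous (at x0 within S) (\<lambda>x. f x z)"
    and bound: "\<And>x z. x \<in> S \<Longrightarrow> dist x x0 < d \<Longrightarrow> \<bar>f x z\<bar> \<le> w z" and d: "0 < d" and w: "integrable M w"
  shows "continuous (at x0 within S) (\<lambda>x. \<integral>z. f x z \<partial>M)"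
  unfolding continuous_within_sequentially
proof (intro allI impI, elim conjE)
  fix X :: "nat \<Rightarrow> 'b" assume X: "\<forall>n. X n \<in> S" and lim: "X \<longlonglongrightarrow> x0"
  obtain n0 where n0: "\<And>n. n \<ge> n0 \<Longrightarrow> dist (X n) x0 < d"
    using lim d unfolding lim_sequentially by blast
  have "(\<lambda>n. \<integral>z. f (X (n + n0)) z \<partial>M) \<longlonglongrightarrow> (\<integral>z. f x0 z \<partial>M)"
  proof (rule integral_dominated_convergence[OF _ _ w])
    show "AE z in M. (\<lambda>n. f (X (n + n0)) z) \<longlonglongrightarrow> f x0 z"
    proof (rule AE_I2)
      fix z
      have "(\<lambda>n. f (X n) z) \<longlonglongrightarrow> f x0 z"
        using cont[of z] X lim unfolding continuous_within_sequentially o_def by blast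
      then show "(\<lambda>n. f (X (n + n0)) z) \<longlonglongrightarrow> f x0 z" by (rule LIMSEQ_ignore_initial_segment)
    qed
  qed (use meas X \<open>x0 \<in> S\<close> bound n0 in auto)
  then show "((\<lambda>x. \<integral>z. f x z \<partial>M) \<circ> X) \<longlonglongrightarrow> (\<integral>z. f x0 z \<partial>M)"
    unfolding o_def by (rule LIMSEQ_offset)
qed

section \<open>The heat kernel\<close>

text \<open>For \<open>i = 0, 1, 2\<close> this is the \<open>i\<close>-th space derivative of the Gaussian heat kernel; one function with an
index lets the estimates below be proved once. By the heat equation, index \<open>2\<close> is also the time
derivative of index \<open>0\<close>.\<close>

definition heat_ker :: "nat \<Rightarrow> real \<Rightarrow> real \<Rightarrow> real" where
  "heat_ker i x s = (if i = 0 then 1 else if i = 1 then - (x / (2 * s)) else x\<^sup>2 / (4 * s\<^sup>2) - 1 / (2 * s))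
     * (exp (- (x\<^sup>2 / (4 * s))) / sqrt (4 * pi * s))"

lemma heat_ker_0: "heat_ker 0 x s = exp (- (x\<^sup>2 / (4 * s))) / sqrt (4 * pi * s)"
  by (simp add: heat_ker_def)
lemma heat_ker_1: "heat_ker 1 x s = - (x / (2 * s)) * (exp (- (x\<^sup>2 / (4 * s))) / sqrt (4 * pi * s))"
  by (simp add: heat_ker_def)
lemma heat_ker_2: "heat_ker 2 x s = (x\<^sup>2 / (4 * s\<^sup>2) - 1 / (2 * s)) * (exp (- (x\<^sup>2 / (4 * s))) / sqrt (4 * pi * s))"
  by (simp add: heat_ker_def)

lemma heat_ker_0_deriv:
  assumes "s > 0" shows "((\<lambda>x. heat_ker 0 x s) has_real_derivative heat_ker 1 x s) (at x within S)"
proof -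
  define c where "c = 1 / sqrt (4 * pi * s)"
  have "((\<lambda>x. exp (- (x\<^sup>2 / (4 * s))) * c) has_real_derivative - (x / (2 * s)) * (exp (- (x\<^sup>2 / (4 * s))) * c)) (at x within S)"
    using assms by (auto intro!: derivative_eq_intros simp: field_simps power2_eq_square)
  then show ?thesis by (simp add: heat_ker_0 heat_ker_1 c_def del: One_nat_def)
qed

lemma heat_ker_1_deriv:
  assumes "s > 0" shows "((\<lambda>x. heat_ker 1 x s) has_real_derivative heat_ker 2 x s) (at x within S)"
proof -
  have "((\<lambda>x. - (x / (2 * s))) has_real_derivative - (1 / (2 * s))) (at x within S)"
    using assms by (auto intro!: derivative_eq_intros simp: field_simps)
  then have "((\<lambda>x. - (x / (2 * s)) * heat_ker 0 x s) has_real_derivative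
      - (1 / (2 * s)) * heat_ker 0 x s + heat_ker 1 x s * - (x / (2 * s))) (at x within S)"
    by (rule DERIV_mult) (rule heat_ker_0_deriv[OF assms])
  moreover have "(\<lambda>x. - (x / (2 * s)) * heat_ker 0 x s) = (\<lambda>x. heat_ker 1 x s)"
    by (simp add: fun_eq_iff heat_ker_0 heat_ker_1 del: One_nat_def)
  moreover have "heat_ker 2 x s = - (1 / (2 * s)) * heat_ker 0 x s + heat_ker 1 x s * - (x / (2 * s))"
  proof -
    have "heat_ker 1 x s = - (x / (2 * s)) * heat_ker 0 x s" "heat_ker 2 x s = (x\<^sup>2 / (4 * s\<^sup>2) - 1 / (2 * s)) * heat_ker 0 x s"
      by (simp_all add: heat_ker_0 heat_ker_1 heat_ker_2 del: One_nat_def)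
    then show ?thesis by (simp add: algebra_simps power2_eq_square del: One_nat_def)
  qed
  ultimately show ?thesis by simp
qed

lemma heat_ker_0_time_deriv:
  assumes "s > 0" shows "((\<lambda>s. heat_ker 0 x s) has_real_derivative heat_ker 2 x s) (at s within S)"
proof -
  define c where "c = 1 / sqrt (4 * pi)"
  have hk0: "heat_ker 0 x s = exp (- (x\<^sup>2 / (4 * s))) * (c * (1 / sqrt s))" for s
    by (simp add: heat_ker_0 c_def real_sqrt_mult)
  have 1: "((\<lambda>s. 1 / sqrt s) has_real_derivative - (1 / (2 * s)) * (1 / sqrt s)) (at s within S)"
    using assms by (auto intro!: derivative_eq_intros simp: field_simps power2_eq_square)
  have 2: "((\<lambda>s. exp (- (x\<^sup>2 / (4 * s)))) has_real_derivative x\<^sup>2 / (4 * s\<^sup>2) * exp (- (x\<^sup>2 / (4 * s)))) (at s within S)"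
    using assms by (auto intro!: derivative_eq_intros simp: field_simps power2_eq_square)
  have "((\<lambda>s. exp (- (x\<^sup>2 / (4 * s))) * (c * (1 / sqrt s))) has_real_derivative
     x\<^sup>2 / (4 * s\<^sup>2) * exp (- (x\<^sup>2 / (4 * s))) * (c * (1 / sqrt s)) +
     c * (- (1 / (2 * s)) * (1 / sqrt s)) * exp (- (x\<^sup>2 / (4 * s)))) (at s within S)"
    by (intro DERIV_mult 2 DERIV_cmult 1)
  moreover have "heat_ker 2 x s = (x\<^sup>2 / (4 * s\<^sup>2) - 1 / (2 * s)) * heat_ker 0 x s" by (simp add: heat_ker_0 heat_ker_2)
  then have "heat_ker 2 x s = x\<^sup>2 / (4 * s\<^sup>2) * exp (- (x\<^sup>2 / (4 * s))) * (c * (1 / sqrt s)) +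
     c * (- (1 / (2 * s)) * (1 / sqrt s)) * exp (- (x\<^sup>2 / (4 * s)))"
    unfolding hk0 by (simp only: algebra_simps)
  ultimately show ?thesis unfolding hk0 by simp
qed

lemma heat_ker_minus: "heat_ker i (- x) s = (-1) ^ (if i = 1 then 1 else 0) * heat_ker i x s"
  by (simp add: heat_ker_def)

lemma continuous_on_heat_ker: "continuous_on (UNIV \<times> {0<..}) (\<lambda>(x, s). heat_ker i x s)"
proof -
  have 0: "continuous_on (UNIV \<times> {0<..}) (\<lambda>p. exp (- ((fst p)\<^sup>2 / (4 * snd p))) / sqrt (4 * pi * snd p))"
    by (intro continuous_intros) auto
  have 1: "continuous_on (UNIV \<times> {0<..}) (\<lambda>p::real \<times> real. if i = 0 then 1 else if i = 1 then - (fst p / (2 * snd p))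
      else (fst p)\<^sup>2 / (4 * (snd p)\<^sup>2) - 1 / (2 * snd p))"
    by (cases "i = 0"; cases "i = 1"; simp; intro continuous_intros; auto)
  show ?thesis unfolding heat_ker_def case_prod_beta by (rule continuous_on_mult[OF 1 0])
qed

lemma borel_measurable_heat_ker [measurable]: "(\<lambda>x. heat_ker i x s) \<in> borel_measurable borel"
  unfolding heat_ker_def by measurable

text \<open>A crude bound common to all indices: every negative power of \<open>s\<close> is absorbed into \<open>(1 + 1 / s) ^ 3\<close>.\<close>

lemma abs_heat_ker_le:
  assumes "s > 0"
  shows "\<bar>heat_ker i x s\<bar> \<le> (1 + 1 / s) ^ 3 * (1 + \<bar>x\<bar>)\<^sup>2 * exp (- (x\<^sup>2 / (4 * s)))"
proof -
  define p where "p = 1 / s"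
  define c where "c = (if i = 0 then 1 else if i = 1 then - (x / (2 * s)) else x\<^sup>2 / (4 * s\<^sup>2) - 1 / (2 * s))"
  have p: "0 < p" using assms by (simp add: p_def)
  have root: "1 / sqrt (4 * pi * s) \<le> 1 + p"
  proof -
    have "1 / sqrt (4 * pi * s) \<le> 1 / sqrt s"
      using assms pi_ge_two by (intro divide_left_mono real_sqrt_le_mono) auto
    also have "\<dots> = sqrt p" by (simp add: p_def real_sqrt_divide)
    also have "\<dots> \<le> 1 + p"
      using p by (intro real_le_lsqrt) (auto simp: power2_eq_square distrib_left distrib_right)
    finally show ?thesis .
  qed
  have e1: "\<bar>x / (2 * s)\<bar> = \<bar>x\<bar> * p / 2" using assms by (simp add: abs_mult p_def)
  have e2: "x\<^sup>2 / (4 * s\<^sup>2) = p\<^sup>2 * (\<bar>x\<bar>)\<^sup>2 / 4" "1 / (2 * s) = p / 2" by (auto simp: p_def power_divide)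
  have "\<bar>c\<bar> \<le> (1 + p)\<^sup>2 * (1 + \<bar>x\<bar>)\<^sup>2"
  proof -
    have "1 \<le> (1 + p)\<^sup>2" "1 \<le> (1 + \<bar>x\<bar>)\<^sup>2" using p by (auto simp: one_le_power)
    then have one: "1 \<le> (1 + p)\<^sup>2 * (1 + \<bar>x\<bar>)\<^sup>2"
      by (metis mult_mono mult_1 zero_le_one zero_le_power2)
    have "p \<le> (1 + p)\<^sup>2" "\<bar>x\<bar> \<le> (1 + \<bar>x\<bar>)\<^sup>2" using p by (auto simp: power2_eq_square algebra_simps)
    then have two: "\<bar>x\<bar> * p \<le> (1 + p)\<^sup>2 * (1 + \<bar>x\<bar>)\<^sup>2"
      using mult_mono[of p "(1 + p)\<^sup>2" "\<bar>x\<bar>" "(1 + \<bar>x\<bar>)\<^sup>2"] by (simp add: mult.commute)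
    have "p\<^sup>2 * (\<bar>x\<bar>)\<^sup>2 \<le> (1 + p)\<^sup>2 * (1 + \<bar>x\<bar>)\<^sup>2"
      using p by (intro mult_mono power_mono) auto
    moreover have "p * 1 \<le> (1 + p)\<^sup>2 * (1 + \<bar>x\<bar>)\<^sup>2"
      using \<open>p \<le> (1 + p)\<^sup>2\<close> \<open>1 \<le> (1 + \<bar>x\<bar>)\<^sup>2\<close> by (intro mult_mono) auto
    moreover have "0 \<le> p\<^sup>2 * (\<bar>x\<bar>)\<^sup>2" by simp
    moreover have "\<bar>A / 4 - p / 2\<bar> \<le> B" if "A \<le> B" "p * 1 \<le> B" "0 \<le> A" for A B
      using that p by linarith
    ultimately have three: "\<bar>x\<^sup>2 / (4 * s\<^sup>2) - 1 / (2 * s)\<bar> \<le> (1 + p)\<^sup>2 * (1 + \<bar>x\<bar>)\<^sup>2"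
      unfolding e2 by blast
    have four: "\<bar>- (x / (2 * s))\<bar> \<le> (1 + p)\<^sup>2 * (1 + \<bar>x\<bar>)\<^sup>2"
      using two mult_nonneg_nonneg[of "\<bar>x\<bar>" p] p unfolding abs_minus_cancel e1 by linarith
    show ?thesis unfolding c_def using one three four by (cases "i = 0"; cases "i = 1") simp_all
  qed
  then have "\<bar>c\<bar> * (1 / sqrt (4 * pi * s)) \<le> (1 + p)\<^sup>2 * (1 + \<bar>x\<bar>)\<^sup>2 * (1 + p)"
    using root by (rule mult_mono) (use assms in auto)
  then have "\<bar>c\<bar> * (1 / sqrt (4 * pi * s)) * exp (- (x\<^sup>2 / (4 * s))) \<le> (1 + p)\<^sup>2 * (1 + \<bar>x\<bar>)\<^sup>2 * (1 + p) * exp (- (x\<^sup>2 / (4 * s)))"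
    by (rule mult_right_mono) simp
  moreover have "\<bar>heat_ker i x s\<bar> = \<bar>c\<bar> * (1 / sqrt (4 * pi * s)) * exp (- (x\<^sup>2 / (4 * s)))"
    unfolding heat_ker_def c_def[symmetric] abs_mult using assms by (simp add: abs_mult)
  moreover have "(1 + p)\<^sup>2 * (1 + \<bar>x\<bar>)\<^sup>2 * (1 + p) = (1 + 1 / s) ^ 3 * (1 + \<bar>x\<bar>)\<^sup>2"
    unfolding p_def[symmetric] by (simp add: power2_eq_square power3_eq_cube)
  ultimately show ?thesis by simp
qed

lemma square_le_exp: "(1 + \<bar>x\<bar>)\<^sup>2 \<le> 2 * exp \<bar>x\<bar>" for x :: real
proof -
  have "1 + \<bar>x\<bar> + \<bar>x\<bar>\<^sup>2 / 2 \<le> exp \<bar>x\<bar>" by (rule exp_lower_Taylor_quadratic) simp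
  then show ?thesis by (simp add: power2_sum)
qed

lemma gauss_absorbs_exp:
  fixes x b K :: real
  assumes "0 < b"
  shows "exp (- (x\<^sup>2 / (4 * b))) \<le> exp (b * K\<^sup>2) * exp (- K * \<bar>x\<bar>)"
proof -
  have "0 \<le> (\<bar>x\<bar> - 2 * b * K)\<^sup>2" by simp
  then have "4 * b * (K * \<bar>x\<bar>) \<le> x\<^sup>2 + 4 * b * (b * K\<^sup>2)"
    by (simp add: power2_eq_square algebra_simps)
  then have "4 * b * (K * \<bar>x\<bar>) / (4 * b) \<le> (x\<^sup>2 + 4 * b * (b * K\<^sup>2)) / (4 * b)"
    using assms by (intro divide_right_mono) auto
  then have "- (x\<^sup>2 / (4 * b)) \<le> b * K\<^sup>2 + - K * \<bar>x\<bar>"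
    using assms by (simp add: add_divide_distrib)
  then show ?thesis by (simp add: exp_add[symmetric])
qed

lemma heat_ker_bound_away_from_time_0:
  fixes a b K :: real
  assumes "0 < a" "a \<le> b"
  obtains M where "0 \<le> M" "\<And>i x s. a \<le> s \<Longrightarrow> s \<le> b \<Longrightarrow> \<bar>heat_ker i x s\<bar> \<le> M * exp (- K * \<bar>x\<bar>)"
proof
  let ?M = "(1 + 1 / a) ^ 3 * 2 * exp (b * (K + 1)\<^sup>2)"
  show "0 \<le> ?M" using assms by simp
  fix i :: nat and x s :: real assume s: "a \<le> s" "s \<le> b"
  have "exp (- (x\<^sup>2 / (4 * s))) \<le> exp (- (x\<^sup>2 / (4 * b)))"
    using s assms by (simp add: divide_left_mono)
  also have "\<dots> \<le> exp (b * (K + 1)\<^sup>2) * exp (- (K + 1) * \<bar>x\<bar>)"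
    using assms by (intro gauss_absorbs_exp) auto
  finally have E: "exp (- (x\<^sup>2 / (4 * s))) \<le> exp (b * (K + 1)\<^sup>2) * exp (- (K + 1) * \<bar>x\<bar>)" .
  have "\<bar>heat_ker i x s\<bar> \<le> (1 + 1 / s) ^ 3 * (1 + \<bar>x\<bar>)\<^sup>2 * exp (- (x\<^sup>2 / (4 * s)))"
    using s assms by (intro abs_heat_ker_le) auto
  also have "\<dots> \<le> (1 + 1 / a) ^ 3 * (2 * exp \<bar>x\<bar>) * (exp (b * (K + 1)\<^sup>2) * exp (- (K + 1) * \<bar>x\<bar>))"
    using s assms E square_le_exp[of x]
    by (intro mult_mono power_mono add_mono divide_left_mono mult_nonneg_nonneg) auto
  also have "\<dots> = ?M * (exp \<bar>x\<bar> * exp (- (K + 1) * \<bar>x\<bar>))" by (simp add: mult_ac)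
  also have "exp \<bar>x\<bar> * exp (- (K + 1) * \<bar>x\<bar>) = exp (- K * \<bar>x\<bar>)"
    by (simp add: exp_add[symmetric] algebra_simps)
  finally show "\<bar>heat_ker i x s\<bar> \<le> ?M * exp (- K * \<bar>x\<bar>)" .
qed

lemma exp_minus_le_power5:
  fixes u :: real assumes "0 < u" shows "exp (- u) \<le> (5 / u) ^ 5"
proof -
  have "u / 5 \<le> exp (u / 5)" using exp_ge_add_one_self[of "u / 5"] by linarith
  then have "(u / 5) ^ 5 \<le> exp (u / 5) ^ 5" using assms by (intro power_mono) auto
  also have "\<dots> = exp u" by (simp add: exp_of_nat_mult[symmetric])
  finally have "exp (- u) \<le> inverse ((u / 5) ^ 5)"
    using assms by (simp add: exp_minus le_imp_inverse_le)
  then show ?thesis by (simp add: power_divide)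
qed

text \<open>Away from the origin the Gaussian beats every power of \<open>1 / s\<close>. Half of it pays for the negative powers
and leaves \<open>s\<^sup>2\<close>, the other half gives the exponential weight. The factor \<open>s\<^sup>2\<close> makes a potential
vanish to second order at time zero where its data vanish.\<close>

lemma heat_ker_bound_away_from_origin:
  fixes b \<delta> K :: real
  assumes "0 < b" "0 < \<delta>"
  obtains M where "0 \<le> M"
    "\<And>i x s. 0 < s \<Longrightarrow> s \<le> b \<Longrightarrow> \<delta> \<le> \<bar>x\<bar> \<Longrightarrow> \<bar>heat_ker i x s\<bar> \<le> M * s\<^sup>2 * exp (- K * \<bar>x\<bar>)"
proof
  let ?M = "(1 + b) ^ 3 * 2 * exp (2 * b * (K + 1)\<^sup>2) * (40 / \<delta>\<^sup>2) ^ 5"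
  show "0 \<le> ?M" using assms by simp
  fix i :: nat and x s :: real assume s: "0 < s" "s \<le> b" and x: "\<delta> \<le> \<bar>x\<bar>"
  have "\<delta>\<^sup>2 \<le> x\<^sup>2" using x assms by (simp add: abs_le_square_iff[symmetric])
  then have "exp (- (x\<^sup>2 / (8 * s))) \<le> exp (- (\<delta>\<^sup>2 / (8 * s)))"
    using s by (simp add: divide_right_mono)
  also have "\<dots> \<le> (5 / (\<delta>\<^sup>2 / (8 * s))) ^ 5"
    using s assms by (intro exp_minus_le_power5) auto
  also have "5 / (\<delta>\<^sup>2 / (8 * s)) = 40 / \<delta>\<^sup>2 * s" by simp
  also have "(40 / \<delta>\<^sup>2 * s) ^ 5 = (40 / \<delta>\<^sup>2) ^ 5 * s ^ 5" by (rule power_mult_distrib)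
  finally have E1: "exp (- (x\<^sup>2 / (8 * s))) \<le> (40 / \<delta>\<^sup>2) ^ 5 * s ^ 5" .
  have "exp (- (x\<^sup>2 / (8 * s))) \<le> exp (- (x\<^sup>2 / (4 * (2 * b))))"
    using s assms by (simp add: divide_left_mono)
  also have "\<dots> \<le> exp (2 * b * (K + 1)\<^sup>2) * exp (- (K + 1) * \<bar>x\<bar>)"
    using assms by (intro gauss_absorbs_exp) auto
  finally have E2: "exp (- (x\<^sup>2 / (8 * s))) \<le> exp (2 * b * (K + 1)\<^sup>2) * exp (- (K + 1) * \<bar>x\<bar>)" .
  have "exp (- (x\<^sup>2 / (4 * s))) = exp (- (x\<^sup>2 / (8 * s))) * exp (- (x\<^sup>2 / (8 * s)))"
    by (simp add: exp_add[symmetric])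
  also have "\<dots> \<le> ((40 / \<delta>\<^sup>2) ^ 5 * s ^ 5) * (exp (2 * b * (K + 1)\<^sup>2) * exp (- (K + 1) * \<bar>x\<bar>))"
    using E1 E2 s by (intro mult_mono) auto
  finally have E: "exp (- (x\<^sup>2 / (4 * s))) \<le> \<dots>" .
  have p: "1 + 1 / s \<le> (1 + b) / s" using s by (simp add: field_simps)
  \<comment> \<open>The power \<open>s ^ 5\<close> outweighs the factor \<open>1 / s ^ 3\<close> hidden in \<open>(1 + 1 / s) ^ 3\<close> and leaves \<open>s\<^sup>2\<close>.\<close>
  have "\<bar>heat_ker i x s\<bar> \<le> (1 + 1 / s) ^ 3 * (1 + \<bar>x\<bar>)\<^sup>2 * exp (- (x\<^sup>2 / (4 * s)))"
    using s by (intro abs_heat_ker_le) auto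
  also have "\<dots> \<le> ((1 + b) / s) ^ 3 * (2 * exp \<bar>x\<bar>) *
      (((40 / \<delta>\<^sup>2) ^ 5 * s ^ 5) * (exp (2 * b * (K + 1)\<^sup>2) * exp (- (K + 1) * \<bar>x\<bar>)))"
    using s assms E p square_le_exp[of x] by (intro mult_mono power_mono mult_nonneg_nonneg) auto
  also have "\<dots> = ?M * (s ^ 5 / s ^ 3) * (exp \<bar>x\<bar> * exp (- (K + 1) * \<bar>x\<bar>))"
    by (simp add: power_divide mult_ac)
  also have "s ^ 5 / s ^ 3 = s\<^sup>2" using s by (simp add: divide_simps flip: power_add)
  also have "exp \<bar>x\<bar> * exp (- (K + 1) * \<bar>x\<bar>) = exp (- K * \<bar>x\<bar>)"
    by (simp add: exp_add[symmetric] algebra_simps)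
  finally show "\<bar>heat_ker i x s\<bar> \<le> ?M * s\<^sup>2 * exp (- K * \<bar>x\<bar>)" .
qed

lemma integrable_exp_minus_abs: "integrable lborel (\<lambda>x::real. exp (- \<bar>x\<bar>))"
proof -
  have "has_bochner_integral lborel (\<lambda>x::real. indicator {0..} x *\<^sub>R exp (- \<bar>x\<bar>)) 1"
  proof (rule has_bochner_integral_nn_integral)
    have "(\<integral>\<^sup>+x. ennreal (indicator {0..} x *\<^sub>R exp (- \<bar>x\<bar>)) \<partial>lborel) =
        (\<integral>\<^sup>+x. ennreal (x ^ 0 * exp (- x)) * indicator {0..} x \<partial>lborel)"
      by (intro nn_integral_cong) (auto split: split_indicator)
    also have "\<dots> = 1" by (subst nn_intergal_power_times_exp_Ici) auto
    finally show "(\<integral>\<^sup>+x. ennreal (indicator {0..} x *\<^sub>R exp (- \<bar>x\<bar>)) \<partial>lborel) = ennreal 1" by simp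
  qed auto
  then have "has_bochner_integral lborel (\<lambda>x::real. exp (- \<bar>x\<bar>)) (2 *\<^sub>R 1)"
    by (rule has_bochner_integral_even_function) auto
  then show ?thesis by (simp add: has_bochner_integral_iff)
qed

section \<open>Heat potentials on the line\<close>

text \<open>Reflection at the vertices of a graph multiplies data by a bounded factor per unit length, so
extended data grow exponentially. The Gaussian tolerates this.\<close>

definition exp_growth :: "(real \<Rightarrow> real) \<Rightarrow> bool" where
  "exp_growth r \<longleftrightarrow> r \<in> borel_measurable borel \<and>
     (\<exists>A k. 0 \<le> A \<and> 0 \<le> k \<and> (\<forall>z. \<bar>r z\<bar> \<le> A * exp (k * \<bar>z\<bar>)))"

definition heat_pot :: "nat \<Rightarrow> (real \<Rightarrow> real) \<Rightarrow> real \<Rightarrow> real \<Rightarrow> real" where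
  "heat_pot i r y s = (\<integral>z. heat_ker i (y - z) s * r z \<partial>lborel)"

lemma exp_growth_measurable [measurable_dest]: "exp_growth r \<Longrightarrow> r \<in> borel_measurable borel"
  by (simp add: exp_growth_def)

text \<open>A kernel that decays faster than the data grow gives an integrand dominated uniformly in bounded \<open>y\<close>.\<close>

lemma translate_exp_decay:
  fixes y z A k Y :: real
  assumes "0 \<le> A" "0 \<le> k" "\<bar>y\<bar> \<le> Y" "\<bar>u\<bar> \<le> M * exp (- (k + 1) * \<bar>y - z\<bar>)" "\<bar>v\<bar> \<le> A * exp (k * \<bar>z\<bar>)" "0 \<le> M"
  shows "\<bar>u * v\<bar> \<le> M * A * exp ((k + 1) * Y) * exp (- \<bar>z\<bar>)"
proof -
  have "(k + 1) * \<bar>z\<bar> \<le> (k + 1) * (\<bar>y - z\<bar> + Y)"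
    using assms by (intro mult_left_mono) auto
  then have "- (k + 1) * \<bar>y - z\<bar> + k * \<bar>z\<bar> \<le> (k + 1) * Y + - \<bar>z\<bar>" by (simp add: algebra_simps)
  then have e: "exp (- (k + 1) * \<bar>y - z\<bar>) * exp (k * \<bar>z\<bar>) \<le> exp ((k + 1) * Y) * exp (- \<bar>z\<bar>)"
    unfolding exp_add[symmetric] by simp
  have "\<bar>u * v\<bar> \<le> (M * exp (- (k + 1) * \<bar>y - z\<bar>)) * (A * exp (k * \<bar>z\<bar>))"
    unfolding abs_mult using assms by (intro mult_mono) auto
  also have "\<dots> = M * A * (exp (- (k + 1) * \<bar>y - z\<bar>) * exp (k * \<bar>z\<bar>))" by (simp add: mult_ac)
  also have "\<dots> \<le> M * A * (exp ((k + 1) * Y) * exp (- \<bar>z\<bar>))"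
    using e assms by (intro mult_left_mono) auto
  finally show ?thesis by (simp add: mult_ac)
qed

lemma heat_pot_integrand_bound:
  assumes r: "exp_growth r" and ab: "0 < a" "a \<le> b"
  obtains C where "\<And>i y s z. a \<le> s \<Longrightarrow> s \<le> b \<Longrightarrow> \<bar>y\<bar> \<le> Y \<Longrightarrow> \<bar>heat_ker i (y - z) s * r z\<bar> \<le> C * exp (- \<bar>z\<bar>)"
proof -
  from r obtain A k where A: "0 \<le> A" "0 \<le> k" "\<And>z. \<bar>r z\<bar> \<le> A * exp (k * \<bar>z\<bar>)"
    by (auto simp: exp_growth_def)
  obtain M where M: "0 \<le> M" "\<And>i x s. a \<le> s \<Longrightarrow> s \<le> b \<Longrightarrow> \<bar>heat_ker i x s\<bar> \<le> M * exp (- (k + 1) * \<bar>x\<bar>)"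
    using heat_ker_bound_away_from_time_0[OF ab, of "k + 1"] by metis
  show thesis
    by (rule that[of "M * A * exp ((k + 1) * Y)"]) (rule translate_exp_decay[OF A(1,2) _ M(2) A(3) M(1)])
qed

lemma heat_pot_integrable:
  assumes "exp_growth r" "0 < s"
  shows "integrable lborel (\<lambda>z. heat_ker i (y - z) s * r z)"
proof -
  obtain C where C: "\<And>i y' s' z. s \<le> s' \<Longrightarrow> s' \<le> s \<Longrightarrow> \<bar>y'\<bar> \<le> \<bar>y\<bar> \<Longrightarrow> \<bar>heat_ker i (y' - z) s' * r z\<bar> \<le> C * exp (- \<bar>z\<bar>)"
    using heat_pot_integrand_bound[OF assms order_refl, of "\<bar>y\<bar>"] by metis
  note [measurable] = exp_growth_measurable[OF assms(1)]
  show ?thesis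
  proof (rule Bochner_Integration.integrable_bound)
    show "integrable lborel (\<lambda>z. C * exp (- \<bar>z\<bar>))" using integrable_exp_minus_abs by simp
    show "(\<lambda>z. heat_ker i (y - z) s * r z) \<in> borel_measurable lborel"
      by (intro borel_measurable_times measurable_compose[OF _ borel_measurable_heat_ker] measurable_lborel1) measurable
    show "AE z in lborel. norm (heat_ker i (y - z) s * r z) \<le> norm (C * exp (- \<bar>z\<bar>))"
    proof (rule AE_I2)
      fix z show "norm (heat_ker i (y - z) s * r z) \<le> norm (C * exp (- \<bar>z\<bar>))"
        using C[of s y i z] by simp
    qed
  qed
qed

lemma heat_pot_measurable_integrand:
  assumes "exp_growth r" "0 < s"
  shows "(\<lambda>z. heat_ker i (y - z) s * r z) \<in> borel_measurable lborel"
  using heat_pot_integrable[OF assms] by (rule borel_measurable_integrable)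

lemma heat_pot_space_deriv:
  assumes r: "exp_growth r" and s: "0 < s"
    and D: "\<And>x. ((\<lambda>x. heat_ker i x s) has_real_derivative heat_ker j x s) (at x)"
  shows "((\<lambda>y. heat_pot i r y s) has_real_derivative heat_pot j r y s) (at y)"
proof -
  obtain C where C: "\<And>i y' s' z. s \<le> s' \<Longrightarrow> s' \<le> s \<Longrightarrow> \<bar>y'\<bar> \<le> \<bar>y\<bar> + 1 \<Longrightarrow> \<bar>heat_ker i (y' - z) s' * r z\<bar> \<le> C * exp (- \<bar>z\<bar>)"
    using heat_pot_integrand_bound[OF assms(1,2) order_refl, of "\<bar>y\<bar> + 1"] by metis
  have "((\<lambda>y. heat_pot i r y s) has_real_derivative heat_pot j r y s) (at y within ball y 1)"
    unfolding heat_pot_def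
  proof (rule has_real_derivative_integral_dominated)
    fix x z :: real assume x: "x \<in> ball y 1"
    show "integrable lborel (\<lambda>z. heat_ker i (x - z) s * r z)" by (rule heat_pot_integrable[OF r s])
    have "((\<lambda>x. heat_ker i (x - z) s) has_real_derivative heat_ker j (x - z) s) (at x)"
      using DERIV_shift[of "\<lambda>x. heat_ker i x s" "heat_ker j (x - z) s" x "- z"] D[of "x - z"] by simp
    then show "((\<lambda>x. heat_ker i (x - z) s * r z) has_real_derivative heat_ker j (x - z) s * r z) (at x within ball y 1)"
      by (rule DERIV_cmult_right[OF has_field_derivative_at_within])
    show "\<bar>heat_ker j (x - z) s * r z\<bar> \<le> C * exp (- \<bar>z\<bar>)" using x by (intro C) (auto simp: dist_real_def)
  qed (use heat_pot_measurable_integrand[OF r s] integrable_exp_minus_abs in auto)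
  then show ?thesis by (simp add: at_within_open[of y "ball y 1"])
qed

lemma heat_pot_deriv_01: "exp_growth r \<Longrightarrow> 0 < s \<Longrightarrow> ((\<lambda>y. heat_pot 0 r y s) has_real_derivative heat_pot 1 r y s) (at y)"
  by (rule heat_pot_space_deriv) (auto intro: heat_ker_0_deriv simp del: One_nat_def)

lemma heat_pot_deriv_12: "exp_growth r \<Longrightarrow> 0 < s \<Longrightarrow> ((\<lambda>y. heat_pot 1 r y s) has_real_derivative heat_pot 2 r y s) (at y)"
  by (rule heat_pot_space_deriv) (auto intro: heat_ker_1_deriv simp del: One_nat_def)

lemma heat_pot_time_deriv:
  assumes r: "exp_growth r" and s: "0 < s"
  shows "((\<lambda>s. heat_pot 0 r y s) has_real_derivative heat_pot 2 r y s) (at s)"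
proof -
  have ss: "s / 2 \<le> 2 * s" "0 < s / 2" using s by auto
  obtain C where C: "\<And>i y' s' z. s / 2 \<le> s' \<Longrightarrow> s' \<le> 2 * s \<Longrightarrow> \<bar>y'\<bar> \<le> \<bar>y\<bar> \<Longrightarrow> \<bar>heat_ker i (y' - z) s' * r z\<bar> \<le> C * exp (- \<bar>z\<bar>)"
    using heat_pot_integrand_bound[OF r ss(2,1), of "\<bar>y\<bar>"] by metis
  let ?S = "{s / 2<..<2 * s}"
  have "((\<lambda>s. heat_pot 0 r y s) has_real_derivative heat_pot 2 r y s) (at s within ?S)"
    unfolding heat_pot_def
  proof (rule has_real_derivative_integral_dominated)
    fix x z :: real assume x: "x \<in> ?S"
    then have x0: "0 < x" using ss by auto
    show "integrable lborel (\<lambda>z. heat_ker 0 (y - z) x * r z)" by (rule heat_pot_integrable[OF r x0])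
    show "((\<lambda>x. heat_ker 0 (y - z) x * r z) has_real_derivative heat_ker 2 (y - z) x * r z) (at x within ?S)"
      by (intro DERIV_cmult_right heat_ker_0_time_deriv x0)
    show "\<bar>heat_ker 2 (y - z) x * r z\<bar> \<le> C * exp (- \<bar>z\<bar>)" using x by (intro C) auto
  qed (use s heat_pot_measurable_integrand[OF r s] integrable_exp_minus_abs in auto)
  then show ?thesis using s by (simp add: at_within_open[of s ?S])
qed

lemma continuous_on_heat_pot:
  assumes r: "exp_growth r"
  shows "continuous_on (UNIV \<times> {0<..}) (\<lambda>(y, s). heat_pot i r y s)"
  unfolding continuous_on_eq_continuous_within
proof safe
  fix y s :: real assume s: "0 < s"
  have ss: "s / 2 \<le> 2 * s" "0 < s / 2" using s by auto
  obtain C where C: "\<And>i y' s' z. s / 2 \<le> s' \<Longrightarrow> s' \<le> 2 * s \<Longrightarrow> \<bar>y'\<bar> \<le> \<bar>y\<bar> + 1 \<Longrightarrow> \<bar>heat_ker i (y' - z) s' * r z\<bar> \<le> C * exp (- \<bar>z\<bar>)"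
    using heat_pot_integrand_bound[OF r ss(2,1), of "\<bar>y\<bar> + 1"] by metis
  show "continuous (at (y, s) within UNIV \<times> {0<..}) (\<lambda>(y, s). heat_pot i r y s)"
    unfolding heat_pot_def case_prod_beta
  proof (rule continuous_within_integral_dominated)
    show "0 < min 1 (s / 2)" using s by simp
    show "(y, s) \<in> UNIV \<times> {0<..}" using s by simp
    show "(\<lambda>z. heat_ker i (fst x - z) (snd x) * r z) \<in> borel_measurable lborel" if "x \<in> UNIV \<times> {0<..}" for x
      using that by (intro heat_pot_measurable_integrand[OF r]) auto
    show "continuous (at (y, s) within UNIV \<times> {0<..}) (\<lambda>x. heat_ker i (fst x - z) (snd x) * r z)" for z
    proof -
      have "continuous_on (UNIV \<times> {0<..}) (\<lambda>x. (\<lambda>(x, s). heat_ker i x s) (fst x - z, snd x) * r z)"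
        by (intro continuous_on_mult continuous_on_compose2[OF continuous_on_heat_ker] continuous_intros) auto
      then show ?thesis using s by (simp add: continuous_on_eq_continuous_within)
    qed
    show "\<bar>heat_ker i (fst x - z) (snd x) * r z\<bar> \<le> C * exp (- \<bar>z\<bar>)"
      if "x \<in> UNIV \<times> {0<..}" "dist x (y, s) < min 1 (s / 2)" for x z
    proof (rule C)
      have "dist (fst x) y < 1" "dist (snd x) s < s / 2"
        using that dist_fst_le[of x "(y, s)"] dist_snd_le[of x "(y, s)"] by auto
      then show "\<bar>fst x\<bar> \<le> \<bar>y\<bar> + 1" "s / 2 \<le> snd x" "snd x \<le> 2 * s" unfolding dist_real_def using s by linarith+
    qed
    show "integrable lborel (\<lambda>z. C * exp (- \<bar>z\<bar>))" using integrable_exp_minus_abs by simp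
  qed
qed

lemma gaussian_mass: "has_bochner_integral lborel (\<lambda>x::real. exp (- x\<^sup>2) / sqrt pi) 1"
proof -
  have "has_bochner_integral lborel (\<lambda>x::real. exp (- x\<^sup>2)) (2 *\<^sub>R (sqrt pi / 2))"
    by (rule has_bochner_integral_even_function[OF gaussian_moment_0]) simp
  then have "has_bochner_integral lborel (\<lambda>x::real. exp (- x\<^sup>2) / sqrt pi) ((2 *\<^sub>R (sqrt pi / 2)) / sqrt pi)"
    by (rule has_bochner_integral_divide_zero)
  then show ?thesis by simp
qed

lemma heat_pot_0_scaled:
  assumes "0 < s"
  shows "heat_pot 0 r y s = (\<integral>x. exp (- x\<^sup>2) / sqrt pi * r (y + 2 * sqrt s * x) \<partial>lborel)"
proof -
  have s: "2 * sqrt s \<noteq> 0" using assms by simp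
  have "2 * sqrt s * (heat_ker 0 (y - (y + 2 * sqrt s * x)) s * r (y + 2 * sqrt s * x)) =
      exp (- x\<^sup>2) / sqrt pi * r (y + 2 * sqrt s * x)" for x
    using assms by (simp add: heat_ker_0 power_mult_distrib real_sqrt_mult)
  then show ?thesis
    unfolding heat_pot_def
    by (subst lborel_integral_real_affine[OF s, of _ y])
       (use assms in \<open>simp flip: integral_mult_right_zero\<close>)
qed

text \<open>In the variable \<open>(z - y) / (2 * sqrt s)\<close> the kernel no longer depends on \<open>s\<close>, and the formula makes sense
at \<open>s = 0\<close>. Dominated convergence then gives joint continuity down to the initial time.\<close>

lemma heat_pot_initial:
  assumes r: "exp_growth r" and cont: "continuous_on UNIV r"
  shows "continuous_on (UNIV \<times> {0..}) (\<lambda>(y, s). if s = 0 then r y else heat_pot 0 r y s)"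
proof -
  from r obtain A k where A: "0 \<le> A" "0 \<le> k" "\<And>z. \<bar>r z\<bar> \<le> A * exp (k * \<bar>z\<bar>)"
    by (auto simp: exp_growth_def)
  define P where "P = (\<lambda>p. \<integral>x. exp (- x\<^sup>2) / sqrt pi * r (fst p + 2 * sqrt (snd p) * x) \<partial>lborel)"
  have "continuous_on (UNIV \<times> {0..}) P"
    unfolding continuous_on_eq_continuous_within
  proof safe
    fix y s :: real assume s: "0 \<le> s"
    define Y b where "Y = \<bar>y\<bar> + 1" and "b = 2 * sqrt (s + 1)"
    define K where "K = k * b + 1"
    show "continuous (at (y, s) within UNIV \<times> {0..}) P"
      unfolding P_def
    proof (rule continuous_within_integral_dominated)
      show "0 < (1::real)" by simp
      show "(y, s) \<in> UNIV \<times> {0..}" using s by simp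
      show "(\<lambda>x. exp (- x\<^sup>2) / sqrt pi * r (fst p + 2 * sqrt (snd p) * x)) \<in> borel_measurable lborel"
        if "p \<in> UNIV \<times> {0..}" for p
        using exp_growth_measurable[OF r] by measurable
      show "continuous (at (y, s) within UNIV \<times> {0..}) (\<lambda>p. exp (- x\<^sup>2) / sqrt pi * r (fst p + 2 * sqrt (snd p) * x))" for x
      proof -
        have "continuous_on (UNIV \<times> {0..}) (\<lambda>p. exp (- x\<^sup>2) / sqrt pi * r (fst p + 2 * sqrt (snd p) * x))"
          by (intro continuous_on_mult continuous_on_compose2[OF cont] continuous_intros) auto
        then show ?thesis using s by (simp add: continuous_on_eq_continuous_within)
      qed
      show "\<bar>exp (- x\<^sup>2) / sqrt pi * r (fst p + 2 * sqrt (snd p) * x)\<bar> \<le>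
          exp (1 / 4 * K\<^sup>2) / sqrt pi * A * exp (k * Y) * exp (- \<bar>x\<bar>)"
        if p: "p \<in> UNIV \<times> {0..}" "dist p (y, s) < 1" for p x
      proof -
        have "dist (fst p) y < 1" "dist (snd p) s < 1"
          using p dist_fst_le[of p "(y, s)"] dist_snd_le[of p "(y, s)"] by auto
        then have d: "\<bar>fst p\<bar> \<le> Y" "snd p \<le> s + 1" "0 \<le> snd p" using p by (auto simp: dist_real_def Y_def)
        have "2 * sqrt (snd p) \<le> b" using d by (simp add: b_def)
        then have "2 * sqrt (snd p) * \<bar>x\<bar> \<le> b * \<bar>x\<bar>" by (rule mult_right_mono) simp
        moreover have "\<bar>2 * sqrt (snd p) * x\<bar> = 2 * sqrt (snd p) * \<bar>x\<bar>" using d by (simp add: abs_mult)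
        ultimately have "\<bar>fst p + 2 * sqrt (snd p) * x\<bar> \<le> Y + b * \<bar>x\<bar>" using d by linarith
        then have "k * \<bar>fst p + 2 * sqrt (snd p) * x\<bar> \<le> k * (Y + b * \<bar>x\<bar>)"
          using A by (intro mult_left_mono)
        then have "\<bar>r (fst p + 2 * sqrt (snd p) * x)\<bar> \<le> A * exp (k * (Y + b * \<bar>x\<bar>))"
          using A by (meson exp_le_cancel_iff mult_left_mono order_trans)
        moreover have "exp (- x\<^sup>2) \<le> exp (1 / 4 * K\<^sup>2) * exp (- K * \<bar>x\<bar>)"
          using gauss_absorbs_exp[of "1 / 4" x K] by simp
        ultimately have "exp (- x\<^sup>2) * \<bar>r (fst p + 2 * sqrt (snd p) * x)\<bar> \<le>
            (exp (1 / 4 * K\<^sup>2) * exp (- K * \<bar>x\<bar>)) * (A * exp (k * (Y + b * \<bar>x\<bar>)))"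
          by (intro mult_mono) auto
        also have "\<dots> = exp (1 / 4 * K\<^sup>2) * A * exp (k * Y) * exp (- \<bar>x\<bar>)"
          by (simp add: K_def algebra_simps flip: exp_add)
        finally have "exp (- x\<^sup>2) * \<bar>r (fst p + 2 * sqrt (snd p) * x)\<bar> / sqrt pi \<le>
            exp (1 / 4 * K\<^sup>2) * A * exp (k * Y) * exp (- \<bar>x\<bar>) / sqrt pi"
          by (rule divide_right_mono) simp
        then show ?thesis by (simp add: abs_mult)
      qed
      show "integrable lborel (\<lambda>x. exp (1 / 4 * K\<^sup>2) / sqrt pi * A * exp (k * Y) * exp (- \<bar>x\<bar>))"
        using integrable_exp_minus_abs by simp
    qed
  qed
  moreover have "P p = (\<lambda>(y, s). if s = 0 then r y else heat_pot 0 r y s) p" if "p \<in> UNIV \<times> {0..}" for p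
  proof (cases "snd p = 0")
    case True
    then have "P p = (\<integral>x. exp (- x\<^sup>2) / sqrt pi * r (fst p) \<partial>lborel)" by (simp add: P_def)
    also have "\<dots> = (\<integral>x. exp (- x\<^sup>2) / sqrt pi \<partial>lborel) * r (fst p)" by (rule integral_mult_left_zero)
    also have "(\<integral>x. exp (- x\<^sup>2) / sqrt pi \<partial>lborel) = 1"
      using gaussian_mass by (rule has_bochner_integral_integral_eq)
    finally show ?thesis using True by (simp add: case_prod_beta)
  next
    case False
    then show ?thesis using that by (auto simp: P_def case_prod_beta heat_pot_0_scaled)
  qed
  ultimately show ?thesis using continuous_on_eq by blast
qed

text \<open>Extension by zero to nonpositive times turns a Duhamel integral over \<open>{0..t}\<close> into one over a fixed
interval, which may be differentiated in \<open>t\<close> without boundary terms.\<close>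

definition heat_ext :: "nat \<Rightarrow> (real \<Rightarrow> real) \<Rightarrow> real \<Rightarrow> real \<Rightarrow> real" where
  "heat_ext i r y s = (if 0 < s then heat_pot i r y s else 0)"

lemma heat_pot_flat_bound:
  assumes r: "exp_growth r" and \<delta>: "0 < \<delta>" and flat: "\<And>z. \<bar>z - y0\<bar> < 2 * \<delta> \<Longrightarrow> r z = 0"
  obtains C where "0 \<le> C"
    "\<And>i y s. \<bar>y - y0\<bar> < \<delta> \<Longrightarrow> s \<le> 1 \<Longrightarrow> \<bar>heat_ext i r y s\<bar> \<le> C * (max 0 s)\<^sup>2"
proof -
  from r obtain A k where A: "0 \<le> A" "0 \<le> k" "\<And>z. \<bar>r z\<bar> \<le> A * exp (k * \<bar>z\<bar>)"
    by (auto simp: exp_growth_def)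
  obtain M where M: "0 \<le> M" "\<And>i x s. 0 < s \<Longrightarrow> s \<le> 1 \<Longrightarrow> \<delta> \<le> \<bar>x\<bar> \<Longrightarrow> \<bar>heat_ker i x s\<bar> \<le> M * s\<^sup>2 * exp (- (k + 1) * \<bar>x\<bar>)"
    using heat_ker_bound_away_from_origin[of 1 \<delta> "k + 1"] \<delta> by (metis zero_less_one)
  define Y where "Y = \<bar>y0\<bar> + \<delta>"
  define D where "D = M * A * exp ((k + 1) * Y)"
  have D: "0 \<le> D" using M A by (simp add: D_def)
  define C where "C = D * (\<integral>z. exp (- \<bar>z\<bar>) \<partial>lborel)"
  have bound: "\<bar>heat_pot i r y s\<bar> \<le> C * s\<^sup>2" if y: "\<bar>y - y0\<bar> < \<delta>" and s: "0 < s" "s \<le> 1" for i y s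
  proof -
    have pt: "\<bar>heat_ker i (y - z) s * r z\<bar> \<le> s\<^sup>2 * D * exp (- \<bar>z\<bar>)" for z
    proof (cases "\<bar>z - y0\<bar> < 2 * \<delta>")
      case True then show ?thesis using flat D by simp
    next
      case False
      then have "\<delta> \<le> \<bar>y - z\<bar>" using y by linarith
      then have "\<bar>heat_ker i (y - z) s * r z\<bar> \<le> (M * s\<^sup>2) * A * exp ((k + 1) * Y) * exp (- \<bar>z\<bar>)"
        using y M s A by (intro translate_exp_decay) (auto simp: Y_def)
      then show ?thesis by (simp add: D_def mult_ac)
    qed
    have "\<bar>heat_pot i r y s\<bar> \<le> (\<integral>z. \<bar>heat_ker i (y - z) s * r z\<bar> \<partial>lborel)"
      unfolding heat_pot_def by (rule integral_abs_bound)
    also have "\<dots> \<le> (\<integral>z. s\<^sup>2 * D * exp (- \<bar>z\<bar>) \<partial>lborel)"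
      using pt heat_pot_integrable[OF r s(1)] integrable_exp_minus_abs
      by (intro integral_mono integrable_abs integrable_mult_right) auto
    also have "\<dots> = C * s\<^sup>2" by (simp add: C_def mult_ac)
    finally show ?thesis .
  qed
  show thesis
  proof (rule that[of C])
    show "0 \<le> C" unfolding C_def using D by (intro mult_nonneg_nonneg Bochner_Integration.integral_nonneg) auto
    then show "\<bar>heat_ext i r y s\<bar> \<le> C * (max 0 s)\<^sup>2" if "\<bar>y - y0\<bar> < \<delta>" "s \<le> 1" for i y s
      using bound[OF that(1) _ that(2), of i] by (auto simp: heat_ext_def max_def)
  qed
qed

lemma flat_radius:
  fixes y :: real
  assumes "open V" "y \<in> V" "\<And>z. z \<in> V \<Longrightarrow> r z = 0"
  shows "\<exists>\<delta>>0. \<forall>z. \<bar>z - y\<bar> < 2 * \<delta> \<longrightarrow> r z = 0"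
proof -
  obtain e where e: "0 < e" "\<And>z. dist z y < e \<Longrightarrow> z \<in> V"
    using assms(1,2) by (auto simp: open_dist)
  show ?thesis using e assms(3) by (intro exI[of _ "e / 2"]) (auto simp: dist_real_def)
qed

text \<open>Where the data vanish, extension by zero does not create a singularity at time zero, by the
quadratic bound above.\<close>

lemma continuous_on_heat_ext:
  assumes r: "exp_growth r" and "open V" and flat: "\<And>z. z \<in> V \<Longrightarrow> r z = 0"
  shows "continuous_on (V \<times> UNIV) (\<lambda>(y, s). heat_ext i r y s)"
proof (rule continuous_at_imp_continuous_on, safe)
  fix y s :: real assume y: "y \<in> V"
  show "isCont (\<lambda>(y, s). heat_ext i r y s) (y, s)"
  proof (cases "0 < s")
    case True
    have "isCont (\<lambda>(y, s). heat_pot i r y s) (y, s)"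
      using continuous_on_heat_pot[OF r, of i] True
      by (subst (asm) continuous_on_eq_continuous_at) (auto intro: open_Times)
    moreover have "eventually (\<lambda>p. p \<in> UNIV \<times> {0<..}) (nhds (y, s))"
      using True by (intro eventually_nhds_in_open open_Times) auto
    then have "eventually (\<lambda>p. (\<lambda>(y, s). heat_pot i r y s) p = (\<lambda>(y, s). heat_ext i r y s) p) (nhds (y, s))"
      by eventually_elim (auto simp: heat_ext_def)
    ultimately show ?thesis by (simp add: isCont_cong)
  next
    case False
    obtain \<delta> where \<delta>: "0 < \<delta>" "\<And>z. \<bar>z - y\<bar> < 2 * \<delta> \<Longrightarrow> r z = 0"
      using flat_radius[of V y r, OF \<open>open V\<close> y flat] by blast
    obtain C where C: "0 \<le> C" "\<And>i y' s. \<bar>y' - y\<bar> < \<delta> \<Longrightarrow> s \<le> 1 \<Longrightarrow> \<bar>heat_ext i r y' s\<bar> \<le> C * (max 0 s)\<^sup>2"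
      using heat_pot_flat_bound[OF r \<delta>] by blast
    have "((\<lambda>(y, s). heat_ext i r y s) \<longlongrightarrow> 0) (at (y, s))"
    proof (rule Lim_null_comparison)
      have "eventually (\<lambda>p. p \<in> {y - \<delta><..<y + \<delta>} \<times> {..<1}) (at (y, s))"
        using False \<delta> by (intro eventually_at_in_open' open_Times) auto
      then show "\<forall>\<^sub>F p in at (y, s). norm ((\<lambda>(y, s). heat_ext i r y s) p) \<le> C * (max 0 (snd p))\<^sup>2"
        by eventually_elim (use C in auto)
      have "((\<lambda>p. C * (max 0 (snd p))\<^sup>2) \<longlongrightarrow> C * (max 0 (snd (y, s)))\<^sup>2) (at (y, s))"
        by (intro tendsto_intros)
      then show "((\<lambda>p. C * (max 0 (snd p))\<^sup>2) \<longlongrightarrow> 0) (at (y, s))" using False by simp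
    qed
    then show ?thesis using False by (simp add: isCont_def heat_ext_def)
  qed
qed

lemma heat_ext_deriv_01: "exp_growth r \<Longrightarrow> ((\<lambda>y. heat_ext 0 r y s) has_real_derivative heat_ext 1 r y s) (at y)"
  using heat_pot_deriv_01[of r s y] by (auto simp: heat_ext_def)

lemma heat_ext_deriv_12: "exp_growth r \<Longrightarrow> ((\<lambda>y. heat_ext 1 r y s) has_real_derivative heat_ext 2 r y s) (at y)"
  using heat_pot_deriv_12[of r s y] by (auto simp: heat_ext_def)

lemma heat_ext_time_deriv:
  assumes r: "exp_growth r" and "open V" "y \<in> V" and flat: "\<And>z. z \<in> V \<Longrightarrow> r z = 0"
  shows "((\<lambda>s. heat_ext 0 r y s) has_real_derivative heat_ext 2 r y s) (at s)"
proof -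
  consider "s > 0" | "s < 0" | "s = 0" by linarith
  then show ?thesis
  proof cases
    case 1
    then have "((\<lambda>s. heat_pot 0 r y s) has_real_derivative heat_ext 2 r y s) (at s)"
      using heat_pot_time_deriv[OF r] by (simp add: heat_ext_def)
    then show ?thesis
      by (rule has_field_derivative_transform_within_open[of _ _ _ "{0<..}"]) (use 1 in \<open>auto simp: heat_ext_def\<close>)
  next
    case 2
    have "((\<lambda>s. 0) has_real_derivative heat_ext 2 r y s) (at s)" using 2 by (simp add: heat_ext_def)
    then show ?thesis
      by (rule has_field_derivative_transform_within_open[of _ _ _ "{..<0}"]) (use 2 in \<open>auto simp: heat_ext_def\<close>)
  next
    case 3
    obtain \<delta> where \<delta>: "0 < \<delta>" "\<And>z. \<bar>z - y\<bar> < 2 * \<delta> \<Longrightarrow> r z = 0"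
      using flat_radius[of V y r, OF assms(2,3) flat] by blast
    obtain C where C: "0 \<le> C" "\<And>i y' s. \<bar>y' - y\<bar> < \<delta> \<Longrightarrow> s \<le> 1 \<Longrightarrow> \<bar>heat_ext i r y' s\<bar> \<le> C * (max 0 s)\<^sup>2"
      using heat_pot_flat_bound[OF r \<delta>] by blast
    have "((\<lambda>h. (heat_ext 0 r y (0 + h) - heat_ext 0 r y 0) / h) \<longlongrightarrow> 0) (at 0)"
    proof (rule Lim_null_comparison)
      have "eventually (\<lambda>h::real. h \<in> {..<1}) (at 0)" by (intro eventually_at_in_open') auto
      moreover have "eventually (\<lambda>h::real. h \<noteq> 0) (at 0)" by (simp add: eventually_at_filter)
      ultimately show "\<forall>\<^sub>F h in at 0. norm ((heat_ext 0 r y (0 + h) - heat_ext 0 r y 0) / h) \<le> C * \<bar>h\<bar>"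
      proof eventually_elim
        case (elim h)
        have "\<bar>heat_ext 0 r y h\<bar> \<le> C * (max 0 h)\<^sup>2" using elim \<delta> by (intro C) auto
        also have "\<dots> \<le> C * \<bar>h\<bar>\<^sup>2" using C by (intro mult_left_mono power_mono) auto
        finally have "\<bar>heat_ext 0 r y h\<bar> \<le> C * \<bar>h\<bar> * \<bar>h\<bar>" by (simp add: power2_eq_square)
        then show ?case using elim by (simp add: heat_ext_def[of _ _ _ 0] divide_le_eq)
      qed
      have "((\<lambda>h::real. C * \<bar>h\<bar>) \<longlongrightarrow> C * \<bar>0\<bar>) (at 0)" by (intro tendsto_intros)
      then show "((\<lambda>h::real. C * \<bar>h\<bar>) \<longlongrightarrow> 0) (at 0)" by simp
    qed
    then show ?thesis using 3 by (simp add: DERIV_def heat_ext_def[of 2])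
  qed
qed

lemma exp_growth_add: "exp_growth r \<Longrightarrow> exp_growth q \<Longrightarrow> exp_growth (\<lambda>z. r z + q z)"
proof -
  assume r: "exp_growth r" and q: "exp_growth q"
  then obtain A k B l where A: "0 \<le> A" "0 \<le> k" "\<And>z. \<bar>r z\<bar> \<le> A * exp (k * \<bar>z\<bar>)"
    and B: "0 \<le> B" "0 \<le> l" "\<And>z. \<bar>q z\<bar> \<le> B * exp (l * \<bar>z\<bar>)"
    unfolding exp_growth_def by blast
  have "\<bar>r z + q z\<bar> \<le> (A + B) * exp ((k + l) * \<bar>z\<bar>)" for z
  proof -
    have "\<bar>r z + q z\<bar> \<le> A * exp (k * \<bar>z\<bar>) + B * exp (l * \<bar>z\<bar>)" using A(3)[of z] B(3)[of z] by linarith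
    also have "\<dots> \<le> A * exp ((k + l) * \<bar>z\<bar>) + B * exp ((k + l) * \<bar>z\<bar>)"
      using A B by (intro add_mono mult_left_mono) (auto intro: mult_right_mono)
    finally show ?thesis by (simp add: distrib_right)
  qed
  moreover have "(\<lambda>z. r z + q z) \<in> borel_measurable borel"
    using exp_growth_measurable[OF r] exp_growth_measurable[OF q] by measurable
  ultimately show ?thesis unfolding exp_growth_def using A B by (meson add_nonneg_nonneg)
qed

lemma exp_growth_cmult: "exp_growth r \<Longrightarrow> exp_growth (\<lambda>z. c * r z)"
proof -
  assume r: "exp_growth r"
  then obtain A k where A: "0 \<le> A" "0 \<le> k" "\<And>z. \<bar>r z\<bar> \<le> A * exp (k * \<bar>z\<bar>)"
    unfolding exp_growth_def by blast
  have "\<bar>c * r z\<bar> \<le> (\<bar>c\<bar> * A) * exp (k * \<bar>z\<bar>)" for z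
    using mult_left_mono[OF A(3)[of z], of "\<bar>c\<bar>"] by (simp add: abs_mult mult_ac)
  moreover have "(\<lambda>z. c * r z) \<in> borel_measurable borel"
    using exp_growth_measurable[OF r] by measurable
  ultimately show ?thesis unfolding exp_growth_def using A by (meson mult_nonneg_nonneg abs_ge_zero)
qed

lemma exp_growth_bounded: "r \<in> borel_measurable borel \<Longrightarrow> (\<And>z. \<bar>r z\<bar> \<le> A) \<Longrightarrow> exp_growth r"
  unfolding exp_growth_def by (intro conjI exI[of _ A] exI[of _ 0]) (auto intro: order_trans[OF abs_ge_zero])

lemma exp_growth_diff: "exp_growth r \<Longrightarrow> exp_growth q \<Longrightarrow> exp_growth (\<lambda>z. r z - q z)"
  using exp_growth_add[OF _ exp_growth_cmult[of q "- 1"], of r] by simp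

lemma exp_growth_reflect: "exp_growth r \<Longrightarrow> exp_growth (\<lambda>z. r (c - z))"
proof -
  assume r: "exp_growth r"
  then obtain A k where A: "0 \<le> A" "0 \<le> k" "\<And>z. \<bar>r z\<bar> \<le> A * exp (k * \<bar>z\<bar>)"
    unfolding exp_growth_def by blast
  have "\<bar>r (c - z)\<bar> \<le> (A * exp (k * \<bar>c\<bar>)) * exp (k * \<bar>z\<bar>)" for z
  proof -
    have "k * \<bar>c - z\<bar> \<le> k * (\<bar>c\<bar> + \<bar>z\<bar>)" using A by (intro mult_left_mono) auto
    then have "A * exp (k * \<bar>c - z\<bar>) \<le> A * exp (k * \<bar>c\<bar> + k * \<bar>z\<bar>)"
      using A by (intro mult_left_mono) (auto simp: distrib_left)
    then show ?thesis using A(3)[of "c - z"] by (simp add: exp_add)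
  qed
  moreover have "(\<lambda>z. r (c - z)) \<in> borel_measurable borel"
    using exp_growth_measurable[OF r] by measurable
  ultimately show ?thesis unfolding exp_growth_def using A by (meson mult_nonneg_nonneg exp_ge_zero)
qed

lemma heat_pot_add: "exp_growth r \<Longrightarrow> exp_growth q \<Longrightarrow> 0 < s \<Longrightarrow>
    heat_pot i (\<lambda>z. r z + q z) y s = heat_pot i r y s + heat_pot i q y s"
  unfolding heat_pot_def distrib_left
  by (rule Bochner_Integration.integral_add) (rule heat_pot_integrable; assumption)+

lemma heat_pot_cmult: "heat_pot i (\<lambda>z. c * r z) y s = c * heat_pot i r y s"
  unfolding heat_pot_def by (simp add: mult.left_commute[of _ c])

lemma heat_pot_diff: "exp_growth r \<Longrightarrow> exp_growth q \<Longrightarrow> 0 < s \<Longrightarrow>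
    heat_pot i (\<lambda>z. r z - q z) y s = heat_pot i r y s - heat_pot i q y s"
  unfolding heat_pot_def right_diff_distrib
  by (rule Bochner_Integration.integral_diff) (rule heat_pot_integrable; assumption)+

lemma heat_pot_sum: "(\<And>a. a \<in> S \<Longrightarrow> exp_growth (f a)) \<Longrightarrow> 0 < s \<Longrightarrow>
    heat_pot i (\<lambda>z. \<Sum>a\<in>S. f a z) y s = (\<Sum>a\<in>S. heat_pot i (f a) y s)"
  unfolding heat_pot_def sum_distrib_left
  by (rule Bochner_Integration.integral_sum) (auto intro: heat_pot_integrable)

lemma heat_pot_reflect: "heat_pot i (\<lambda>z. r (c - z)) y s = (if i = 1 then - 1 else 1) * heat_pot i r (c - y) s"
proof -
  have "heat_ker i (y - (c + - 1 * z)) s * r (c - (c + - 1 * z)) = (if i = 1 then - 1 else 1) * (heat_ker i (c - y - z) s * r z)" for z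
    using heat_ker_minus[of i "c - y - z" s] by (simp add: algebra_simps)
  moreover have "heat_pot i (\<lambda>z. r (c - z)) y s = (\<integral>z. heat_ker i (y - (c + - 1 * z)) s * r (c - (c + - 1 * z)) \<partial>lborel)"
    unfolding heat_pot_def by (subst lborel_integral_real_affine[of "- 1" _ c]) simp_all
  ultimately show ?thesis by (simp only: heat_pot_def integral_mult_right_zero)
qed

text \<open>This gives the continuity and the Dirichlet conditions at a vertex, and the next lemma
the Kirchhoff condition.\<close>

lemma heat_pot_0_odd:
  assumes "\<And>z. r (- z) = - r z" shows "heat_pot 0 r 0 s = 0"
  using heat_pot_reflect[of 0 r 0 0 s] heat_pot_cmult[of 0 "- 1" r 0 s] assms by simp

lemma heat_pot_1_even:
  assumes "\<And>z. r (- z) = r z" shows "heat_pot 1 r 0 s = 0"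
  using heat_pot_reflect[of 1 r 0 0 s] assms by simp

lemma heat_pot_0_const:
  assumes "0 < s" shows "heat_pot 0 (\<lambda>_. c) y s = c"
proof -
  have "heat_pot 0 (\<lambda>_. c) y s = (\<integral>x. exp (- x\<^sup>2) / sqrt pi \<partial>lborel) * c"
    unfolding heat_pot_0_scaled[OF assms] by (rule integral_mult_left_zero)
  then show ?thesis by (simp only: has_bochner_integral_integral_eq[OF gaussian_mass])
qed

lemma heat_pot_1_const: "0 < s \<Longrightarrow> heat_pot 1 (\<lambda>_. c) y s = 0"
  using heat_pot_reflect[of 1 "\<lambda>_. c" "2 * y" y s] by simp

section \<open>Duhamel integrals\<close>

text \<open>The integral runs over all of \<open>{0..T}\<close>; the kernels in use vanish for \<open>s \<ge> t\<close>.\<close>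

definition duhamel :: "real \<Rightarrow> (real \<Rightarrow> real) \<Rightarrow> (real \<Rightarrow> real \<Rightarrow> real) \<Rightarrow> real \<Rightarrow> real \<Rightarrow> real" where
  "duhamel T h V y t = integral {0..T} (\<lambda>s. V y (t - s) * h s)"

lemma continuous_on_kernel_compose:
  assumes V: "continuous_on (A \<times> B) (\<lambda>(y, s). V y s)"
    and f: "continuous_on S f" and g: "continuous_on S g" and im: "\<And>x. x \<in> S \<Longrightarrow> f x \<in> A" "\<And>x. x \<in> S \<Longrightarrow> g x \<in> B"
  shows "continuous_on S (\<lambda>x. V (f x) (g x))"
  using continuous_on_compose2[OF V continuous_on_Pair[OF f g]] im by auto

lemma continuous_on_duhamel_integrand:
  fixes V :: "real \<Rightarrow> real \<Rightarrow> real"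
  assumes V: "continuous_on (A \<times> UNIV) (\<lambda>(y, s). V y s)" and h: "continuous_on {0..T} h"
  shows "continuous_on ((A \<times> UNIV) \<times> {0..T}) (\<lambda>(p, s). V (fst p) (snd p - s) * h s)"
  unfolding case_prod_beta
  by (intro continuous_on_mult continuous_on_kernel_compose[OF V]
      continuous_on_compose2[OF h] continuous_intros) auto

lemma continuous_on_duhamel:
  assumes V: "continuous_on (A \<times> UNIV) (\<lambda>(y, s). V y s)" and h: "continuous_on {0..T} h"
  shows "continuous_on (A \<times> UNIV) (\<lambda>(y, t). duhamel T h V y t)"
  using integral_continuous_on_param[of "A \<times> UNIV" 0 T "\<lambda>p s. V (fst p) (snd p - s) * h s"]
    continuous_on_duhamel_integrand[OF assms]
  by (simp add: duhamel_def case_prod_beta)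

lemma duhamel_integrable:
  fixes V :: "real \<Rightarrow> real \<Rightarrow> real"
  assumes V: "continuous_on (A \<times> UNIV) (\<lambda>(y, s). V y s)" and h: "continuous_on {0..T} h" and "y \<in> A"
  shows "(\<lambda>s. V y (t - s) * h s) integrable_on {0..T}"
  by (intro integrable_continuous_real continuous_on_mult h
      continuous_on_kernel_compose[OF V] continuous_intros) (use assms in auto)

lemma duhamel_space_deriv:
  assumes V: "continuous_on (A \<times> UNIV) (\<lambda>(y, s). V y s)" and V': "continuous_on (A \<times> UNIV) (\<lambda>(y, s). V' y s)"
    and h: "continuous_on {0..T} h" and A: "convex A" "y \<in> A"
    and D: "\<And>y s. y \<in> A \<Longrightarrow> ((\<lambda>y. V y s) has_real_derivative V' y s) (at y within A)"
  shows "((\<lambda>y. duhamel T h V y t) has_real_derivative duhamel T h V' y t) (at y within A)"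
proof -
  have "continuous_on (A \<times> {0..T}) (\<lambda>(y, s). V' y (t - s) * h s)"
    unfolding case_prod_beta
    by (intro continuous_on_mult continuous_on_kernel_compose[OF V']
      continuous_on_compose2[OF h] continuous_intros) auto
  moreover have "((\<lambda>y. V y (t - s) * h s) has_real_derivative V' y (t - s) * h s) (at y within A)" if "y \<in> A" for y s
    by (rule DERIV_cmult_right[OF D[OF that]])
  ultimately show ?thesis
    unfolding duhamel_def
    using leibniz_rule_field_derivative[of A 0 T "\<lambda>y s. V y (t - s) * h s" "\<lambda>y s. V' y (t - s) * h s" y]
      duhamel_integrable[OF V h] A by auto
qed

lemma duhamel_time_deriv:
  assumes V: "continuous_on (A \<times> UNIV) (\<lambda>(y, s). V y s)" and V': "continuous_on (A \<times> UNIV) (\<lambda>(y, s). V' y s)"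
    and h: "continuous_on {0..T} h" and y: "y \<in> A"
    and D: "\<And>s. ((\<lambda>s. V y s) has_real_derivative V' y s) (at s)"
  shows "((\<lambda>t. duhamel T h V y t) has_real_derivative duhamel T h V' y t) (at t)"
proof -
  have "continuous_on (UNIV \<times> {0..T}) (\<lambda>(t, s). V' y (t - s) * h s)"
    unfolding case_prod_beta
    by (intro continuous_on_mult continuous_on_kernel_compose[OF V']
      continuous_on_compose2[OF h] continuous_intros) (use y in auto)
  moreover have "((\<lambda>t. V y (t - s) * h s) has_real_derivative V' y (t - s) * h s) (at t)" for t s
  proof -
    have "((\<lambda>t. V y (t + - s)) has_real_derivative V' y (t - s)) (at t)"
      using D[of "t - s"] by (subst DERIV_shift[symmetric]) simp
    then show ?thesis by (intro DERIV_cmult_right) simp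
  qed
  ultimately show ?thesis
    unfolding duhamel_def
    using leibniz_rule_field_derivative[of UNIV 0 T "\<lambda>t s. V y (t - s) * h s" "\<lambda>t s. V' y (t - s) * h s" t]
      duhamel_integrable[OF V h y] by auto
qed

section \<open>The half line\<close>

text \<open>The data equal \<open>2\<close> on the negative axis and \<open>0\<close> on the positive one. On the positive axis their heat
evolution is the solution with zero initial value and boundary value \<open>1\<close>. The value \<open>1\<close> at the origin
makes \<open>1 - unit_step\<close> an odd function.\<close>

definition unit_step :: "real \<Rightarrow> real" where "unit_step z = 1 - sgn z"

lemma exp_growth_unit_step: "exp_growth unit_step"
proof (rule exp_growth_bounded)
  show "unit_step \<in> borel_measurable borel" unfolding unit_step_def[abs_def] by measurable
  show "\<bar>unit_step z\<bar> \<le> 2" for z by (simp add: unit_step_def sgn_if)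
qed

abbreviation "bdry_ker i \<equiv> heat_ext i unit_step"

lemma unit_step_flat: "z \<in> {0<..} \<Longrightarrow> unit_step z = 0"
  by (simp add: unit_step_def)

lemma continuous_on_bdry_ker: "continuous_on ({0<..} \<times> UNIV) (\<lambda>(y, s). bdry_ker i y s)"
  by (rule continuous_on_heat_ext[OF exp_growth_unit_step _ unit_step_flat]) auto

lemma bdry_ker_time_deriv: "0 < y \<Longrightarrow> ((\<lambda>s. bdry_ker 0 y s) has_real_derivative bdry_ker 2 y s) (at s)"
  by (rule heat_ext_time_deriv[OF exp_growth_unit_step _ _ unit_step_flat, of "{0<..}"]) auto

lemma bdry_ker_scaled_integrable: "integrable lborel (\<lambda>x. exp (- x\<^sup>2) / sqrt pi * unit_step (y + c * x))"
proof (rule Bochner_Integration.integrable_bound)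
  show "integrable lborel (\<lambda>x::real. 2 * (exp (- x\<^sup>2) / sqrt pi))"
    using gaussian_mass by (intro integrable_mult_right) (simp only: has_bochner_integral_iff)
  show "(\<lambda>x. exp (- x\<^sup>2) / sqrt pi * unit_step (y + c * x)) \<in> borel_measurable lborel"
    using exp_growth_measurable[OF exp_growth_unit_step] by measurable
  show "AE x in lborel. norm (exp (- x\<^sup>2) / sqrt pi * unit_step (y + c * x)) \<le> norm (2 * (exp (- x\<^sup>2) / sqrt pi))"
    by (rule AE_I2) (auto simp: unit_step_def sgn_if divide_simps)
qed

lemma bdry_ker_0_origin: assumes "0 < s" shows "bdry_ker 0 0 s = 1"
proof -
  have "exp_growth sgn" by (rule exp_growth_bounded[of _ 1]) (auto simp: sgn_if)
  then have "heat_pot 0 unit_step 0 s = heat_pot 0 (\<lambda>_. 1) 0 s - heat_pot 0 sgn 0 s"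
    unfolding unit_step_def[abs_def] using assms
    by (intro heat_pot_diff exp_growth_bounded[of _ 1]) auto
  then show ?thesis using assms by (simp add: heat_ext_def heat_pot_0_const heat_pot_0_odd sgn_minus)
qed

lemma bdry_ker_0_nonneg: "0 \<le> bdry_ker 0 y s"
  unfolding heat_ext_def
  by (auto simp: heat_pot_0_scaled unit_step_def sgn_if intro!: Bochner_Integration.integral_nonneg)

lemma sgn_mono: "x \<le> y \<Longrightarrow> sgn x \<le> sgn y" for x y :: real
  by (auto simp: sgn_if)

lemma bdry_ker_0_le_1: assumes "0 \<le> y" shows "bdry_ker 0 y s \<le> 1"
proof (cases "0 < s")
  case True
  have "heat_pot 0 unit_step y s \<le> heat_pot 0 unit_step 0 s"
    unfolding heat_pot_0_scaled[OF True]
    by (intro integral_mono bdry_ker_scaled_integrable mult_left_mono) (use assms in \<open>auto simp: unit_step_def intro!: sgn_mono\<close>)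
  then show ?thesis using True bdry_ker_0_origin[OF True] by (simp add: heat_ext_def)
qed (simp add: heat_ext_def)

text \<open>After rescaling, the Gaussian is integrated over the half line below \<open>- y / (2 * sqrt s)\<close>, which grows with \<open>s\<close>.\<close>

lemma bdry_ker_0_mono: assumes "0 \<le> y" "s \<le> s'" shows "bdry_ker 0 y s \<le> bdry_ker 0 y s'"
proof (cases "0 < s")
  case True
  then have s': "0 < s'" using assms by simp
  have "unit_step (y + 2 * sqrt s * x) \<le> unit_step (y + 2 * sqrt s' * x)" for x
  proof (cases "x < 0")
    case True
    have "2 * sqrt s' * x \<le> 2 * sqrt s * x" using True assms by (intro mult_right_mono_neg) auto
    then show ?thesis by (auto simp: unit_step_def intro!: sgn_mono)
  next
    case False
    have "0 < 2 * sqrt s" "0 < 2 * sqrt s'" using \<open>0 < s\<close> s' by auto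
    then have "x = 0 \<or> 0 < 2 * sqrt s' * x \<and> 0 < 2 * sqrt s * x" using False by (simp add: zero_less_mult_iff) linarith?
    then have "x = 0 \<or> 0 < y + 2 * sqrt s' * x \<and> 0 < y + 2 * sqrt s * x" using assms by linarith
    then show ?thesis using assms by (auto simp: unit_step_def)
  qed
  then have "heat_pot 0 unit_step y s \<le> heat_pot 0 unit_step y s'"
    unfolding heat_pot_0_scaled[OF True] heat_pot_0_scaled[OF s']
    by (intro integral_mono bdry_ker_scaled_integrable mult_left_mono) auto
  then show ?thesis using True s' by (simp add: heat_ext_def)
next
  case False
  then show ?thesis using bdry_ker_0_nonneg[of y s'] by (simp add: heat_ext_def)
qed

text \<open>Together with \<open>bdry_ker_0_tendsto_1\<close> this says that the kernels \<open>bdry_ker 2 y\<close> form an approximate identity in time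
as \<open>y\<close> tends to \<open>0\<close>: they are nonnegative, and up to any time \<open>\<eta> > 0\<close> their mass is \<open>bdry_ker 0 y \<eta>\<close>.\<close>

lemma bdry_ker_2_nonneg: assumes "0 < y" shows "0 \<le> bdry_ker 2 y s"
  by (rule mono_on_imp_deriv_nonneg[of UNIV "bdry_ker 0 y" "bdry_ker 2 y s" s])
     (use assms bdry_ker_time_deriv bdry_ker_0_mono in \<open>auto intro!: mono_onI\<close>)

lemma bdry_ker_0_tendsto_1:
  assumes "0 < \<eta>" "0 < e" obtains d where "0 < d" "\<And>y. 0 < y \<Longrightarrow> y < d \<Longrightarrow> 1 - bdry_ker 0 y \<eta> < e"
proof -
  have "isCont (\<lambda>y. heat_pot 0 unit_step y \<eta>) 0"
    using heat_pot_deriv_01[OF exp_growth_unit_step assms(1)] by (rule DERIV_isCont)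
  then have "(\<lambda>y. bdry_ker 0 y \<eta>) \<midarrow>0\<rightarrow> 1"
    using assms bdry_ker_0_origin[OF assms(1)] by (simp add: isCont_def heat_ext_def)
  then obtain d where "0 < d" "\<And>y. y \<noteq> 0 \<Longrightarrow> \<bar>y\<bar> < d \<Longrightarrow> \<bar>bdry_ker 0 y \<eta> - 1\<bar> < e"
    using assms(2) by (auto simp: LIM_def dist_real_def)
  then show thesis by (intro that[of d]) (fastforce simp: abs_less_iff)+
qed

lemma duhamel_bdry_ker_restrict:
  assumes h: "continuous_on {0..T} h" and y: "0 < y" and t: "0 \<le> t" "t \<le> T"
  shows "duhamel T h (bdry_ker i) y t = integral {0..t} (\<lambda>s. bdry_ker i y (t - s) * h s)"
proof -
  have "integral {0..t} (\<lambda>s. bdry_ker i y (t - s) * h s) + integral {t..T} (\<lambda>s. bdry_ker i y (t - s) * h s) = duhamel T h (bdry_ker i) y t"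
    unfolding duhamel_def
    by (rule Henstock_Kurzweil_Integration.integral_combine[OF t duhamel_integrable[OF continuous_on_bdry_ker h]]) (use y in auto)
  moreover have "integral {t..T} (\<lambda>s. bdry_ker i y (t - s) * h s) = integral {t..T} (\<lambda>s. 0)"
    by (rule Henstock_Kurzweil_Integration.integral_cong) (auto simp: heat_ext_def)
  ultimately show ?thesis by simp
qed

lemma bdry_ker_2_integral:
  assumes y: "0 < y" and ab: "a \<le> b"
  shows "((\<lambda>s. bdry_ker 2 y (t - s)) has_integral (bdry_ker 0 y (t - a) - bdry_ker 0 y (t - b))) {a..b}"
proof -
  have "((\<lambda>s. bdry_ker 2 y (t - s)) has_integral (- bdry_ker 0 y (t - b) - - bdry_ker 0 y (t - a))) {a..b}"
  proof (rule fundamental_theorem_of_calculus[OF ab])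
    fix x
    have "((\<lambda>s. - bdry_ker 0 y (t - s)) has_real_derivative - (bdry_ker 2 y (t - x) * (- 1))) (at x)"
      by (intro DERIV_minus DERIV_chain'[of "\<lambda>s. t - s" _ _ _ "bdry_ker 0 y"] bdry_ker_time_deriv y)
         (auto intro!: derivative_eq_intros)
    then show "((\<lambda>s. - bdry_ker 0 y (t - s)) has_vector_derivative bdry_ker 2 y (t - x)) (at x within {a..b})"
      by (simp add: has_real_derivative_iff_has_vector_derivative has_vector_derivative_at_within)
  qed
  then show ?thesis by simp
qed

text \<open>The kernel is within \<open>1 - bdry_ker 0 y \<eta>\<close> of \<open>1\<close> except on a time interval of length \<open>\<eta>\<close>.\<close>

lemma duhamel_bdry_ker_0_error:
  assumes h: "continuous_on {0..T} h" and M: "\<And>s. s \<in> {0..T} \<Longrightarrow> \<bar>h s\<bar> \<le> M"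
    and y: "0 < y" and t: "0 \<le> t" "t \<le> T" and \<eta>: "0 < \<eta>"
  shows "\<bar>duhamel T h (bdry_ker 0) y t - integral {0..t} h\<bar> \<le> M * (1 - bdry_ker 0 y \<eta>) * T + M * \<eta>"
proof -
  \<comment> \<open>Before time \<open>c\<close> the kernel has had at least the time \<open>\<eta>\<close> to approach \<open>1\<close>.\<close>
  define c where "c = max 0 (t - \<eta>)"
  have c: "0 \<le> c" "c \<le> t" "t - c \<le> \<eta>" using t \<eta> by (auto simp: c_def)
  have M0: "0 \<le> M" using M[of 0] t by auto
  let ?f = "\<lambda>s. (bdry_ker 0 y (t - s) - 1) * h s"
  have cb: "continuous_on {0..t} (\<lambda>s. bdry_ker 0 y (t - s))"
    by (intro continuous_on_kernel_compose[OF continuous_on_bdry_ker] continuous_intros) (use y in auto)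
  have ch: "continuous_on {0..t} h" using h t by (auto intro: continuous_on_subset)
  have cf: "continuous_on {0..t} ?f" by (intro continuous_on_mult continuous_on_diff cb ch continuous_on_const)
  have ints: "?f integrable_on {0..t}" "?f integrable_on {0..c}" "?f integrable_on {c..t}"
    using cf c by (auto intro!: integrable_continuous_real elim: continuous_on_subset)
  have "duhamel T h (bdry_ker 0) y t - integral {0..t} h = integral {0..t} ?f"
    unfolding duhamel_bdry_ker_restrict[OF h y t]
    by (subst Henstock_Kurzweil_Integration.integral_diff[symmetric])
       (auto intro!: integrable_continuous_real continuous_on_mult cb ch simp: algebra_simps)
  also have "\<dots> = integral {0..c} ?f + integral {c..t} ?f"
    using Henstock_Kurzweil_Integration.integral_combine[OF c(1,2) ints(1)] by simp
  also have "\<bar>\<dots>\<bar> \<le> (M * (1 - bdry_ker 0 y \<eta>)) * (c - 0) + M * (t - c)"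
  proof (rule order_trans[OF abs_triangle_ineq add_mono])
    have nn: "0 \<le> M * (1 - bdry_ker 0 y \<eta>)" using M0 bdry_ker_0_le_1[of y \<eta>] y by simp
    have "norm (integral (cbox 0 c) ?f) \<le> (M * (1 - bdry_ker 0 y \<eta>)) * measure lborel (cbox 0 c)" if "c \<noteq> 0"
    proof (rule has_integral_bound[OF nn integrable_integral])
      show "?f integrable_on cbox 0 c" using ints by simp
      fix s assume s: "s \<in> cbox 0 c"
      show "norm (?f s) \<le> M * (1 - bdry_ker 0 y \<eta>)"
      proof -
        from that have "\<eta> \<le> t - s" using s by (auto simp: c_def max_def split: if_splits)
        then have "bdry_ker 0 y \<eta> \<le> bdry_ker 0 y (t - s)" "bdry_ker 0 y (t - s) \<le> 1" using y by (auto intro: bdry_ker_0_mono bdry_ker_0_le_1)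
        then have "\<bar>bdry_ker 0 y (t - s) - 1\<bar> \<le> 1 - bdry_ker 0 y \<eta>" by simp
        then have "\<bar>h s\<bar> * \<bar>bdry_ker 0 y (t - s) - 1\<bar> \<le> M * (1 - bdry_ker 0 y \<eta>)"
          using M[of s] M0 s c t by (intro mult_mono) auto
        then show ?thesis by (simp add: abs_mult mult.commute)
      qed
    qed
    then show "\<bar>integral {0..c} ?f\<bar> \<le> (M * (1 - bdry_ker 0 y \<eta>)) * (c - 0)" using c by (cases "c = 0") simp_all
    have "norm (integral (cbox c t) ?f) \<le> M * measure lborel (cbox c t)"
    proof (rule has_integral_bound[OF M0 integrable_integral])
      show "?f integrable_on cbox c t" using ints by simp
      fix s assume s: "s \<in> cbox c t"
      have "\<bar>bdry_ker 0 y (t - s) - 1\<bar> \<le> 1" using y bdry_ker_0_nonneg[of y "t - s"] bdry_ker_0_le_1[of y "t - s"] by simp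
      then have "\<bar>h s\<bar> * \<bar>bdry_ker 0 y (t - s) - 1\<bar> \<le> M * 1"
        using M[of s] M0 s c t by (intro mult_mono) auto
      then show "norm (?f s) \<le> M" by (simp add: abs_mult mult.commute)
    qed
    then show "\<bar>integral {c..t} ?f\<bar> \<le> M * (t - c)" using c by simp
  qed
  also have "\<dots> \<le> (M * (1 - bdry_ker 0 y \<eta>)) * T + M * \<eta>"
    using c t M0 bdry_ker_0_le_1[of y \<eta>] y by (intro add_mono mult_left_mono) auto
  finally show ?thesis .
qed

text \<open>The usual estimate for an approximate identity: the oscillation of \<open>h\<close> on a time interval of length \<open>\<eta>\<close>,
plus the mass that the kernel leaves outside of it.\<close>

lemma duhamel_bdry_ker_2_error:
  assumes h: "continuous_on {0..T} h" and M: "\<And>s. s \<in> {0..T} \<Longrightarrow> \<bar>h s\<bar> \<le> M"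
    and y: "0 < y" and t: "\<eta> \<le> t" "t \<le> T" and \<eta>: "0 < \<eta>"
    and osc: "\<And>s. s \<in> {0..T} \<Longrightarrow> \<bar>s - t\<bar> \<le> \<eta> \<Longrightarrow> \<bar>h s - h t\<bar> \<le> e"
  shows "\<bar>duhamel T h (bdry_ker 2) y t - h t\<bar> \<le> e + 3 * M * (1 - bdry_ker 0 y \<eta>)"
proof -
  define c where "c = t - \<eta>"
  have c: "0 \<le> c" "c \<le> t" "t - c = \<eta>" and t0: "0 \<le> t" using t \<eta> by (auto simp: c_def)
  have M0: "0 \<le> M" using M[of t] t t0 by auto
  have e0: "0 \<le> e" using osc[of t] t t0 \<eta> by auto
  let ?f = "\<lambda>s. bdry_ker 2 y (t - s) * (h s - h t)"
  have cb: "continuous_on {0..t} (\<lambda>s. bdry_ker 2 y (t - s))"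
    by (intro continuous_on_kernel_compose[OF continuous_on_bdry_ker] continuous_intros) (use y in auto)
  have ch: "continuous_on {0..t} h" using h t by (auto intro: continuous_on_subset)
  have cf: "continuous_on {0..t} ?f" by (intro continuous_on_mult continuous_on_diff cb ch continuous_on_const)
  have ints: "?f integrable_on {0..t}" "?f integrable_on {0..c}" "?f integrable_on {c..t}"
    using cf c by (auto intro!: integrable_continuous_real elim: continuous_on_subset)
  have K0: "bdry_ker 0 y 0 = 0" by (simp add: heat_ext_def)
  have "integral {0..t} (\<lambda>s. bdry_ker 2 y (t - s) * h t) = bdry_ker 0 y t * h t"
    using integral_unique[OF bdry_ker_2_integral[OF y t0, of t]] K0 by simp
  then have "duhamel T h (bdry_ker 2) y t = integral {0..t} ?f + bdry_ker 0 y t * h t"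
    unfolding duhamel_bdry_ker_restrict[OF h y t0 t(2)] right_diff_distrib
    by (subst Henstock_Kurzweil_Integration.integral_diff)
       (auto intro!: integrable_continuous_real continuous_on_mult cb ch continuous_on_const)
  also have "integral {0..t} ?f = integral {0..c} ?f + integral {c..t} ?f"
    using Henstock_Kurzweil_Integration.integral_combine[OF c(1,2) ints(1)] by simp
  finally have eq: "duhamel T h (bdry_ker 2) y t - h t = integral {0..c} ?f + integral {c..t} ?f - (1 - bdry_ker 0 y t) * h t"
    by (simp add: algebra_simps)
  have i1: "\<bar>integral {0..c} ?f\<bar> \<le> 2 * M * (1 - bdry_ker 0 y \<eta>)"
  proof -
    have "norm (integral {0..c} ?f) \<le> integral {0..c} (\<lambda>s. bdry_ker 2 y (t - s) * (2 * M))"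
    proof (rule integral_norm_bound_integral[OF ints(2)])
      show "(\<lambda>s. bdry_ker 2 y (t - s) * (2 * M)) integrable_on {0..c}"
        using bdry_ker_2_integral[OF y c(1), of t] by (intro integrable_on_mult_left) auto
      fix s assume s: "s \<in> {0..c}"
      have "\<bar>h s - h t\<bar> \<le> 2 * M" using M[of s] M[of t] s c t t0 by (auto simp: abs_le_iff)
      then show "norm (?f s) \<le> bdry_ker 2 y (t - s) * (2 * M)"
        using bdry_ker_2_nonneg[OF y, of "t - s"] by (simp add: abs_mult mult_left_mono)
    qed
    also have "\<dots> = (bdry_ker 0 y t - bdry_ker 0 y \<eta>) * (2 * M)"
      using integral_unique[OF bdry_ker_2_integral[OF y c(1), of t]] c(3) by simp
    also have "\<dots> \<le> (1 - bdry_ker 0 y \<eta>) * (2 * M)"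
      using bdry_ker_0_le_1[of y t] y M0 by (intro mult_right_mono) auto
    finally show ?thesis by (simp add: mult.commute)
  qed
  have i2: "\<bar>integral {c..t} ?f\<bar> \<le> e"
  proof -
    have "norm (integral {c..t} ?f) \<le> integral {c..t} (\<lambda>s. bdry_ker 2 y (t - s) * e)"
    proof (rule integral_norm_bound_integral[OF ints(3)])
      show "(\<lambda>s. bdry_ker 2 y (t - s) * e) integrable_on {c..t}"
        using bdry_ker_2_integral[OF y c(2), of t] by (intro integrable_on_mult_left) auto
      fix s assume s: "s \<in> {c..t}"
      have "\<bar>h s - h t\<bar> \<le> e" using s c t t0 by (intro osc) auto
      then show "norm (?f s) \<le> bdry_ker 2 y (t - s) * e"
        using bdry_ker_2_nonneg[OF y, of "t - s"] by (simp add: abs_mult mult_left_mono)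
    qed
    also have "\<dots> = bdry_ker 0 y \<eta> * e"
      using integral_unique[OF bdry_ker_2_integral[OF y c(2), of t]] c(3) K0 by simp
    also have "\<dots> \<le> 1 * e" using bdry_ker_0_le_1[of y \<eta>] y e0 by (intro mult_right_mono) auto
    finally show ?thesis by simp
  qed
  have i3: "\<bar>(1 - bdry_ker 0 y t) * h t\<bar> \<le> (1 - bdry_ker 0 y \<eta>) * M"
    unfolding abs_mult using bdry_ker_0_mono[of y \<eta> t] bdry_ker_0_le_1[of y t] y t t0 M[of t]
    by (intro mult_mono) auto
  have "3 * M * (1 - bdry_ker 0 y \<eta>) = 2 * M * (1 - bdry_ker 0 y \<eta>) + (1 - bdry_ker 0 y \<eta>) * M"
    by (simp add: algebra_simps)
  then show ?thesis unfolding eq using i1 i2 i3 by linarith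
qed

lemma continuous_on_boundary_extension:
  fixes D :: "real \<Rightarrow> real \<Rightarrow> real"
  assumes D: "continuous_on ({0<..} \<times> S) (\<lambda>(y, t). D y t)" and g: "continuous_on S g"
    and lim: "\<And>t0 e. t0 \<in> S \<Longrightarrow> 0 < e \<Longrightarrow>
      \<exists>d>0. \<forall>y t. 0 < y \<and> y < d \<and> t \<in> S \<and> \<bar>t - t0\<bar> < d \<longrightarrow> \<bar>D y t - g t\<bar> < e"
  shows "continuous_on ({0..} \<times> S) (\<lambda>(y, t). if y = 0 then g t else D y t)"
  unfolding continuous_on_eq_continuous_within
proof (rule ballI)
  fix p :: "real \<times> real" assume p: "p \<in> {0..} \<times> S"
  let ?F = "\<lambda>(y :: real, t). if y = 0 then g t else D y t"
  show "continuous (at p within {0..} \<times> S) ?F"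
  proof (cases "fst p = 0")
    case False
    then have p': "p \<in> {0<..} \<times> S" using p by auto
    have "continuous (at p within {0<..} \<times> S) (\<lambda>(y, t). D y t)"
      using D p' unfolding continuous_on_eq_continuous_within by blast
    then have "continuous (at p within {0<..} \<times> S) ?F"
      by (rule continuous_transform_within[OF _ zero_less_one p']) auto
    moreover have "at p within {0<..} \<times> S = at p within {0..} \<times> S"
      by (rule at_within_nhd[of p "{0<..} \<times> UNIV"]) (use p' in \<open>auto intro: open_Times\<close>)
    ultimately show ?thesis by simp
  next
    case True
    then obtain t0 where t0: "p = (0, t0)" "t0 \<in> S" using p by (cases p) auto
    show ?thesis unfolding continuous_within_eps_delta
    proof (intro allI impI)
      fix e :: real assume e: "0 < e"
      then obtain d where d: "0 < d"
        "\<And>y t. 0 < y \<Longrightarrow> y < d \<Longrightarrow> t \<in> S \<Longrightarrow> \<bar>t - t0\<bar> < d \<Longrightarrow> \<bar>D y t - g t\<bar> < e / 2"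
        using lim[OF t0(2), of "e / 2"] by auto
      obtain d' where d': "0 < d'" "\<And>t. t \<in> S \<Longrightarrow> \<bar>t - t0\<bar> < d' \<Longrightarrow> \<bar>g t - g t0\<bar> < e / 2"
        using g t0(2) e unfolding continuous_on_iff dist_real_def by (metis half_gt_zero)
      show "\<exists>d>0. \<forall>x\<in>{0..} \<times> S. dist x p < d \<longrightarrow> dist (?F x) (?F p) < e"
      proof (intro exI[of _ "min d d'"] conjI ballI impI)
        show "0 < min d d'" using d d' by simp
        fix x assume x: "x \<in> {0..} \<times> S" "dist x p < min d d'"
        obtain y t where yt: "x = (y, t)" by (cases x)
        have "dist y 0 < min d d'" "dist t t0 < min d d'"
          using x dist_fst_le[of x p] dist_snd_le[of x p] by (auto simp: yt t0)
        then have *: "\<bar>y\<bar> < d" "\<bar>t - t0\<bar> < d" "\<bar>t - t0\<bar> < d'" "0 \<le> y" "t \<in> S"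
          using x by (auto simp: dist_real_def yt)
        have "\<bar>g t - g t0\<bar> < e / 2" using * by (intro d')
        moreover have "\<bar>D y t - g t\<bar> < e / 2" if "y \<noteq> 0" using * that by (intro d) auto
        ultimately have "\<bar>g t - g t0\<bar> < e" "y \<noteq> 0 \<Longrightarrow> \<bar>D y t - g t0\<bar> < e" using e by linarith+
        then show "dist (?F x) (?F p) < e" by (auto simp: yt t0 dist_real_def)
      qed
    qed
  qed
qed

lemma integral_deriv_half_line:
  assumes g: "continuous_on {0..} g" and y: "0 \<le> y"
  shows "((\<lambda>y. integral {0..y} g) has_real_derivative g y) (at y within {0..})"
proof -
  have "((\<lambda>y. integral {0..y} g) has_real_derivative g y) (at y within {0..y + 1})"
    using g y by (intro integral_has_real_derivative) (auto intro: continuous_on_subset)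
  moreover have "at y within {0..y + 1} = at y within {0..}"
    by (rule at_within_nhd[of y "{..<y + 1}"]) (use y in auto)
  ultimately show ?thesis by simp
qed

text \<open>Rescaling the integral to \<open>{0..1}\<close> turns it into one over a fixed interval.\<close>

lemma continuous_on_primitive_param:
  fixes G :: "real \<Rightarrow> real \<Rightarrow> real"
  assumes G: "continuous_on ({0..} \<times> S) (\<lambda>(y, t). G y t)"
  shows "continuous_on ({0..} \<times> S) (\<lambda>(y, t). integral {0..y} (\<lambda>z. G z t))"
proof -
  have "continuous_on (({0..} \<times> S) \<times> {0..1}) (\<lambda>(p, x). fst p * G (fst p * x) (snd p))"
    unfolding case_prod_beta
    by (intro continuous_on_mult continuous_on_kernel_compose[OF G] continuous_intros) auto
  then have "continuous_on ({0..} \<times> S) (\<lambda>p. integral {0..1} (\<lambda>x. fst p * G (fst p * x) (snd p)))"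
    using integral_continuous_on_param[of "{0..} \<times> S" 0 1 "\<lambda>p x. fst p * G (fst p * x) (snd p)"] by simp
  moreover have "integral {0..1} (\<lambda>x. y * G (y * x) t) = integral {0..y} (\<lambda>z. G z t)" if y: "0 \<le> y" "t \<in> S" for y t
  proof -
    have c: "continuous_on {0..y} (\<lambda>z. G z t)"
      by (intro continuous_on_kernel_compose[OF G] continuous_intros) (use y in auto)
    have "((\<lambda>x. y *\<^sub>R G (y * x) t) has_integral integral {y * 0..y * 1} (\<lambda>z. G z t)) {0..1}"
      by (rule has_integral_substitution[where c = 0 and d = y])
         (use y c in \<open>auto intro!: derivative_eq_intros simp: mult_left_le\<close>)
    from integral_unique[OF this] show ?thesis by simp
  qed
  ultimately show ?thesis
    by (auto simp: case_prod_beta intro: continuous_on_eq)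
qed

text \<open>The first derivative near the boundary is recovered from the second one by integration, so it
needs no separate limit: a primitive of \<open>B2\<close> is automatically continuous up to \<open>y = 0\<close>.\<close>

lemma second_order_up_to_boundary:
  fixes B0 B1 B2 :: "real \<Rightarrow> real \<Rightarrow> real"
  assumes B0: "\<And>t. t \<in> S \<Longrightarrow> continuous_on {0..} (\<lambda>y. B0 y t)"
    and B1: "continuous_on ({0<..} \<times> S) (\<lambda>(y, t). B1 y t)"
    and B2: "continuous_on ({0..} \<times> S) (\<lambda>(y, t). B2 y t)"
    and d1: "\<And>y t. 0 < y \<Longrightarrow> t \<in> S \<Longrightarrow> ((\<lambda>y. B0 y t) has_real_derivative B1 y t) (at y)"
    and d2: "\<And>y t. 0 < y \<Longrightarrow> t \<in> S \<Longrightarrow> ((\<lambda>y. B1 y t) has_real_derivative B2 y t) (at y)"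
  obtains C where "continuous_on ({0..} \<times> S) (\<lambda>(y, t). C y t)"
    "\<And>y t. 0 < y \<Longrightarrow> t \<in> S \<Longrightarrow> C y t = B1 y t"
    "\<And>y t. 0 \<le> y \<Longrightarrow> t \<in> S \<Longrightarrow> ((\<lambda>y. B0 y t) has_real_derivative C y t) (at y within {0..})"
    "\<And>y t. 0 \<le> y \<Longrightarrow> t \<in> S \<Longrightarrow> ((\<lambda>y. C y t) has_real_derivative B2 y t) (at y within {0..})"
proof -
  \<comment> \<open>The primitive of \<open>B2\<close> that agrees with \<open>B1\<close> at \<open>y = 1\<close>.\<close>
  define C where "C = (\<lambda>y t. B1 1 t - integral {0..1} (\<lambda>z. B2 z t) + integral {0..y} (\<lambda>z. B2 z t))"
  have prim: "continuous_on ({0..} \<times> S) (\<lambda>(y, t). integral {0..y} (\<lambda>z. B2 z t))"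
    by (rule continuous_on_primitive_param[OF B2])
  have contC: "continuous_on ({0..} \<times> S) (\<lambda>(y, t). C y t)"
    unfolding C_def case_prod_beta
    by (intro continuous_on_add continuous_on_diff continuous_on_kernel_compose[OF B1]
        continuous_on_kernel_compose[OF prim] continuous_intros) auto
  have B2t: "continuous_on {0..} (\<lambda>z. B2 z t)" if "t \<in> S" for t
    by (intro continuous_on_kernel_compose[OF B2] continuous_intros) (use that in auto)
  have Ct: "continuous_on {0..} (\<lambda>z. C z t)" if "t \<in> S" for t
    by (intro continuous_on_kernel_compose[OF contC] continuous_intros) (use that in auto)
  have dC: "((\<lambda>y. C y t) has_real_derivative B2 y t) (at y within {0..})" if "0 \<le> y" "t \<in> S" for y t
  proof -
    have "((\<lambda>y. B1 1 t - integral {0..1} (\<lambda>z. B2 z t) + integral {0..y} (\<lambda>z. B2 z t)) has_real_derivative 0 + B2 y t) (at y within {0..})"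
      by (intro DERIV_add DERIV_const integral_deriv_half_line[OF B2t] that)
    then show ?thesis by (simp add: C_def)
  qed
  have pos: "at y within {0..} = at y" if "0 < y" for y :: real
    by (rule at_within_interior) (use that in simp)
  have CB: "C y t = B1 y t" if "0 < y" "t \<in> S" for y t
  proof -
    have "((\<lambda>y. B1 y t - C y t) has_field_derivative 0) (at y within {0<..})" if "y \<in> {0<..}" for y
    proof -
      have y: "0 < y" using that by simp
      have "((\<lambda>y. B1 y t - C y t) has_field_derivative B2 y t - B2 y t) (at y)"
        using dC[of y t] y \<open>t \<in> S\<close> unfolding pos[OF y] by (intro DERIV_diff d2) auto
      then show ?thesis by (simp add: has_field_derivative_at_within)
    qed
    then obtain c where "\<And>y. y \<in> {0<..} \<Longrightarrow> B1 y t - C y t = c"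
      using has_field_derivative_zero_constant[of "{0<..}" "\<lambda>y. B1 y t - C y t"] by auto
    moreover have "B1 1 t - C 1 t = 0" by (simp add: C_def)
    ultimately have "B1 y t - C y t = 0" using that by (metis greaterThan_iff zero_less_one)
    then show ?thesis by simp
  qed
  have dB: "((\<lambda>y. B0 y t) has_real_derivative C y t) (at y within {0..})" if "0 \<le> y" "t \<in> S" for y t
  proof -
    define P where "P = (\<lambda>y. integral {0..y} (\<lambda>z. C z t))"
    have dP: "(P has_real_derivative C y t) (at y within {0..})" if "0 \<le> y" for y
      unfolding P_def by (rule integral_deriv_half_line[OF Ct[OF \<open>t \<in> S\<close>] that])
    have "((\<lambda>y. B0 y t - P y) has_field_derivative 0) (at y within {0<..})" if "y \<in> {0<..}" for y
    proof -
      have y: "0 < y" using that by simp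
      have "((\<lambda>y. B0 y t - P y) has_field_derivative B1 y t - C y t) (at y)"
        using dP[of y] y \<open>t \<in> S\<close> unfolding pos[OF y] by (intro DERIV_diff d1) auto
      then show ?thesis using CB[OF y \<open>t \<in> S\<close>] by (simp add: has_field_derivative_at_within)
    qed
    then obtain c where c: "\<And>y. y \<in> {0<..} \<Longrightarrow> B0 y t - P y = c"
      using has_field_derivative_zero_constant[of "{0<..}" "\<lambda>y. B0 y t - P y"] by auto
    have "continuous_on {0..} P" using dP by (intro DERIV_continuous_on) auto
    then have "continuous_on (closure {0<..}) (\<lambda>y. B0 y t - P y)"
      using B0[OF \<open>t \<in> S\<close>] by (auto intro: continuous_on_diff)
    then have c': "B0 y t - P y = c" if "0 \<le> y" for y
      by (rule continuous_constant_on_closure) (use c that in auto)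
    have "((\<lambda>y. P y + c) has_real_derivative C y t) (at y within {0..})"
      using DERIV_add[OF dP[OF \<open>0 \<le> y\<close>] DERIV_const[of c]] by simp
    then show ?thesis
      by (rule has_field_derivative_transform_within[OF _ zero_less_one])
         (use that c' in \<open>auto simp: algebra_simps\<close>)
  qed
  show thesis by (rule that[of C]) (use contC CB dB dC in auto)
qed

text \<open>The half-line problem with zero initial value and boundary value \<open>integral {0..t} h\<close>. For \<open>y > 0\<close> the
kernel is smooth up to time zero; at \<open>y = 0\<close> the value and the second derivative are assigned their limits.\<close>

lemma half_line_solution:
  assumes T: "0 < T" and h: "continuous_on {0..T} h"
  obtains B0 B1 B2 :: "real \<Rightarrow> real \<Rightarrow> real" where
    "continuous_on ({0..} \<times> {0..T}) (\<lambda>(y, t). B0 y t)"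
    "continuous_on ({0..} \<times> {0<..<T}) (\<lambda>(y, t). B1 y t)"
    "continuous_on ({0..} \<times> {0<..<T}) (\<lambda>(y, t). B2 y t)"
    "\<And>t. t \<in> {0..T} \<Longrightarrow> B0 0 t = integral {0..t} h"
    "\<And>y t. 0 < y \<Longrightarrow> B0 y t = duhamel T h (bdry_ker 0) y t"
    "\<And>y t. 0 < y \<Longrightarrow> t \<in> {0<..<T} \<Longrightarrow> B1 y t = duhamel T h (bdry_ker 1) y t"
    "\<And>y t. 0 \<le> y \<Longrightarrow> t \<in> {0<..<T} \<Longrightarrow> ((\<lambda>y. B0 y t) has_real_derivative B1 y t) (at y within {0..})"
    "\<And>y t. 0 \<le> y \<Longrightarrow> t \<in> {0<..<T} \<Longrightarrow> ((\<lambda>y. B1 y t) has_real_derivative B2 y t) (at y within {0..})"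
    "\<And>y t. 0 \<le> y \<Longrightarrow> t \<in> {0<..<T} \<Longrightarrow> ((\<lambda>t. B0 y t) has_real_derivative B2 y t) (at t)"
proof -
  define B0 where "B0 = (\<lambda>y t. if y = 0 then integral {0..t} h else duhamel T h (bdry_ker 0) y t)"
  define B2 where "B2 = (\<lambda>y t. if y = 0 then h t else duhamel T h (bdry_ker 2) y t)"
  have "bounded (h ` {0..T})" by (rule compact_imp_bounded[OF compact_continuous_image[OF h compact_Icc]])
  then obtain M where M0: "0 < M" "\<forall>x\<in>h ` {0..T}. norm x \<le> M" unfolding bounded_pos by blast
  then have M: "\<And>s. s \<in> {0..T} \<Longrightarrow> \<bar>h s\<bar> \<le> M" "0 < M" by auto
  have cD: "continuous_on ({0<..} \<times> S) (\<lambda>(y, t). duhamel T h (bdry_ker i) y t)" for i S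
    by (rule continuous_on_subset[OF continuous_on_duhamel[OF continuous_on_bdry_ker h]]) auto
  have d01: "((\<lambda>y. duhamel T h (bdry_ker 0) y t) has_real_derivative duhamel T h (bdry_ker 1) y t) (at y)" if "0 < y" for y t
    using duhamel_space_deriv[OF continuous_on_bdry_ker continuous_on_bdry_ker h, where y = y and t = t, of 0 1] that
      heat_ext_deriv_01[OF exp_growth_unit_step]
    by (auto simp: at_within_open[of y "{0<..}"] intro: has_field_derivative_at_within)
  have d12: "((\<lambda>y. duhamel T h (bdry_ker 1) y t) has_real_derivative duhamel T h (bdry_ker 2) y t) (at y)" if "0 < y" for y t
    using duhamel_space_deriv[OF continuous_on_bdry_ker continuous_on_bdry_ker h, where y = y and t = t, of 1 2] that
      heat_ext_deriv_12[OF exp_growth_unit_step]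
    by (auto simp: at_within_open[of y "{0<..}"] intro: has_field_derivative_at_within)
  have dt: "((\<lambda>t. duhamel T h (bdry_ker 0) y t) has_real_derivative duhamel T h (bdry_ker 2) y t) (at t)" if "0 < y" for y t
    using that by (intro duhamel_time_deriv[OF continuous_on_bdry_ker continuous_on_bdry_ker h] bdry_ker_time_deriv) auto
  have dg: "((\<lambda>t. integral {0..t} h) has_real_derivative h t) (at t)" if "t \<in> {0<..<T}" for t
    using integral_has_real_derivative[OF h, of t] that at_within_interior[of t "{0..T}"] by auto
  have c0: "continuous_on ({0..} \<times> {0..T}) (\<lambda>(y, t). B0 y t)"
    unfolding B0_def
  proof (rule continuous_on_boundary_extension[OF cD])
    show "continuous_on {0..T} (\<lambda>t. integral {0..t} h)"
      by (rule indefinite_integral_continuous_1) (rule integrable_continuous_real[OF h])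
    fix t0 e :: real assume t0: "t0 \<in> {0..T}" and e: "0 < e"
    define \<eta> where "\<eta> = e / (2 * M)"
    have \<eta>: "0 < \<eta>" "M * \<eta> = e / 2" using e M by (auto simp: \<eta>_def)
    obtain d where d: "0 < d" "\<And>y. 0 < y \<Longrightarrow> y < d \<Longrightarrow> 1 - bdry_ker 0 y \<eta> < e / (2 * (M * T))"
      using bdry_ker_0_tendsto_1[OF \<eta>(1), of "e / (2 * (M * T))"] e M T by (metis divide_pos_pos mult_pos_pos zero_less_numeral)
    have "\<bar>duhamel T h (bdry_ker 0) y t - integral {0..t} h\<bar> < e" if "0 < y" "y < d" "t \<in> {0..T}" for y t
    proof -
      have "M * T * (1 - bdry_ker 0 y \<eta>) < M * T * (e / (2 * (M * T)))"
        using d(2)[OF that(1,2)] M T by (intro mult_strict_left_mono) auto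
      then have "M * (1 - bdry_ker 0 y \<eta>) * T < e / 2" using M T by (simp add: mult_ac)
      then show ?thesis using duhamel_bdry_ker_0_error[OF h M(1) that(1) _ _ \<eta>(1), of t] that(3) \<eta>(2) by simp
    qed
    then show "\<exists>d>0. \<forall>y t. 0 < y \<and> y < d \<and> t \<in> {0..T} \<and> \<bar>t - t0\<bar> < d \<longrightarrow>
        \<bar>duhamel T h (bdry_ker 0) y t - integral {0..t} h\<bar> < e"
      using d(1) by blast
  qed
  have c2: "continuous_on ({0..} \<times> {0<..<T}) (\<lambda>(y, t). B2 y t)"
    unfolding B2_def
  proof (rule continuous_on_boundary_extension[OF cD])
    show "continuous_on {0<..<T} h" by (rule continuous_on_subset[OF h]) auto
    fix t0 e :: real assume t0: "t0 \<in> {0<..<T}" and e: "0 < e"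
    have "uniformly_continuous_on {0..T} h" by (rule compact_uniformly_continuous[OF h]) simp
    then obtain d' where d': "0 < d'" "\<And>s t. s \<in> {0..T} \<Longrightarrow> t \<in> {0..T} \<Longrightarrow> \<bar>s - t\<bar> < d' \<Longrightarrow> \<bar>h s - h t\<bar> < e / 2"
      using e unfolding uniformly_continuous_on_def dist_real_def by (metis half_gt_zero)
    define \<eta> where "\<eta> = min (d' / 2) (t0 / 2)"
    have \<eta>: "0 < \<eta>" "\<eta> < d'" "\<eta> \<le> t0 / 2" using d' t0 by (auto simp: \<eta>_def)
    obtain d where d: "0 < d" "\<And>y. 0 < y \<Longrightarrow> y < d \<Longrightarrow> 1 - bdry_ker 0 y \<eta> < e / (2 * (3 * M))"
      using bdry_ker_0_tendsto_1[OF \<eta>(1), of "e / (2 * (3 * M))"] e M T by (metis divide_pos_pos mult_pos_pos zero_less_numeral)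
    have "\<bar>duhamel T h (bdry_ker 2) y t - h t\<bar> < e" if "0 < y" "y < d" "t \<in> {0<..<T}" "\<bar>t - t0\<bar> < t0 / 2" for y t
    proof -
      have "3 * M * (1 - bdry_ker 0 y \<eta>) < 3 * M * (e / (2 * (3 * M)))"
        using d(2)[OF that(1,2)] M T by (intro mult_strict_left_mono) auto
      then have 1: "3 * M * (1 - bdry_ker 0 y \<eta>) < e / 2" using M by simp
      have "\<eta> \<le> t" using that(4) \<eta>(3) by linarith
      moreover have "t \<le> T" using that(3) by simp
      ultimately have "\<bar>duhamel T h (bdry_ker 2) y t - h t\<bar> \<le> e / 2 + 3 * M * (1 - bdry_ker 0 y \<eta>)"
        using d'(2)[of _ t] \<eta> that(3)
        by (intro duhamel_bdry_ker_2_error[OF h M(1) that(1) _ _ \<eta>(1)]) (auto intro!: less_imp_le)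
      then show ?thesis using 1 by simp
    qed
    then show "\<exists>d>0. \<forall>y t. 0 < y \<and> y < d \<and> t \<in> {0<..<T} \<and> \<bar>t - t0\<bar> < d \<longrightarrow>
        \<bar>duhamel T h (bdry_ker 2) y t - h t\<bar> < e"
      using d(1) t0 by (intro exI[of _ "min d (t0 / 2)"]) auto
  qed
  have c0t: "continuous_on {0..} (\<lambda>y. B0 y t)" if "t \<in> {0<..<T}" for t
    by (intro continuous_on_kernel_compose[OF c0] continuous_intros) (use that in auto)
  have e0: "((\<lambda>y. B0 y t) has_real_derivative duhamel T h (bdry_ker 1) y t) (at y)" if "0 < y" for y t
    by (rule has_field_derivative_transform_within_open[OF d01[OF that], of "{0<..}"]) (use that in \<open>auto simp: B0_def\<close>)
  have e1: "((\<lambda>y. duhamel T h (bdry_ker 1) y t) has_real_derivative B2 y t) (at y)" if "0 < y" for y t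
    using d12[OF that] that by (simp add: B2_def)
  obtain C where C: "continuous_on ({0..} \<times> {0<..<T}) (\<lambda>(y, t). C y t)"
    "\<And>y t. 0 < y \<Longrightarrow> t \<in> {0<..<T} \<Longrightarrow> C y t = duhamel T h (bdry_ker 1) y t"
    "\<And>y t. 0 \<le> y \<Longrightarrow> t \<in> {0<..<T} \<Longrightarrow> ((\<lambda>y. B0 y t) has_real_derivative C y t) (at y within {0..})"
    "\<And>y t. 0 \<le> y \<Longrightarrow> t \<in> {0<..<T} \<Longrightarrow> ((\<lambda>y. C y t) has_real_derivative B2 y t) (at y within {0..})"
    by (rule second_order_up_to_boundary[OF c0t cD c2 e0 e1]) auto
  have et: "((\<lambda>t. B0 y t) has_real_derivative B2 y t) (at t)" if "0 \<le> y" "t \<in> {0<..<T}" for y t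
    using that dt[of y t] dg[OF that(2)] by (auto simp: B0_def B2_def)
  show thesis
    by (rule that[of B0 C B2]) (use c0 C c2 et in \<open>auto simp: B0_def\<close>)
qed

section \<open>Metric graphs and the method of images\<close>

text \<open>A graph is given by its half-edges: \<open>flip\<close> reverses a half-edge, and two half-edges meet at a vertex
if they have the same origin. A function on the graph is a family of functions \<open>U e\<close> of the distance
from the origin of \<open>e\<close>, subject to \<open>U (flip e) y = U e (L e - y)\<close>. In this form every vertex condition
is a condition at \<open>y = 0\<close>. The Dirichlet condition is imposed at \<open>v0\<close>.\<close>

locale metric_graph =
  fixes H :: "'h set" and flip :: "'h \<Rightarrow> 'h" and L :: "'h \<Rightarrow> real" and org :: "'h \<Rightarrow> 'v" and v0 :: 'v
  assumes finite_H: "finite H"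
    and flip_in [simp]: "e \<in> H \<Longrightarrow> flip e \<in> H"
    and flip_flip [simp]: "e \<in> H \<Longrightarrow> flip (flip e) = e"
    and L_flip [simp]: "e \<in> H \<Longrightarrow> L (flip e) = L e"
    and L_pos: "e \<in> H \<Longrightarrow> 0 < L e"
begin

definition star :: "'h \<Rightarrow> 'h set" where
  "star e = {e' \<in> H. org e' = org e}"

lemma finite_star [simp]: "finite (star e)"
  using finite_H by (simp add: star_def)

lemma star_self: "e \<in> H \<Longrightarrow> e \<in> star e"
  by (simp add: star_def)

lemma star_D: "e' \<in> star e \<Longrightarrow> e' \<in> H" "e' \<in> star e \<Longrightarrow> org e' = org e" "e' \<in> star e \<Longrightarrow> star e' = star e"
  by (auto simp: star_def)

lemma card_star_pos: "e \<in> H \<Longrightarrow> 0 < card (star e)"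
  using star_self by (auto simp: card_gt_0_iff)

text \<open>The inserted \<open>1\<close> makes the minimum exist for the empty graph.\<close>

definition \<delta> :: real where "\<delta> = Min (insert 1 (L ` H))"

lemma \<delta>_pos: "0 < \<delta>"
  unfolding \<delta>_def using finite_H L_pos by (subst Min_gr_iff) auto

lemma \<delta>_le: "e \<in> H \<Longrightarrow> \<delta> \<le> L e"
  unfolding \<delta>_def using finite_H by (intro Min_le) auto

text \<open>The reflection rule that makes differences of two extended data odd and, away from \<open>v0\<close>, their sum
over a star even. At \<open>v0\<close> it is odd reflection.\<close>

definition scatter :: "'h \<Rightarrow> ('h \<Rightarrow> real) \<Rightarrow> real" where
  "scatter e X = (if org e = v0 then 0 else 2 / card (star e)) * (\<Sum>e'\<in>star e. X e') - X e"

lemma scatter_cong: "e \<in> H \<Longrightarrow> (\<And>e'. e' \<in> star e \<Longrightarrow> X e' = Y e') \<Longrightarrow> scatter e X = scatter e Y"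
  by (simp add: scatter_def star_self)

lemma abs_scatter_le:
  assumes e: "e \<in> H" and X: "\<And>e'. e' \<in> H \<Longrightarrow> \<bar>X e'\<bar> \<le> M"
  shows "\<bar>scatter e X\<bar> \<le> 3 * M"
proof -
  let ?c = "if org e = v0 then 0 else 2 / real (card (star e))"
  have M: "0 \<le> M" using X[OF e] by linarith
  have "\<bar>\<Sum>e'\<in>star e. X e'\<bar> \<le> (\<Sum>e'\<in>star e. M)"
    by (rule order_trans[OF sum_abs sum_mono]) (use X star_D in auto)
  then have "\<bar>?c * (\<Sum>e'\<in>star e. X e')\<bar> \<le> ?c * (card (star e) * M)"
    unfolding abs_mult by (intro mult_mono) auto
  also have "\<dots> \<le> 2 * M" using card_star_pos[OF e] M by auto
  finally show ?thesis unfolding scatter_def using X[OF e] by linarith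
qed

lemma scatter_const:
  assumes "e \<in> H" "\<And>e'. e' \<in> star e \<Longrightarrow> X e' = c"
  shows "scatter e X = (if org e = v0 then - c else c)"
  using assms card_star_pos[OF assms(1)] star_self[OF assms(1)] by (auto simp: scatter_def)

lemma sum_scatter:
  assumes e: "e \<in> H" and "org e \<noteq> v0"
  shows "(\<Sum>e'\<in>star e. scatter e' X) = (\<Sum>e'\<in>star e. X e')"
proof -
  have "(\<Sum>e'\<in>star e. scatter e' X) = (\<Sum>e'\<in>star e. 2 / card (star e) * (\<Sum>e'\<in>star e. X e') - X e')"
    by (rule sum.cong) (use assms star_D in \<open>auto simp: scatter_def\<close>)
  also have "\<dots> = (\<Sum>e'\<in>star e. X e')"
    using card_star_pos[OF e] by (simp add: sum_subtractf)
  finally show ?thesis .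
qed

definition vertex_compatible :: "('h \<Rightarrow> real \<Rightarrow> real) \<Rightarrow> bool" where
  "vertex_compatible f \<longleftrightarrow>
     (\<forall>e\<in>H. \<forall>y\<in>{0..L e}. f (flip e) y = f e (L e - y)) \<and>
     (\<forall>e\<in>H. \<forall>e'\<in>star e. f e' 0 = f e 0) \<and>
     (\<forall>e\<in>H. org e = v0 \<longrightarrow> f e 0 = 0)"

text \<open>The extension after \<open>n\<close> rounds of reflection. It has its final value on \<open>{- n * \<delta>..L e + n * \<delta>}\<close>, since
a reflection of depth at most \<open>\<delta>\<close> beyond the last known point lands where the previous round
is already correct. The starting value is extended as a constant, which keeps it continuous.\<close>

fun images :: "('h \<Rightarrow> real \<Rightarrow> real) \<Rightarrow> nat \<Rightarrow> 'h \<Rightarrow> real \<Rightarrow> real" where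
  "images f 0 e y = f e (max 0 (min (L e) y))"
| "images f (Suc n) e y =
     (if y < 0 then scatter e (\<lambda>e'. images f n e' (- y))
      else if y > L e then scatter (flip e) (\<lambda>e'. images f n e' (y - L e))
      else f e y)"

lemma images_base: "e \<in> H \<Longrightarrow> y \<in> {0..L e} \<Longrightarrow> images f n e y = f e y"
  by (cases n) auto

lemma images_flip:
  assumes f: "vertex_compatible f" and e: "e \<in> H"
  shows "images f n (flip e) y = images f n e (L e - y)"
proof (cases n)
  case 0
  have "max 0 (min (L e) y) \<in> {0..L e}" using L_pos[OF e] by auto
  then have "f (flip e) (max 0 (min (L e) y)) = f e (L e - max 0 (min (L e) y))"
    using f e unfolding vertex_compatible_def by blast
  also have "L e - max 0 (min (L e) y) = max 0 (min (L e) (L e - y))" using L_pos[OF e] by auto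
  finally show ?thesis using e 0 by simp
next
  case (Suc m)
  then show ?thesis using f e L_pos[OF e] by (auto simp: vertex_compatible_def)
qed

lemma images_stable:
  "e \<in> H \<Longrightarrow> - (real n * \<delta>) \<le> y \<Longrightarrow> y \<le> L e + real n * \<delta> \<Longrightarrow> images f (Suc n) e y = images f n e y"
proof (induction n arbitrary: e y)
  case 0
  then show ?case by auto
next
  case (Suc n)
  have IH: "images f (Suc n) e' z = images f n e' z" if "e' \<in> H" "0 \<le> z" "z \<le> real (Suc n) * \<delta>" for e' z
    using that \<delta>_le[OF that(1)] \<delta>_pos by (intro Suc.IH) (auto simp: distrib_right mult_nonneg_nonneg order_trans[of _ 0])
  have 1: "scatter e (\<lambda>e'. images f (Suc n) e' (- y)) = scatter e (\<lambda>e'. images f n e' (- y))" if "y < 0"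
    using Suc.prems that by (intro scatter_cong IH) (auto dest: star_D)
  have 2: "scatter (flip e) (\<lambda>e'. images f (Suc n) e' (y - L e)) = scatter (flip e) (\<lambda>e'. images f n e' (y - L e))"
    if "L e < y"
    using Suc.prems that by (intro scatter_cong IH) (auto dest: star_D)
  show ?case using 1 2 unfolding images.simps(2)[of f "Suc n" e y] images.simps(2)[of f n e y] by auto
qed

lemma images_stable_le:
  assumes "n \<le> m" "e \<in> H" "- (real n * \<delta>) \<le> y" "y \<le> L e + real n * \<delta>"
  shows "images f m e y = images f n e y"
  using assms(1)
proof (induction m rule: dec_induct)
  case (step k)
  have "real n * \<delta> \<le> real k * \<delta>" using step \<delta>_pos by simp
  then have "images f (Suc k) e y = images f k e y" using assms by (intro images_stable) auto
  then show ?case using step by simp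
qed simp

text \<open>The number of rounds after which the extension at \<open>y\<close> no longer changes.\<close>

definition level :: "real \<Rightarrow> nat" where "level y = nat \<lceil>\<bar>y\<bar> / \<delta>\<rceil>"

lemma level_bounds: "\<bar>y\<bar> \<le> real (level y) * \<delta>" "real (level y) \<le> \<bar>y\<bar> / \<delta> + 1"
proof -
  have "0 \<le> \<bar>y\<bar> / \<delta>" using \<delta>_pos by simp
  then have *: "\<bar>y\<bar> / \<delta> \<le> real (level y)" "real (level y) \<le> \<bar>y\<bar> / \<delta> + 1"
    unfolding level_def by linarith+
  then show "\<bar>y\<bar> \<le> real (level y) * \<delta>" using \<delta>_pos by (simp add: divide_le_eq)
  show "real (level y) \<le> \<bar>y\<bar> / \<delta> + 1" by (fact *)
qed

definition extend :: "('h \<Rightarrow> real \<Rightarrow> real) \<Rightarrow> 'h \<Rightarrow> real \<Rightarrow> real" where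
  "extend f e y = images f (level y) e y"

lemma extend_eq_images:
  assumes "e \<in> H" "\<bar>y\<bar> \<le> real n * \<delta>"
  shows "extend f e y = images f n e y"
proof -
  have "images f m e y = images f (min m n) e y" if "\<bar>y\<bar> \<le> real (min m n) * \<delta>" "min m n \<le> m" for m n
    using that assms L_pos[OF assms(1)] by (intro images_stable_le) auto
  from this[of "level y" n] this[of n "level y"] show ?thesis
    using assms level_bounds(1)[of y] unfolding extend_def by (simp add: min.commute min_def)
qed

lemma extend_base: "e \<in> H \<Longrightarrow> y \<in> {0..L e} \<Longrightarrow> extend f e y = f e y"
  by (simp add: extend_def images_base)

lemma extend_flip:
  assumes f: "vertex_compatible f" and e: "e \<in> H"
  shows "extend f (flip e) y = extend f e (L e - y)"
proof -
  define n where "n = max (level y) (level (L e - y))"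
  have "\<bar>y\<bar> \<le> real n * \<delta>" "\<bar>L e - y\<bar> \<le> real n * \<delta>"
    using level_bounds(1)[of y] level_bounds(1)[of "L e - y"] \<delta>_pos
    by (auto simp: n_def intro: order_trans mult_right_mono)
  then show ?thesis using extend_eq_images[of _ _ n] e images_flip[OF f e] by simp
qed

text \<open>At \<open>y = 0\<close> the rule reproduces the vertex value precisely because the data agree at each vertex and
vanish at \<open>v0\<close>. Elsewhere it is the recursion itself.\<close>

lemma extend_scatter:
  assumes f: "vertex_compatible f" and e: "e \<in> H" and y: "0 \<le> y"
  shows "extend f e (- y) = scatter e (\<lambda>e'. extend f e' y)"
proof (cases "y = 0")
  case True
  have "scatter e (\<lambda>e'. extend f e' 0) = (if org e = v0 then - f e 0 else f e 0)"
    using f e by (intro scatter_const) (auto simp: vertex_compatible_def extend_base star_D L_pos less_imp_le)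
  also have "\<dots> = f e 0" using f e by (auto simp: vertex_compatible_def)
  finally show ?thesis using True e L_pos[OF e] by (simp add: extend_base)
next
  case False
  have "extend f e (- y) = images f (Suc (level y)) e (- y)"
    using level_bounds(1)[of y] \<delta>_pos y by (intro extend_eq_images e) (simp add: distrib_right)
  also have "\<dots> = scatter e (\<lambda>e'. images f (level y) e' y)" using False y by simp
  finally show ?thesis by (simp add: extend_def)
qed

lemma images_bound:
  assumes M: "\<And>e y. e \<in> H \<Longrightarrow> y \<in> {0..L e} \<Longrightarrow> \<bar>f e y\<bar> \<le> M" and "0 \<le> M"
  shows "e \<in> H \<Longrightarrow> \<bar>images f n e y\<bar> \<le> M * 3 ^ n"
proof (induction n arbitrary: e y)
  case 0
  then show ?case using M[of e "max 0 (min (L e) y)"] L_pos[of e] by simp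
next
  case (Suc n)
  have "\<bar>f e y\<bar> \<le> M * 3 ^ Suc n" if "y \<in> {0..L e}"
  proof -
    have "M * 1 \<le> M * 3 ^ Suc n" using \<open>0 \<le> M\<close> by (intro mult_left_mono one_le_power) auto
    then show ?thesis using M[OF Suc.prems that] by simp
  qed
  moreover have "\<bar>scatter e (\<lambda>e'. images f n e' z)\<bar> \<le> M * 3 ^ Suc n" if "e \<in> H" for e z
    using abs_scatter_le[OF that, of "\<lambda>e'. images f n e' z" "M * 3 ^ n"] Suc.IH by (simp add: mult_ac)
  ultimately show ?case using Suc.prems by auto
qed

lemma images_measurable:
  assumes "\<And>e. e \<in> H \<Longrightarrow> (\<lambda>y. f e (max 0 (min (L e) y))) \<in> borel_measurable borel"
  shows "e \<in> H \<Longrightarrow> images f n e \<in> borel_measurable borel"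
proof (induction n arbitrary: e)
  case 0
  then show ?case using assms by simp
next
  case (Suc n)
  have sc: "(\<lambda>y. scatter e (\<lambda>e'. images f n e' (a + b * y))) \<in> borel_measurable borel" if "e \<in> H" for e a b
    unfolding scatter_def using that star_D
    by (intro borel_measurable_diff borel_measurable_times borel_measurable_sum borel_measurable_const
        measurable_compose[OF _ Suc.IH]) (auto intro!: borel_measurable_add borel_measurable_times)
  have "images f (Suc n) e = (\<lambda>y. if y < 0 then scatter e (\<lambda>e'. images f n e' (0 + (- 1) * y))
      else if L e < y then scatter (flip e) (\<lambda>e'. images f n e' (- L e + 1 * y))
      else f e (max 0 (min (L e) y)))"
    by (auto simp: fun_eq_iff)
  also have "\<dots> \<in> borel_measurable borel"
    using Suc.prems assms by (intro measurable_If sc pred_intros_logic) auto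
  finally show ?case .
qed

lemma extend_LIMSEQ: "e \<in> H \<Longrightarrow> (\<lambda>n. images f n e y) \<longlonglongrightarrow> extend f e y"
proof (rule tendsto_eventually)
  assume e: "e \<in> H"
  show "\<forall>\<^sub>F n in sequentially. images f n e y = extend f e y"
    unfolding eventually_sequentially
  proof (intro exI[of _ "level y"] allI impI)
    fix n assume "level y \<le> n"
    then have "\<bar>y\<bar> \<le> real n * \<delta>"
      using level_bounds(1)[of y] \<delta>_pos by (meson mult_right_mono of_nat_mono order_trans less_imp_le)
    then show "images f n e y = extend f e y" using e by (simp add: extend_eq_images)
  qed
qed

text \<open>One round of reflection multiplies the supremum by at most \<open>3\<close> and advances by \<open>\<delta>\<close>.\<close>

lemma exp_growth_extend:
  assumes meas: "\<And>e. e \<in> H \<Longrightarrow> (\<lambda>y. f e (max 0 (min (L e) y))) \<in> borel_measurable borel"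
    and M: "\<And>e y. e \<in> H \<Longrightarrow> y \<in> {0..L e} \<Longrightarrow> \<bar>f e y\<bar> \<le> M" and "e \<in> H"
  shows "exp_growth (extend f e)"
  unfolding exp_growth_def
proof (intro conjI exI allI)
  show "extend f e \<in> borel_measurable borel"
    by (rule borel_measurable_LIMSEQ_real[OF extend_LIMSEQ images_measurable[OF meas]]) (use \<open>e \<in> H\<close> in auto)
  have M0: "0 \<le> M" using M[OF \<open>e \<in> H\<close>, of 0] L_pos[OF \<open>e \<in> H\<close>] by auto
  show "0 \<le> 3 * M" using M0 by simp
  show "0 \<le> ln 3 / \<delta>" using \<delta>_pos by simp
  show "\<bar>extend f e z\<bar> \<le> 3 * M * exp (ln 3 / \<delta> * \<bar>z\<bar>)" for z
  proof -
    have "\<bar>extend f e z\<bar> \<le> M * 3 ^ level z"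
      unfolding extend_def by (rule images_bound[OF _ M0 \<open>e \<in> H\<close>]) (rule M)
    also have "(3::real) ^ level z = exp (real (level z) * ln 3)"
      by (simp add: exp_of_nat_mult)
    also have "\<dots> \<le> exp ((\<bar>z\<bar> / \<delta> + 1) * ln 3)"
      using level_bounds(2)[of z] by (simp add: mult_right_mono)
    also have "(\<bar>z\<bar> / \<delta> + 1) * ln 3 = ln 3 + ln 3 / \<delta> * \<bar>z\<bar>" by (simp add: distrib_right)
    also have "exp \<dots> = 3 * exp (ln 3 / \<delta> * \<bar>z\<bar>)" by (simp add: exp_add)
    finally have "\<bar>extend f e z\<bar> \<le> M * (3 * exp (ln 3 / \<delta> * \<bar>z\<bar>))"
      using M0 by (simp add: mult_left_mono mult_right_mono)
    then show ?thesis by (simp add: mult_ac)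
  qed
qed

lemma continuous_on_images:
  assumes f: "vertex_compatible f" and cont: "\<And>e. e \<in> H \<Longrightarrow> continuous_on {0..L e} (f e)"
  shows "e \<in> H \<Longrightarrow> continuous_on UNIV (images f n e)"
proof (induction n arbitrary: e)
  case 0
  have "continuous_on UNIV (\<lambda>y. f e (max 0 (min (L e) y)))"
    by (rule continuous_on_compose2[OF cont[OF 0]]) (use L_pos[OF 0] in \<open>auto intro!: continuous_intros\<close>)
  then show ?case by simp
next
  case (Suc n)
  note e = Suc.prems
  have sc: "continuous_on S (\<lambda>y. scatter e (\<lambda>e'. images f n e' (a + b * y)))" if "e \<in> H" for e a b S
    unfolding scatter_def using that star_D
    by (intro continuous_on_diff continuous_on_mult continuous_on_sum continuous_on_const
        continuous_on_compose2[OF Suc.IH]) (auto intro!: continuous_intros)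
  have at0: "scatter e (\<lambda>e'. images f n e' 0) = f e 0" if "e \<in> H" for e
  proof -
    have "scatter e (\<lambda>e'. images f n e' 0) = (if org e = v0 then - f e 0 else f e 0)"
      using f that by (intro scatter_const) (auto simp: vertex_compatible_def images_base star_D L_pos less_imp_le)
    then show ?thesis using f that by (auto simp: vertex_compatible_def)
  qed
  have fl: "f (flip e) 0 = f e (L e)" using f e L_pos[OF e] by (auto simp: vertex_compatible_def)
  have "continuous_on ({..0} \<union> ({L e..} \<union> {0..L e})) (images f (Suc n) e)"
  proof (intro continuous_on_closed_Un)
    have "continuous_on {..0} (\<lambda>y. scatter e (\<lambda>e'. images f n e' (0 + (- 1) * y)))" by (rule sc[OF e])
    then show "continuous_on {..0} (images f (Suc n) e)"
      by (rule continuous_on_eq) (use at0[OF e] L_pos[OF e] in \<open>auto simp: less_le\<close>)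
    have "continuous_on {L e..} (\<lambda>y. scatter (flip e) (\<lambda>e'. images f n e' (- L e + 1 * y)))"
      by (rule sc) (use e in simp)
    then show "continuous_on {L e..} (images f (Suc n) e)"
      by (rule continuous_on_eq) (use at0[of "flip e"] fl L_pos[OF e] e in \<open>auto simp: less_le\<close>)
    show "continuous_on {0..L e} (images f (Suc n) e)"
      by (rule continuous_on_eq[OF cont[OF e]]) auto
  qed auto
  moreover have "{..0} \<union> ({L e..} \<union> {0..L e}) = UNIV" by auto
  ultimately show ?case by simp
qed

lemma continuous_on_extend:
  assumes f: "vertex_compatible f" and cont: "\<And>e. e \<in> H \<Longrightarrow> continuous_on {0..L e} (f e)" and e: "e \<in> H"
  shows "continuous_on UNIV (extend f e)"
proof (rule continuous_at_imp_continuous_on, rule ballI)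
  fix y :: real
  define n where "n = level (\<bar>y\<bar> + 1)"
  have n: "\<bar>y\<bar> + 1 \<le> real n * \<delta>" using level_bounds(1)[of "\<bar>y\<bar> + 1"] by (simp add: n_def)
  have "isCont (images f n e) y"
    using continuous_on_images[OF f cont e, of n] by (simp add: continuous_on_eq_continuous_at)
  moreover have "eventually (\<lambda>z. images f n e z = extend f e z) (nhds y)"
  proof -
    have "eventually (\<lambda>z. z \<in> {y - 1<..<y + 1}) (nhds y)" by (intro eventually_nhds_in_open) auto
    then show ?thesis by eventually_elim (use n e in \<open>auto intro!: extend_eq_images[symmetric]\<close>)
  qed
  ultimately show "isCont (extend f e) y" by (simp add: isCont_cong)
qed

text \<open>The reflection rule is stated for \<open>y \<ge> 0\<close> only; the parities that follow from it are symmetric in \<open>y\<close>.\<close>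

lemma extend_parity:
  assumes f: "vertex_compatible f" and e: "e \<in> H"
  shows "e' \<in> star e \<Longrightarrow> org e \<noteq> v0 \<Longrightarrow> extend f e (- y) - extend f e' (- y) = - (extend f e y - extend f e' y)"
    and "org e = v0 \<Longrightarrow> extend f e (- y) = - extend f e y"
    and "org e \<noteq> v0 \<Longrightarrow> (\<Sum>e'\<in>star e. extend f e' (- y)) = (\<Sum>e'\<in>star e. extend f e' y)"
proof -
  have odd: "extend f e (- y) = - extend f e y" if "org e = v0" "0 \<le> y" for y
    using extend_scatter[OF f e that(2)] that by (simp add: scatter_def)
  show "extend f e (- y) = - extend f e y" if "org e = v0"
    using odd[OF that, of y] odd[OF that, of "- y"] by (cases "0 \<le> y") auto
  have diff: "extend f e (- y) - extend f e' (- y) = - (extend f e y - extend f e' y)"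
    if "e' \<in> star e" "0 \<le> y" for e' y
    using extend_scatter[OF f e that(2)] extend_scatter[OF f star_D(1)[OF that(1)] that(2)] star_D[OF that(1)]
    by (simp add: scatter_def)
  show "extend f e (- y) - extend f e' (- y) = - (extend f e y - extend f e' y)" if "e' \<in> star e"
    using diff[OF that, of y] diff[OF that, of "- y"] by (cases "0 \<le> y") auto
  have even: "(\<Sum>e'\<in>star e. extend f e' (- y)) = (\<Sum>e'\<in>star e. extend f e' y)" if "org e \<noteq> v0" "0 \<le> y" for y
  proof -
    have "(\<Sum>e'\<in>star e. extend f e' (- y)) = (\<Sum>e'\<in>star e. scatter e' (\<lambda>e'. extend f e' y))"
      by (rule sum.cong) (use extend_scatter[OF f _ that(2)] star_D in auto)
    then show ?thesis using sum_scatter[OF e that(1)] by simp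
  qed
  show "(\<Sum>e'\<in>star e. extend f e' (- y)) = (\<Sum>e'\<in>star e. extend f e' y)" if "org e \<noteq> v0"
    using even[OF that, of y] even[OF that, of "- y"] by (cases "0 \<le> y") auto
qed

lemma heat_pot_extend_vertex:
  assumes f: "vertex_compatible f" and gr: "\<And>e. e \<in> H \<Longrightarrow> exp_growth (extend f e)" and e: "e \<in> H" and s: "0 < s"
  shows "e' \<in> star e \<Longrightarrow> heat_pot 0 (extend f e') 0 s = heat_pot 0 (extend f e) 0 s"
    and "org e = v0 \<Longrightarrow> heat_pot 0 (extend f e) 0 s = 0"
    and "org e \<noteq> v0 \<Longrightarrow> (\<Sum>e'\<in>star e. heat_pot 1 (extend f e') 0 s) = 0"
proof -
  show zero: "heat_pot 0 (extend f e) 0 s = 0" if "org e = v0"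
    by (rule heat_pot_0_odd) (rule extend_parity(2)[OF f e that])
  show "heat_pot 0 (extend f e') 0 s = heat_pot 0 (extend f e) 0 s" if "e' \<in> star e"
  proof (cases "org e = v0")
    case True
    have "heat_pot 0 (extend f e') 0 s = 0"
      by (rule heat_pot_0_odd) (rule extend_parity(2)[OF f], use star_D[OF that] True in auto)
    then show ?thesis using zero[OF True] by simp
  next
    case False
    have "heat_pot 0 (\<lambda>y. extend f e y - extend f e' y) 0 s = 0"
      by (rule heat_pot_0_odd) (rule extend_parity(1)[OF f e that False])
    then show ?thesis using heat_pot_diff[OF gr gr s] e star_D[OF that] by simp
  qed
  show "(\<Sum>e'\<in>star e. heat_pot 1 (extend f e') 0 s) = 0" if "org e \<noteq> v0"
    using heat_pot_1_even[of "\<lambda>y. \<Sum>e'\<in>star e. extend f e' y" s] extend_parity(3)[OF f e that]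
      heat_pot_sum[of "star e" "extend f" s 1 0] gr s star_D by auto
qed

text \<open>The equation and the derivatives are required up to the end points of each edge, for times in the
open interval; in return the vertices can be treated like interior points in the maximum principle.
Initial and Dirichlet data are not part of this notion.\<close>

definition heat_solution ::
    "real \<Rightarrow> ('h \<Rightarrow> real \<Rightarrow> real \<Rightarrow> real) \<Rightarrow> ('h \<Rightarrow> real \<Rightarrow> real \<Rightarrow> real) \<Rightarrow> ('h \<Rightarrow> real \<Rightarrow> real \<Rightarrow> real) \<Rightarrow> bool" where
  "heat_solution T U Uy Uyy \<longleftrightarrow>
     (\<forall>e\<in>H. continuous_on ({0..L e} \<times> {0..T}) (\<lambda>(y, t). U e y t)) \<and>
     (\<forall>e\<in>H. continuous_on ({0..L e} \<times> {0<..<T}) (\<lambda>(y, t). Uy e y t)) \<and>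
     (\<forall>e\<in>H. continuous_on ({0..L e} \<times> {0<..<T}) (\<lambda>(y, t). Uyy e y t)) \<and>
     (\<forall>e\<in>H. \<forall>y\<in>{0..L e}. \<forall>t\<in>{0<..<T}.
        ((\<lambda>y. U e y t) has_real_derivative Uy e y t) (at y within {0..L e}) \<and>
        ((\<lambda>y. Uy e y t) has_real_derivative Uyy e y t) (at y within {0..L e}) \<and>
        ((\<lambda>t. U e y t) has_real_derivative Uyy e y t) (at t)) \<and>
     (\<forall>e\<in>H. \<forall>y\<in>{0..L e}. \<forall>t\<in>{0..T}. U (flip e) y t = U e (L e - y) t) \<and>
     (\<forall>e\<in>H. \<forall>e'\<in>star e. \<forall>t\<in>{0..T}. U e' 0 t = U e 0 t) \<and>
     (\<forall>e\<in>H. org e \<noteq> v0 \<longrightarrow> (\<forall>t\<in>{0<..<T}. (\<Sum>e'\<in>star e. Uy e' 0 t) = 0))"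

theorem homogeneous_heat_solution_exists:
  assumes f: "vertex_compatible f" and cont: "\<And>e. e \<in> H \<Longrightarrow> continuous_on {0..L e} (f e)"
  obtains U Uy Uyy where "heat_solution T U Uy Uyy"
    "\<And>e y. e \<in> H \<Longrightarrow> y \<in> {0..L e} \<Longrightarrow> U e y 0 = f e y"
    "\<And>e t. e \<in> H \<Longrightarrow> org e = v0 \<Longrightarrow> 0 \<le> t \<Longrightarrow> U e 0 t = 0"
proof -
  have "\<exists>M. \<forall>y\<in>{0..L e}. \<bar>f e y\<bar> \<le> M" if "e \<in> H" for e
    using compact_imp_bounded[OF compact_continuous_image[OF cont[OF that] compact_Icc]]
    by (auto simp: bounded_iff)
  then obtain m where m: "\<And>e y. e \<in> H \<Longrightarrow> y \<in> {0..L e} \<Longrightarrow> \<bar>f e y\<bar> \<le> m e" by metis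
  have M: "\<bar>f e y\<bar> \<le> Max (m ` H)" if "e \<in> H" "y \<in> {0..L e}" for e y
    using m[OF that] that finite_H by (meson Max_ge finite_imageI imageI order_trans)
  have "continuous_on UNIV (\<lambda>y. f e (max 0 (min (L e) y)))" if "e \<in> H" for e
    by (rule continuous_on_compose2[OF cont[OF that]]) (use L_pos[OF that] in \<open>auto intro!: continuous_intros\<close>)
  then have meas: "(\<lambda>y. f e (max 0 (min (L e) y))) \<in> borel_measurable borel" if "e \<in> H" for e
    using that by (intro borel_measurable_continuous_onI)
  have gr: "exp_growth (extend f e)" if "e \<in> H" for e
    by (rule exp_growth_extend[OF meas M that])
  define U where "U = (\<lambda>e y t. if t = 0 then extend f e y else heat_pot 0 (extend f e) y t)"
  have "heat_solution T U (\<lambda>e. heat_pot 1 (extend f e)) (\<lambda>e. heat_pot 2 (extend f e))"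
    unfolding heat_solution_def
  proof (intro conjI ballI impI)
    fix e assume e: "e \<in> H"
    show "continuous_on ({0..L e} \<times> {0..T}) (\<lambda>(y, t). U e y t)"
      unfolding U_def
      by (rule continuous_on_subset[OF heat_pot_initial[OF gr[OF e] continuous_on_extend[OF f cont e]]]) auto
    show "continuous_on ({0..L e} \<times> {0<..<T}) (\<lambda>(y, t). heat_pot 1 (extend f e) y t)"
      by (rule continuous_on_subset[OF continuous_on_heat_pot[OF gr[OF e]]]) auto
    show "continuous_on ({0..L e} \<times> {0<..<T}) (\<lambda>(y, t). heat_pot 2 (extend f e) y t)"
      by (rule continuous_on_subset[OF continuous_on_heat_pot[OF gr[OF e]]]) auto
    {
      fix y t assume t: "t \<in> {0<..<T}"
      then have t0: "0 < t" by simp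
      show "((\<lambda>y. U e y t) has_real_derivative heat_pot 1 (extend f e) y t) (at y within {0..L e})"
        using t heat_pot_deriv_01[OF gr[OF e] t0] by (simp add: U_def has_field_derivative_at_within)
      show "((\<lambda>y. heat_pot 1 (extend f e) y t) has_real_derivative heat_pot 2 (extend f e) y t) (at y within {0..L e})"
        by (rule has_field_derivative_at_within[OF heat_pot_deriv_12[OF gr[OF e] t0]])
      show "((\<lambda>t. U e y t) has_real_derivative heat_pot 2 (extend f e) y t) (at t)"
        by (rule has_field_derivative_transform_within_open[OF heat_pot_time_deriv[OF gr[OF e] t0], of "{0<..}"])
           (use t0 in \<open>auto simp: U_def\<close>)
    }
    show "U (flip e) y t = U e (L e - y) t" if "y \<in> {0..L e}" "t \<in> {0..T}" for y t
    proof -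
      have "extend f (flip e) = (\<lambda>z. extend f e (L e - z))" using extend_flip[OF f e] by (simp add: fun_eq_iff)
      then show ?thesis using heat_pot_reflect[of 0 "extend f e" "L e" y t] by (simp add: U_def)
    qed
    show "U e' 0 t = U e 0 t" if "e' \<in> star e" "t \<in> {0..T}" for e' t
      using heat_pot_extend_vertex(1)[OF f gr e _ that(1), of t] that e f star_D[OF that(1)]
      by (auto simp: U_def extend_base L_pos less_imp_le vertex_compatible_def)
    show "(\<Sum>e'\<in>star e. heat_pot 1 (extend f e') 0 t) = 0" if "org e \<noteq> v0" "t \<in> {0<..<T}" for t
      using heat_pot_extend_vertex(3)[OF f gr e _ that(1), of t] that by auto
  qed
  moreover have "U e y 0 = f e y" if "e \<in> H" "y \<in> {0..L e}" for e y
    using that by (simp add: U_def extend_base)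
  moreover have "U e 0 t = 0" if "e \<in> H" "org e = v0" "0 \<le> t" for e t
    using that heat_pot_extend_vertex(2)[OF f gr that(1) _ that(2), of t] f
    by (cases "t = 0") (auto simp: U_def extend_base L_pos less_imp_le vertex_compatible_def)
  ultimately show thesis using that by blast
qed

lemma heat_solution_D:
  assumes "heat_solution T U Uy Uyy" "e \<in> H"
  shows "continuous_on ({0..L e} \<times> {0..T}) (\<lambda>(y, t). U e y t)"
    and "continuous_on ({0..L e} \<times> {0<..<T}) (\<lambda>(y, t). Uy e y t)"
    and "continuous_on ({0..L e} \<times> {0<..<T}) (\<lambda>(y, t). Uyy e y t)"
    and "y \<in> {0..L e} \<Longrightarrow> t \<in> {0<..<T} \<Longrightarrow> ((\<lambda>y. U e y t) has_real_derivative Uy e y t) (at y within {0..L e})"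
    and "y \<in> {0..L e} \<Longrightarrow> t \<in> {0<..<T} \<Longrightarrow> ((\<lambda>y. Uy e y t) has_real_derivative Uyy e y t) (at y within {0..L e})"
    and "y \<in> {0..L e} \<Longrightarrow> t \<in> {0<..<T} \<Longrightarrow> ((\<lambda>t. U e y t) has_real_derivative Uyy e y t) (at t)"
    and "y \<in> {0..L e} \<Longrightarrow> t \<in> {0..T} \<Longrightarrow> U (flip e) y t = U e (L e - y) t"
    and "e' \<in> star e \<Longrightarrow> t \<in> {0..T} \<Longrightarrow> U e' 0 t = U e 0 t"
    and "org e \<noteq> v0 \<Longrightarrow> t \<in> {0<..<T} \<Longrightarrow> (\<Sum>e'\<in>star e. Uy e' 0 t) = 0"
  using assms unfolding heat_solution_def by blast+

lemma heat_solution_lincomb: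
  assumes U: "heat_solution T U Uy Uyy" and V: "heat_solution T V Vy Vyy"
  shows "heat_solution T (\<lambda>e y t. a * U e y t + b * V e y t) (\<lambda>e y t. a * Uy e y t + b * Vy e y t)
    (\<lambda>e y t. a * Uyy e y t + b * Vyy e y t)"
  unfolding heat_solution_def case_prod_beta
proof (intro conjI ballI impI)
  fix e assume e: "e \<in> H"
  note U = heat_solution_D[OF U e] and V = heat_solution_D[OF V e]
  show "continuous_on ({0..L e} \<times> {0..T}) (\<lambda>x. a * U e (fst x) (snd x) + b * V e (fst x) (snd x))"
    using U(1) V(1) unfolding case_prod_beta by (intro continuous_intros)
  show "continuous_on ({0..L e} \<times> {0<..<T}) (\<lambda>x. a * Uy e (fst x) (snd x) + b * Vy e (fst x) (snd x))"
    using U(2) V(2) unfolding case_prod_beta by (intro continuous_intros)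
  show "continuous_on ({0..L e} \<times> {0<..<T}) (\<lambda>x. a * Uyy e (fst x) (snd x) + b * Vyy e (fst x) (snd x))"
    using U(3) V(3) unfolding case_prod_beta by (intro continuous_intros)
  {
    fix y t assume yt: "y \<in> {0..L e}" "t \<in> {0<..<T}"
    show "((\<lambda>y. a * U e y t + b * V e y t) has_real_derivative a * Uy e y t + b * Vy e y t) (at y within {0..L e})"
      by (intro DERIV_add DERIV_cmult U(4)[OF yt] V(4)[OF yt])
    show "((\<lambda>y. a * Uy e y t + b * Vy e y t) has_real_derivative a * Uyy e y t + b * Vyy e y t) (at y within {0..L e})"
      by (intro DERIV_add DERIV_cmult U(5)[OF yt] V(5)[OF yt])
    show "((\<lambda>t. a * U e y t + b * V e y t) has_real_derivative a * Uyy e y t + b * Vyy e y t) (at t)"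
      by (intro DERIV_add DERIV_cmult U(6)[OF yt] V(6)[OF yt])
  }
  show "a * U (flip e) y t + b * V (flip e) y t = a * U e (L e - y) t + b * V e (L e - y) t"
    if "y \<in> {0..L e}" "t \<in> {0..T}" for y t using U(7)[OF that] V(7)[OF that] by simp
  show "a * U e' 0 t + b * V e' 0 t = a * U e 0 t + b * V e 0 t" if "e' \<in> star e" "t \<in> {0..T}" for e' t
    using U(8)[OF that] V(8)[OF that] by simp
  show "(\<Sum>e'\<in>star e. a * Uy e' 0 t + b * Vy e' 0 t) = 0" if "org e \<noteq> v0" "t \<in> {0<..<T}" for t
    using U(9)[OF that] V(9)[OF that] by (simp add: sum.distrib flip: sum_distrib_left)
qed

lemma heat_solution_const: "heat_solution T (\<lambda>_ _ _. c) (\<lambda>_ _ _. 0) (\<lambda>_ _ _. 0)"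
  unfolding heat_solution_def by auto

section \<open>The maximum principle\<close>

lemma heat_solution_maximum_interior:
  assumes sol: "heat_solution T U Uy Uyy"
    and init: "\<And>e y. e \<in> H \<Longrightarrow> y \<in> {0..L e} \<Longrightarrow> U e y 0 \<le> c"
    and bdry: "\<And>e t. e \<in> H \<Longrightarrow> org e = v0 \<Longrightarrow> t \<in> {0..T} \<Longrightarrow> U e 0 t \<le> c"
    and e1: "e1 \<in> H" and y1: "y1 \<in> {0..L e1}" and t1: "t1 \<in> {0<..<T}"
  shows "U e1 y1 t1 \<le> c"
proof (rule ccontr)
  assume "\<not> U e1 y1 t1 \<le> c"
  then have pos: "c < U e1 y1 t1" by simp
  \<comment> \<open>Subtracting \<open>\<epsilon> * t\<close> makes the inequality strict and still leaves a value above \<open>c\<close>.\<close>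
  define \<epsilon> where "\<epsilon> = (U e1 y1 t1 - c) / (2 * t1)"
  have \<epsilon>: "0 < \<epsilon>" "\<epsilon> * t1 = (U e1 y1 t1 - c) / 2" using pos t1 by (auto simp: \<epsilon>_def)
  define v where "v = (\<lambda>e (p :: real \<times> real). U e (fst p) (snd p) - \<epsilon> * snd p)"
  have "\<exists>p\<in>{0..L e} \<times> {0..t1}. \<forall>q\<in>{0..L e} \<times> {0..t1}. v e q \<le> v e p" if e: "e \<in> H" for e
  proof (rule continuous_attains_sup)
    show "compact ({0..L e} \<times> {0..t1})" by (intro compact_Times compact_Icc)
    show "{0..L e} \<times> {0..t1} \<noteq> {}" using L_pos[OF e] t1 by auto
    have "continuous_on ({0..L e} \<times> {0..t1}) (\<lambda>(y, t). U e y t)"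
      by (rule continuous_on_subset[OF heat_solution_D(1)[OF sol e]]) (use t1 in auto)
    then show "continuous_on ({0..L e} \<times> {0..t1}) (v e)"
      unfolding v_def case_prod_beta by (intro continuous_intros)
  qed
  then obtain p where p: "\<And>e. e \<in> H \<Longrightarrow> p e \<in> {0..L e} \<times> {0..t1}"
    "\<And>e q. e \<in> H \<Longrightarrow> q \<in> {0..L e} \<times> {0..t1} \<Longrightarrow> v e q \<le> v e (p e)" by metis
  have "Max ((\<lambda>e. v e (p e)) ` H) \<in> (\<lambda>e. v e (p e)) ` H"
    using finite_H e1 by (intro Max_in) auto
  then obtain e0 where e0: "e0 \<in> H" "Max ((\<lambda>e. v e (p e)) ` H) = v e0 (p e0)" by auto
  have e0max: "v e (p e) \<le> v e0 (p e0)" if "e \<in> H" for e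
    unfolding e0(2)[symmetric] using finite_H that by (intro Max_ge) auto
  obtain y0 t0 where yt0: "p e0 = (y0, t0)" by (cases "p e0")
  \<comment> \<open>Reversing the edge moves a maximum at its far end to its origin.\<close>
  define e y where "e = (if y0 = L e0 then flip e0 else e0)" and "y = (if y0 = L e0 then 0 else y0)"
  have t0: "t0 \<in> {0..t1}" and y0: "y0 \<in> {0..L e0}" using p(1)[OF e0(1)] yt0 by auto
  have e: "e \<in> H" using e0 by (simp add: e_def)
  have y: "0 \<le> y" "y < L e" using y0 e0 L_pos[OF e0(1)] by (auto simp: e_def y_def)
  have Uval: "U e y t0 = U e0 y0 t0"
    using heat_solution_D(7)[OF sol e0(1), of 0 t0] t0 t1 L_pos[OF e0(1)] by (auto simp: e_def y_def)
  have max: "U e' y' t' - \<epsilon> * t' \<le> U e y t0 - \<epsilon> * t0" if "e' \<in> H" "y' \<in> {0..L e'}" "t' \<in> {0..t1}" for e' y' t'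
    using p(2)[OF that(1), of "(y', t')"] e0max[OF that(1)] that Uval by (simp add: v_def yt0)
  have big: "c < U e y t0 - \<epsilon> * t0"
    using max[OF e1 y1, of t1] t1 \<epsilon>(2) pos by (simp add: field_simps)
  have "t0 \<noteq> 0" using big init[OF e, of y] y by auto
  then have t0': "t0 \<in> {0<..<T}" using t0 t1 by auto
  have et: "0 \<le> \<epsilon> * t0" using \<epsilon> t0 by simp
  have nb: "org e \<noteq> v0" if "y = 0"
    using bdry[OF e, of t0] that big et t0' by auto
  have yin: "y \<in> {0..L e}" using y by simp
  have maxy: "U e' y' t0 \<le> U e y t0" if "e' \<in> H" "y' \<in> {0..L e'}" for e' y'
    using max[OF that t0] by simp
  have slope: "Uy e' y' t0 \<le> 0" if "e' \<in> H" "0 \<le> y'" "y' < L e'" "U e' y' t0 = U e y t0" for e' y'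
  proof (rule ccontr)
    assume "\<not> Uy e' y' t0 \<le> 0"
    moreover have "((\<lambda>y. U e' y t0) has_real_derivative Uy e' y' t0) (at y' within {0..L e'})"
      by (rule heat_solution_D(4)[OF sol that(1) _ t0']) (use that in simp)
    ultimately obtain d where d: "0 < d" "\<And>h. 0 < h \<Longrightarrow> y' + h \<in> {0..L e'} \<Longrightarrow> h < d \<Longrightarrow> U e' y' t0 < U e' (y' + h) t0"
      using has_real_derivative_pos_inc_right[of "\<lambda>y. U e' y t0" "Uy e' y' t0" y' "{0..L e'}"] by auto
    define h where "h = min (d / 2) (L e' - y')"
    have h: "0 < h" "y' + h \<in> {0..L e'}" "h < d" using d(1) that by (auto simp: h_def)
    show False using d(2)[OF h] maxy[OF that(1) h(2)] that(4) by simp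
  qed
  have "Uy e y t0 = 0"
  proof (cases "y = 0")
    case True
    have "Uy e' 0 t0 \<le> 0" if "e' \<in> star e" for e'
      using heat_solution_D(8)[OF sol e that, of t0] t0' True star_D[OF that] L_pos by (intro slope) auto
    moreover have "(\<Sum>e'\<in>star e. - Uy e' 0 t0) = 0"
      using heat_solution_D(9)[OF sol e nb[OF True] t0'] by (simp add: sum_negf)
    ultimately have "\<forall>e'\<in>star e. - Uy e' 0 t0 = 0" by (subst (asm) sum_nonneg_eq_0_iff) auto
    then show ?thesis using True star_self[OF e] by simp
  next
    case False
    have "((\<lambda>y. U e y t0) has_real_derivative Uy e y t0) (at y)"
      using heat_solution_D(4)[OF sol e yin t0'] at_within_interior[of y "{0..L e}"] False y by auto
    moreover have "0 < min y (L e - y)" using False y by auto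
    moreover have "\<forall>z. \<bar>y - z\<bar> < min y (L e - y) \<longrightarrow> U e z t0 \<le> U e y t0"
      by (intro allI impI maxy e) auto
    ultimately show ?thesis by (rule DERIV_local_max)
  qed
  have "Uyy e y t0 \<le> 0"
  proof (rule ccontr)
    assume "\<not> Uyy e y t0 \<le> 0"
    then obtain d where d: "0 < d" "\<And>h. 0 < h \<Longrightarrow> y + h \<in> {0..L e} \<Longrightarrow> h < d \<Longrightarrow> Uy e y t0 < Uy e (y + h) t0"
      using has_real_derivative_pos_inc_right[OF heat_solution_D(5)[OF sol e yin t0']] by auto
    define h where "h = min (d / 2) (L e - y)"
    have h: "0 < h" "y + h \<in> {0..L e}" "h < d" using d(1) y by (auto simp: h_def)
    have "U e y t0 < U e (y + h) t0"
    proof (rule DERIV_pos_imp_increasing_open[of y "y + h" "\<lambda>z. U e z t0"])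
      show "continuous_on {y..y + h} (\<lambda>z. U e z t0)"
        by (intro continuous_on_kernel_compose[OF heat_solution_D(1)[OF sol e]] continuous_intros)
           (use h y t0 t1 in auto)
      fix z assume z: "y < z" "z < y + h"
      have "((\<lambda>z. U e z t0) has_real_derivative Uy e z t0) (at z)"
        using heat_solution_D(4)[OF sol e _ t0', of z] at_within_interior[of z "{0..L e}"] z h y by auto
      moreover have "0 < Uy e z t0" using d(2)[of "z - y"] z h y \<open>Uy e y t0 = 0\<close> by simp
      ultimately show "\<exists>D. ((\<lambda>z. U e z t0) has_real_derivative D) (at z) \<and> 0 < D" by blast
    qed (use h in simp)
    then show False using maxy[OF e h(2)] by simp
  qed
  moreover have "\<epsilon> \<le> Uyy e y t0"
  proof (rule ccontr)
    assume less: "\<not> \<epsilon> \<le> Uyy e y t0"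
    have "((\<lambda>t. U e y t - \<epsilon> * t) has_real_derivative Uyy e y t0 - \<epsilon>) (at t0)"
      using DERIV_diff[OF heat_solution_D(6)[OF sol e yin t0'] DERIV_cmult_Id] .
    then obtain d where d: "0 < d" "\<And>h. 0 < h \<Longrightarrow> h < d \<Longrightarrow> U e y t0 - \<epsilon> * t0 < U e y (t0 - h) - \<epsilon> * (t0 - h)"
      using DERIV_neg_dec_left[of "\<lambda>t. U e y t - \<epsilon> * t" "Uyy e y t0 - \<epsilon>" t0] less by auto
    define h where "h = min (d / 2) t0"
    have h: "0 < h" "h < d" "t0 - h \<in> {0..t1}" using d t0 t0' by (auto simp: h_def)
    show False using d(2)[OF h(1,2)] max[OF e yin h(3)] by simp
  qed
  ultimately show False using \<epsilon> by simp
qed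

theorem heat_solution_maximum:
  assumes T: "0 < T" and sol: "heat_solution T U Uy Uyy"
    and init: "\<And>e y. e \<in> H \<Longrightarrow> y \<in> {0..L e} \<Longrightarrow> U e y 0 \<le> c"
    and bdry: "\<And>e t. e \<in> H \<Longrightarrow> org e = v0 \<Longrightarrow> t \<in> {0..T} \<Longrightarrow> U e 0 t \<le> c"
    and e: "e \<in> H" and y: "y \<in> {0..L e}" and t: "t \<in> {0..T}"
  shows "U e y t \<le> c"
proof -
  have "continuous_on {0..T} (\<lambda>t. U e y t)"
    by (intro continuous_on_kernel_compose[OF heat_solution_D(1)[OF sol e]] continuous_intros) (use y in auto)
  then have "continuous_on (closure {0<..<T}) (\<lambda>t. U e y t)" using T by simp
  moreover have "U e y t \<le> c" if "t \<in> {0<..<T}" for t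
    using heat_solution_maximum_interior[OF sol init bdry e y that] by blast
  ultimately show ?thesis
    using continuous_le_on_closure[of "{0<..<T}" "U e y" t c] t T by simp
qed

corollary heat_solution_minimum:
  assumes T: "0 < T" and sol: "heat_solution T U Uy Uyy"
    and init: "\<And>e y. e \<in> H \<Longrightarrow> y \<in> {0..L e} \<Longrightarrow> c \<le> U e y 0"
    and bdry: "\<And>e t. e \<in> H \<Longrightarrow> org e = v0 \<Longrightarrow> t \<in> {0..T} \<Longrightarrow> c \<le> U e 0 t"
    and e: "e \<in> H" and y: "y \<in> {0..L e}" and t: "t \<in> {0..T}"
  shows "c \<le> U e y t"
  using heat_solution_maximum[OF T heat_solution_lincomb[OF sol heat_solution_const[of T 0], of "- 1" 0], of "- c" e y t]
    init bdry e y t by simp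

corollary heat_solution_unique:
  assumes T: "0 < T" and U: "heat_solution T U Uy Uyy" and V: "heat_solution T V Vy Vyy"
    and init: "\<And>e y. e \<in> H \<Longrightarrow> y \<in> {0..L e} \<Longrightarrow> U e y 0 = V e y 0"
    and bdry: "\<And>e t. e \<in> H \<Longrightarrow> org e = v0 \<Longrightarrow> t \<in> {0..T} \<Longrightarrow> U e 0 t = V e 0 t"
    and e: "e \<in> H" and y: "y \<in> {0..L e}" and t: "t \<in> {0..T}"
  shows "U e y t = V e y t"
proof -
  note d = heat_solution_lincomb[OF U V, of 1 "- 1"]
  have "1 * U e y t + - 1 * V e y t \<le> 0" by (rule heat_solution_maximum[OF T d _ _ e y t]) (use init bdry in auto)
  moreover have "0 \<le> 1 * U e y t + - 1 * V e y t" by (rule heat_solution_minimum[OF T d _ _ e y t]) (use init bdry in auto)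
  ultimately show ?thesis by simp
qed

section \<open>Prescribed values at the Dirichlet vertex\<close>

definition at_v0 :: "'h \<Rightarrow> real" where "at_v0 e = (if org e = v0 then 1 else 0)"

text \<open>The initial datum \<open>1\<close>, changed to \<open>0\<close> at the Dirichlet vertex so that it is compatible there. Its
extension jumps at that vertex.\<close>

definition punctured_one :: "'h \<Rightarrow> real \<Rightarrow> real" where
  "punctured_one e y = (if y = 0 \<and> org e = v0 \<or> y = L e \<and> org (flip e) = v0 then 0 else 1)"

lemma vertex_compatible_punctured_one: "vertex_compatible punctured_one"
  unfolding vertex_compatible_def
proof (intro conjI ballI impI)
  fix e assume e: "e \<in> H"
  show "punctured_one (flip e) y = punctured_one e (L e - y)" if "y \<in> {0..L e}" for y
    using e by (auto simp: punctured_one_def)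
  show "punctured_one e' 0 = punctured_one e 0" if e': "e' \<in> star e" for e'
    using L_pos[OF e] L_pos[OF star_D(1)[OF e']] star_D(2)[OF e'] by (simp add: punctured_one_def)
  show "punctured_one e 0 = 0" if "org e = v0"
    using that by (simp add: punctured_one_def)
qed

text \<open>The initial datum whose evolution has boundary value \<open>1\<close> at \<open>v0\<close> and vanishes initially on the rest of the graph.\<close>

definition defect :: "'h \<Rightarrow> real \<Rightarrow> real" where
  "defect e z = 1 - extend punctured_one e z"

lemma exp_growth_extend_punctured_one: assumes "e \<in> H" shows "exp_growth (extend punctured_one e)"
proof (rule exp_growth_extend[OF _ _ assms])
  show "(\<lambda>y. punctured_one e (max 0 (min (L e) y))) \<in> borel_measurable borel" for e
    unfolding punctured_one_def by measurable
  show "\<bar>punctured_one e y\<bar> \<le> 1" for e y by (simp add: punctured_one_def)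
qed

lemma exp_growth_defect: "e \<in> H \<Longrightarrow> exp_growth (defect e)"
  unfolding defect_def[abs_def]
  by (intro exp_growth_diff exp_growth_extend_punctured_one exp_growth_bounded[of _ 1]) auto

text \<open>What is left of the datum after the steps at those ends of the edge that lie at \<open>v0\<close>.\<close>

definition remainder :: "'h \<Rightarrow> real \<Rightarrow> real" where
  "remainder e z = defect e z - at_v0 e * unit_step z - at_v0 (flip e) * unit_step (L e - z)"

lemma exp_growth_remainder: "e \<in> H \<Longrightarrow> exp_growth (remainder e)"
  unfolding remainder_def[abs_def]
  by (intro exp_growth_diff exp_growth_cmult exp_growth_defect exp_growth_reflect exp_growth_unit_step)

lemma remainder_flip: "e \<in> H \<Longrightarrow> remainder (flip e) z = remainder e (L e - z)"
  using extend_flip[OF vertex_compatible_punctured_one, of e z] by (simp add: remainder_def defect_def)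

text \<open>On the edge, away from an end at \<open>v0\<close>, the extension of \<open>1\<close> is \<open>1\<close>. Up to a distance \<open>\<delta>\<close> beyond an end it is \<open>1\<close> again if that end is
a transition vertex, because the reflected data are all \<open>1\<close>, and \<open>- 1\<close> if it is \<open>v0\<close>, which the step accounts for.\<close>

lemma remainder_flat:
  assumes e: "e \<in> H" and z: "z \<in> {- \<delta><..<L e + \<delta>}"
  shows "remainder e z = 0"
proof -
  have left: "remainder e z = 0" if e: "e \<in> H" and z: "- \<delta> < z" "z < L e" for e z
  proof -
    consider "0 < z" | "z = 0" | "z < 0" by linarith
    then show ?thesis
    proof cases
      case 1
      then have "extend punctured_one e z = 1" using z e by (simp add: extend_base punctured_one_def)
      then show ?thesis using 1 z by (simp add: remainder_def defect_def unit_step_def)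
    next
      case 2
      then have "extend punctured_one e z = (if org e = v0 then 0 else 1)"
        using L_pos[OF e] e by (simp add: extend_base punctured_one_def)
      then show ?thesis using 2 L_pos[OF e] by (simp add: remainder_def defect_def unit_step_def at_v0_def)
    next
      case 3
      have "extend punctured_one e' (- z) = 1" if "e' \<in> star e" for e'
        using 3 z \<delta>_le[OF star_D(1)[OF that]] star_D(1)[OF that] by (simp add: extend_base punctured_one_def)
      then have "scatter e (\<lambda>e'. extend punctured_one e' (- z)) = (if org e = v0 then - 1 else 1)"
        by (rule scatter_const[OF e])
      then have "extend punctured_one e z = (if org e = v0 then - 1 else 1)"
        using extend_scatter[OF vertex_compatible_punctured_one e, of "- z"] 3 by simp
      then show ?thesis using 3 L_pos[OF e] by (simp add: remainder_def defect_def unit_step_def at_v0_def)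
    qed
  qed
  show ?thesis
  proof (cases "z < L e")
    case True then show ?thesis using left[OF e] z by simp
  next
    case False
    have "remainder e z = remainder (flip e) (L e - z)" using remainder_flip[OF e, of "L e - z"] by simp
    also have "\<dots> = 0" using False z e L_pos[OF e] by (intro left) auto
    finally show ?thesis .
  qed
qed

lemma heat_ext_defect:
  assumes e: "e \<in> H"
  shows "heat_ext i (defect e) y s = at_v0 e * bdry_ker i y s
    + at_v0 (flip e) * ((if i = 1 then - 1 else 1) * bdry_ker i (L e - y) s) + heat_ext i (remainder e) y s"
proof (cases "0 < s")
  case True
  have "defect e = (\<lambda>z. at_v0 e * unit_step z + at_v0 (flip e) * unit_step (L e - z) + remainder e z)"
    by (simp add: remainder_def fun_eq_iff)
  then have "heat_pot i (defect e) y s = heat_pot i (\<lambda>z. at_v0 e * unit_step z + at_v0 (flip e) * unit_step (L e - z) + remainder e z) y s"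
    by simp
  also have "\<dots> = heat_pot i (\<lambda>z. at_v0 e * unit_step z) y s + heat_pot i (\<lambda>z. at_v0 (flip e) * unit_step (L e - z)) y s
      + heat_pot i (remainder e) y s"
    by (simp add: heat_pot_add exp_growth_add exp_growth_cmult exp_growth_reflect exp_growth_unit_step
        exp_growth_remainder e True)
  finally show ?thesis
    using True by (simp add: heat_ext_def heat_pot_cmult heat_pot_reflect[of i unit_step])
qed (simp add: heat_ext_def)

lemma heat_pot_defect:
  assumes e: "e \<in> H" and s: "0 < s"
  shows "heat_pot 0 (defect e) y s = 1 - heat_pot 0 (extend punctured_one e) y s"
    and "heat_pot 1 (defect e) y s = - heat_pot 1 (extend punctured_one e) y s"
  using heat_pot_diff[OF exp_growth_bounded[of "\<lambda>_. 1" 1] exp_growth_extend_punctured_one[OF e] s, of _ y]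
    heat_pot_0_const[OF s, of 1 y] heat_pot_1_const[OF s, of 1 y]
  by (simp_all add: defect_def[abs_def] del: One_nat_def)

lemma heat_ext_defect_vertex:
  assumes e: "e \<in> H"
  shows "e' \<in> star e \<Longrightarrow> heat_ext 0 (defect e') 0 s = heat_ext 0 (defect e) 0 s"
    and "org e = v0 \<Longrightarrow> heat_ext 0 (defect e) 0 s = bdry_ker 0 0 s"
    and "org e \<noteq> v0 \<Longrightarrow> (\<Sum>e'\<in>star e. heat_ext 1 (defect e') 0 s) = 0"
proof -
  note vertex = heat_pot_extend_vertex[OF vertex_compatible_punctured_one exp_growth_extend_punctured_one e]
  show "heat_ext 0 (defect e') 0 s = heat_ext 0 (defect e) 0 s" if "e' \<in> star e"
    using vertex(1)[OF _ _ that, of s] heat_pot_defect(1)[of _ s 0] e star_D[OF that] by (auto simp: heat_ext_def)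
  show "heat_ext 0 (defect e) 0 s = bdry_ker 0 0 s" if "org e = v0"
    using vertex(2)[OF _ _ that, of s] heat_pot_defect(1)[of _ s 0] e bdry_ker_0_origin[of s] by (auto simp: heat_ext_def)
  show "(\<Sum>e'\<in>star e. heat_ext 1 (defect e') 0 s) = 0" if "org e \<noteq> v0"
  proof (cases "0 < s")
    case True
    have "(\<Sum>e'\<in>star e. heat_ext 1 (defect e') 0 s) = (\<Sum>e'\<in>star e. - heat_pot 1 (extend punctured_one e') 0 s)"
      by (rule sum.cong) (use True heat_pot_defect(2) star_D in \<open>auto simp: heat_ext_def simp del: One_nat_def\<close>)
    then show ?thesis using vertex(3)[OF _ True that] by (simp add: sum_negf del: One_nat_def)
  qed (simp add: heat_ext_def)
qed

text \<open>Regularity on an edge is that of the half-line solutions and of the integral with the remainder.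
For the vertex conditions these are recombined
into the single kernel \<open>heat_ext i (defect e)\<close>, which inherits them from the homogeneous
solution for every positive time.\<close>

theorem boundary_heat_solution_exists:
  assumes T: "0 < T" and h: "continuous_on {0..T} h"
  obtains U Uy Uyy where "heat_solution T U Uy Uyy"
    "\<And>e y. e \<in> H \<Longrightarrow> y \<in> {0..L e} \<Longrightarrow> U e y 0 = 0"
    "\<And>e t. e \<in> H \<Longrightarrow> org e = v0 \<Longrightarrow> t \<in> {0..T} \<Longrightarrow> U e 0 t = integral {0..t} h"
proof -
  from half_line_solution[OF T h] obtain B0 B1 B2 :: "real \<Rightarrow> real \<Rightarrow> real" where
    B0: "continuous_on ({0..} \<times> {0..T}) (\<lambda>(y, t). B0 y t)" and
    B1: "continuous_on ({0..} \<times> {0<..<T}) (\<lambda>(y, t). B1 y t)" and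
    B2: "continuous_on ({0..} \<times> {0<..<T}) (\<lambda>(y, t). B2 y t)" and
    B0_0: "\<And>t. t \<in> {0..T} \<Longrightarrow> B0 0 t = integral {0..t} h" and
    B0_pos: "\<And>y t. 0 < y \<Longrightarrow> B0 y t = duhamel T h (bdry_ker 0) y t" and
    B1_pos: "\<And>y t. 0 < y \<Longrightarrow> t \<in> {0<..<T} \<Longrightarrow> B1 y t = duhamel T h (bdry_ker 1) y t" and
    B01: "\<And>y t. 0 \<le> y \<Longrightarrow> t \<in> {0<..<T} \<Longrightarrow> ((\<lambda>y. B0 y t) has_real_derivative B1 y t) (at y within {0..})" and
    B12: "\<And>y t. 0 \<le> y \<Longrightarrow> t \<in> {0<..<T} \<Longrightarrow> ((\<lambda>y. B1 y t) has_real_derivative B2 y t) (at y within {0..})" and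
    B02: "\<And>y t. 0 \<le> y \<Longrightarrow> t \<in> {0<..<T} \<Longrightarrow> ((\<lambda>t. B0 y t) has_real_derivative B2 y t) (at t)"
    by blast
  define W where "W = (\<lambda>i e. duhamel T h (heat_ext i (remainder e)))"
  define N where "N = (\<lambda>e. {- \<delta><..<L e + \<delta>})"
  have kern: "continuous_on (N e \<times> UNIV) (\<lambda>(y, s). heat_ext i (remainder e) y s)" if "e \<in> H" for i e
    unfolding N_def by (rule continuous_on_heat_ext[OF exp_growth_remainder[OF that] _ remainder_flat[OF that]]) auto
  have N: "y \<in> N e" if "y \<in> {0..L e}" for e y using that \<delta>_pos by (auto simp: N_def)
  have N_open: "open (N e)" for e by (simp add: N_def)
  have N_flat: "remainder e z = 0" if "e \<in> H" "z \<in> N e" for e z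
    using remainder_flat[OF that(1)] that(2) by (simp add: N_def)
  have W_cont: "continuous_on ({0..L e} \<times> S) (\<lambda>(y, t). W i e y t)" if "e \<in> H" for i e S
    unfolding W_def by (rule continuous_on_subset[OF continuous_on_duhamel[OF kern[OF that] h]]) (use N in auto)
  have conv: "convex (N e)" for e by (simp add: N_def)
  have W01: "((\<lambda>y. W 0 e y t) has_real_derivative W 1 e y t) (at y within {0..L e})" if "e \<in> H" "y \<in> {0..L e}" for e y t
    unfolding W_def
    by (rule DERIV_subset[OF duhamel_space_deriv[OF kern[OF that(1)] kern[OF that(1)] h conv N[OF that(2)]
        has_field_derivative_at_within[OF heat_ext_deriv_01[OF exp_growth_remainder[OF that(1)]]]]]) (use N in auto)
  have W12: "((\<lambda>y. W 1 e y t) has_real_derivative W 2 e y t) (at y within {0..L e})" if "e \<in> H" "y \<in> {0..L e}" for e y t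
    unfolding W_def
    by (rule DERIV_subset[OF duhamel_space_deriv[OF kern[OF that(1)] kern[OF that(1)] h conv N[OF that(2)]
        has_field_derivative_at_within[OF heat_ext_deriv_12[OF exp_growth_remainder[OF that(1)]]]]]) (use N in auto)
  have W02: "((\<lambda>t. W 0 e y t) has_real_derivative W 2 e y t) (at t)" if "e \<in> H" "y \<in> {0..L e}" for e y t
    unfolding W_def
    by (rule duhamel_time_deriv[OF kern[OF that(1)] kern[OF that(1)] h N[OF that(2)]
        heat_ext_time_deriv[OF exp_growth_remainder[OF that(1)] N_open N[OF that(2)] N_flat[OF that(1)]]])
  define U where "U = (\<lambda>e y t. at_v0 e * B0 y t + at_v0 (flip e) * B0 (L e - y) t + W 0 e y t)"
  define Uy where "Uy = (\<lambda>e y t. at_v0 e * B1 y t + at_v0 (flip e) * - B1 (L e - y) t + W 1 e y t)"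
  define Uyy where "Uyy = (\<lambda>e y t. at_v0 e * B2 y t + at_v0 (flip e) * B2 (L e - y) t + W 2 e y t)"
  have refl: "((\<lambda>y. f (L e - y)) has_real_derivative - D) (at y within {0..L e})"
    if "(f has_real_derivative D) (at (L e - y) within {0..})" for e y D and f :: "real \<Rightarrow> real"
  proof -
    have "((\<lambda>y. L e - y) ` {0..L e}) \<subseteq> {0..}" by auto
    then have "(f has_real_derivative D) (at (L e - y) within (\<lambda>y. L e - y) ` {0..L e})"
      using that by (rule DERIV_subset[rotated])
    moreover have "((\<lambda>y. L e - y) has_real_derivative - 1) (at y within {0..L e})"
      by (auto intro!: derivative_eq_intros)
    ultimately have "(f \<circ> (\<lambda>y. L e - y) has_real_derivative D * - 1) (at y within {0..L e})"
      by (rule DERIV_image_chain)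
    then show ?thesis by (simp add: o_def)
  qed
  have int_B: "(\<lambda>s. bdry_ker i (L e) (t - s) * h s) integrable_on {0..T}" if "e \<in> H" for i e t
    by (rule duhamel_integrable[OF continuous_on_bdry_ker h]) (use L_pos that in auto)
  have int_W: "(\<lambda>s. heat_ext i (remainder e) 0 (t - s) * h s) integrable_on {0..T}" if "e \<in> H" for i e t
    by (rule duhamel_integrable[OF kern h N]) (use L_pos that in \<open>auto simp: less_imp_le\<close>)
  have vertex_kernel: "at_v0 (flip e) * ((if i = 1 then - 1 else 1) * duhamel T h (bdry_ker i) (L e) t) + W i e 0 t =
      integral {0..T} (\<lambda>s. (heat_ext i (defect e) 0 (t - s) - at_v0 e * bdry_ker i 0 (t - s)) * h s)"
    and int_vertex: "(\<lambda>s. (heat_ext i (defect e) 0 (t - s) - at_v0 e * bdry_ker i 0 (t - s)) * h s) integrable_on {0..T}"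
    if "e \<in> H" for i e t
  proof -
    let ?c = "at_v0 (flip e) * (if i = 1 then - 1 else 1)"
    have "(\<lambda>s. (heat_ext i (defect e) 0 (t - s) - at_v0 e * bdry_ker i 0 (t - s)) * h s) =
      (\<lambda>s. ?c * (bdry_ker i (L e) (t - s) * h s) + heat_ext i (remainder e) 0 (t - s) * h s)"
      unfolding heat_ext_defect[OF that] by (simp add: fun_eq_iff algebra_simps)
    moreover have "((\<lambda>s. ?c * (bdry_ker i (L e) (t - s) * h s) + heat_ext i (remainder e) 0 (t - s) * h s)
       has_integral ?c * duhamel T h (bdry_ker i) (L e) t + W i e 0 t) {0..T}"
      unfolding W_def duhamel_def
      by (intro has_integral_add has_integral_mult_right integrable_integral int_B int_W that)
    ultimately have *: "((\<lambda>s. (heat_ext i (defect e) 0 (t - s) - at_v0 e * bdry_ker i 0 (t - s)) * h s)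
       has_integral ?c * duhamel T h (bdry_ker i) (L e) t + W i e 0 t) {0..T}" by simp
    show "at_v0 (flip e) * ((if i = 1 then - 1 else 1) * duhamel T h (bdry_ker i) (L e) t) + W i e 0 t =
      integral {0..T} (\<lambda>s. (heat_ext i (defect e) 0 (t - s) - at_v0 e * bdry_ker i 0 (t - s)) * h s)"
      using integral_unique[OF *] by (simp add: mult.assoc)
    show "(\<lambda>s. (heat_ext i (defect e) 0 (t - s) - at_v0 e * bdry_ker i 0 (t - s)) * h s) integrable_on {0..T}"
      using * by blast
  qed
  have U_bdry: "U e 0 t = integral {0..t} h" if "e \<in> H" "org e = v0" "t \<in> {0..T}" for e t
  proof -
    have "U e 0 t = integral {0..t} h + integral {0..T} (\<lambda>s. (heat_ext 0 (defect e) 0 (t - s) - at_v0 e * bdry_ker 0 0 (t - s)) * h s)"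
      using vertex_kernel[OF that(1), of 0 t] B0_0[OF that(3)] B0_pos[OF L_pos[OF that(1)]] that(2)
      by (simp add: U_def at_v0_def)
    then show ?thesis using heat_ext_defect_vertex(2)[OF that(1,2)] that(2) by (simp add: at_v0_def)
  qed
  have "heat_solution T U Uy Uyy"
    unfolding heat_solution_def
  proof (intro conjI ballI impI)
    fix e assume e: "e \<in> H"
    show "continuous_on ({0..L e} \<times> {0..T}) (\<lambda>(y, t). U e y t)"
      unfolding U_def case_prod_beta
      by (intro continuous_on_add continuous_on_mult continuous_on_const continuous_on_kernel_compose[OF B0]
          continuous_on_kernel_compose[OF W_cont[OF e]] continuous_intros) auto
    show "continuous_on ({0..L e} \<times> {0<..<T}) (\<lambda>(y, t). Uy e y t)"
      unfolding Uy_def case_prod_beta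
      by (intro continuous_on_add continuous_on_mult continuous_on_minus continuous_on_const continuous_on_kernel_compose[OF B1]
          continuous_on_kernel_compose[OF W_cont[OF e]] continuous_intros) auto
    show "continuous_on ({0..L e} \<times> {0<..<T}) (\<lambda>(y, t). Uyy e y t)"
      unfolding Uyy_def case_prod_beta
      by (intro continuous_on_add continuous_on_mult continuous_on_const continuous_on_kernel_compose[OF B2]
          continuous_on_kernel_compose[OF W_cont[OF e]] continuous_intros) auto
    {
      fix y t assume y: "y \<in> {0..L e}" and t: "t \<in> {0<..<T}"
      have y': "0 \<le> y" "0 \<le> L e - y" using y by auto
      have sub: "{0..L e} \<subseteq> {0..}" by auto
      show "((\<lambda>y. U e y t) has_real_derivative Uy e y t) (at y within {0..L e})"
        unfolding U_def Uy_def
        by (intro DERIV_add DERIV_cmult refl W01 e y DERIV_subset[OF B01 sub] B01 y' t)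
      have "((\<lambda>y. Uy e y t) has_real_derivative
          at_v0 e * B2 y t + at_v0 (flip e) * - (- B2 (L e - y) t) + W 2 e y t) (at y within {0..L e})"
        unfolding Uy_def
        by (intro DERIV_add DERIV_cmult DERIV_minus refl W12 e y DERIV_subset[OF B12 sub] B12 y' t)
      then show "((\<lambda>y. Uy e y t) has_real_derivative Uyy e y t) (at y within {0..L e})"
        by (simp add: Uyy_def)
      show "((\<lambda>t. U e y t) has_real_derivative Uyy e y t) (at t)"
        unfolding U_def Uyy_def
        by (intro DERIV_add DERIV_cmult W02 e y B02 y' t)
    }
    show "U (flip e) y t = U e (L e - y) t" if "y \<in> {0..L e}" "t \<in> {0..T}" for y t
    proof -
      have "remainder (flip e) = (\<lambda>z. remainder e (L e - z))" using remainder_flip[OF e] by (simp add: fun_eq_iff)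
      then have "heat_ext 0 (remainder (flip e)) y s = heat_ext 0 (remainder e) (L e - y) s" for s
        using heat_pot_reflect[of 0 "remainder e" "L e" y s] by (simp add: heat_ext_def)
      then show ?thesis using e by (simp add: U_def W_def duhamel_def)
    qed
    show "U e' 0 t = U e 0 t" if e': "e' \<in> star e" and t: "t \<in> {0..T}" for e' t
    proof (cases "org e = v0")
      case True
      then show ?thesis using U_bdry e star_D[OF e'] t by simp
    next
      case False
      have *: "U e 0 t = integral {0..T} (\<lambda>s. heat_ext 0 (defect e) 0 (t - s) * h s)" if "e \<in> H" "org e \<noteq> v0" for e
        using vertex_kernel[OF that(1), of 0 t] B0_pos[OF L_pos[OF that(1)]] that(2)
        by (simp add: U_def at_v0_def)
      show ?thesis using *[of e] *[of e'] heat_ext_defect_vertex(1)[OF e e'] e star_D[OF e'] False by simp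
    qed
    show "(\<Sum>e'\<in>star e. Uy e' 0 t) = 0" if v: "org e \<noteq> v0" and t: "t \<in> {0<..<T}" for t
    proof -
      have at0: "at_v0 e' = 0" "e' \<in> H" if "e' \<in> star e" for e' using star_D[OF that] v by (auto simp: at_v0_def)
      have "(\<Sum>e'\<in>star e. Uy e' 0 t) = (\<Sum>e'\<in>star e. integral {0..T} (\<lambda>s. heat_ext 1 (defect e') 0 (t - s) * h s))"
      proof (rule sum.cong)
        fix e' assume e': "e' \<in> star e"
        show "Uy e' 0 t = integral {0..T} (\<lambda>s. heat_ext 1 (defect e') 0 (t - s) * h s)"
          using vertex_kernel[OF at0(2)[OF e'], of 1 t] B1_pos[OF L_pos[OF at0(2)[OF e']] t] at0[OF e']
          by (simp add: Uy_def)
      qed simp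
      also have "\<dots> = integral {0..T} (\<lambda>s. \<Sum>e'\<in>star e. heat_ext 1 (defect e') 0 (t - s) * h s)"
      proof (rule integral_sum[symmetric])
        fix e' assume e': "e' \<in> star e"
        show "(\<lambda>s. heat_ext 1 (defect e') 0 (t - s) * h s) integrable_on {0..T}"
          using int_vertex[OF at0(2)[OF e'], of 1 t] at0(1)[OF e'] by simp
      qed simp
      also have "\<dots> = 0"
        using heat_ext_defect_vertex(3)[OF e v] by (simp flip: sum_distrib_right)
      finally show ?thesis .
    qed
  qed
  moreover have "U e y 0 = 0" if "e \<in> H" "y \<in> {0..L e}" for e y
  proof -
    have D0: "duhamel T h (heat_ext 0 r) y 0 = 0" for r y
    proof -
      have "integral {0..T} (\<lambda>s. heat_ext 0 r y (0 - s) * h s) = integral {0..T} (\<lambda>s. 0)"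
        by (rule Henstock_Kurzweil_Integration.integral_cong) (simp add: heat_ext_def)
      then show ?thesis by (simp add: duhamel_def)
    qed
    have "B0 y 0 = 0" if "0 \<le> y" for y
      using B0_0[of 0] B0_pos[of y 0] D0 that T by (cases "y = 0") auto
    then show ?thesis using that D0 by (simp add: U_def W_def)
  qed
  ultimately show thesis using that U_bdry by blast
qed

end

section \<open>One-sided derivatives on a compact interval\<close>

lemma vector_derivative_Icc:
  assumes "(0::real) < l" "y \<in> {0..l}" "(f has_real_derivative D) (at y within {0..l})"
  shows "vector_derivative f (at y within {0..l}) = D"
  using vector_derivative_within_cbox[of 0 l y f D] assms
  by (simp add: has_real_derivative_iff_has_vector_derivative)

lemma iter_deriv_simps: "iter_deriv S 0 f = f"
  "iter_deriv S (Suc k) f t = vector_derivative (iter_deriv S k f) (at t within S)"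
  by (simp_all add: iter_deriv_def)

lemma iter_deriv_1:
  assumes "0 < l" "y \<in> {0..l}" "(f has_real_derivative D) (at y within {0..l})"
  shows "iter_deriv {0..l} 1 f y = D"
  using vector_derivative_Icc[OF assms] by (simp add: iter_deriv_simps)

lemma iter_deriv_1_has_deriv:
  assumes l: "0 < l" and y: "y \<in> {0..l}"
    and f: "\<And>y. y \<in> {0..l} \<Longrightarrow> (f has_real_derivative f1 y) (at y within {0..l})"
    and f1: "(f1 has_real_derivative D) (at y within {0..l})"
  shows "(iter_deriv {0..l} 1 f has_real_derivative D) (at y within {0..l})"
  by (rule has_field_derivative_transform_within[OF f1 zero_less_one y]) (use iter_deriv_1[OF l _ f] in simp)

lemma iter_deriv_2:
  assumes l: "0 < l" and y: "y \<in> {0..l}"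
    and f: "\<And>y. y \<in> {0..l} \<Longrightarrow> (f has_real_derivative f1 y) (at y within {0..l})"
    and f1: "(f1 has_real_derivative D) (at y within {0..l})"
  shows "iter_deriv {0..l} 2 f y = D"
  using vector_derivative_Icc[OF l y iter_deriv_1_has_deriv[OF assms]]
  by (simp add: iter_deriv_simps numeral_2_eq_2)

lemma Ck_on_2_derivs:
  assumes l: "0 < l" and f: "Ck_on 2 {0..l} f" and y: "y \<in> {0..l}"
  shows "(f has_real_derivative iter_deriv {0..l} 1 f y) (at y within {0..l})"
    and "(iter_deriv {0..l} 1 f has_real_derivative iter_deriv {0..l} 2 f y) (at y within {0..l})"
proof -
  have d: "iter_deriv {0..l} k f differentiable (at y within {0..l})" if "k < 2" for k
    using f y that by (simp add: Ck_on_def)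
  have *: "(iter_deriv {0..l} k f has_real_derivative iter_deriv {0..l} (Suc k) f y) (at y within {0..l})" if "k < 2" for k
    using d[OF that] by (simp add: has_real_derivative_iff_has_vector_derivative iter_deriv_simps vector_derivative_works)
  show "(f has_real_derivative iter_deriv {0..l} 1 f y) (at y within {0..l})"
    using *[of 0] by (simp add: iter_deriv_simps(1))
  show "(iter_deriv {0..l} 1 f has_real_derivative iter_deriv {0..l} 2 f y) (at y within {0..l})"
    using *[of 1] by (simp add: numeral_2_eq_2)
qed

lemma Ck_on_2I:
  assumes l: "0 < l"
    and f: "\<And>y. y \<in> {0..l} \<Longrightarrow> (f has_real_derivative f1 y) (at y within {0..l})"
    and f1: "\<And>y. y \<in> {0..l} \<Longrightarrow> (f1 has_real_derivative f2 y) (at y within {0..l})"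
    and f2: "continuous_on {0..l} f2"
  shows "Ck_on 2 {0..l} f"
  unfolding Ck_on_def
proof (intro conjI allI ballI impI)
  have "f2 y = iter_deriv {0..l} 2 f y" if "y \<in> {0..l}" for y using iter_deriv_2[OF l that f f1] that by simp
  then show "continuous_on {0..l} (iter_deriv {0..l} 2 f)" by (rule continuous_on_eq[OF f2])
  fix k :: nat and y assume "k < 2" and y: "y \<in> {0..l}"
  then consider "k = 0" | "k = 1" by linarith
  then show "iter_deriv {0..l} k f differentiable (at y within {0..l})"
  proof cases
    case 1
    then show ?thesis using f[OF y]
      by (auto simp: iter_deriv_simps(1) has_real_derivative_iff_has_vector_derivative intro: differentiableI_vector)
  next
    case 2
    show ?thesis using iter_deriv_1_has_deriv[OF l y f f1[OF y]] unfolding 2 has_real_derivative_iff_has_vector_derivative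
      by (rule differentiableI_vector)
  qed
qed

section \<open>Networks as metric graphs\<close>

text \<open>The half-edge \<open>(j, False)\<close> runs along the parametrization of the edge \<open>j\<close>, and \<open>(j, True)\<close> against it.
The origin of a half-edge is a point of space, so a vertex of the metric graph is a vertex position.\<close>

definition half_edges :: "('i, 'j, 'n::finite) network \<Rightarrow> ('j \<times> bool) set" where
  "half_edges N = edges N \<times> UNIV"

definition he_flip :: "'j \<times> bool \<Rightarrow> 'j \<times> bool" where "he_flip e = (fst e, \<not> snd e)"

definition he_len :: "('i, 'j, 'n::finite) network \<Rightarrow> 'j \<times> bool \<Rightarrow> real" where
  "he_len N e = len N (fst e)"

definition he_coord :: "('i, 'j, 'n::finite) network \<Rightarrow> 'j \<times> bool \<Rightarrow> real \<Rightarrow> real" where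
  "he_coord N e y = (if snd e then len N (fst e) - y else y)"

definition he_point :: "('i, 'j, 'n::finite) network \<Rightarrow> 'j \<times> bool \<Rightarrow> real \<Rightarrow> real ^ 'n" where
  "he_point N e y = param N (fst e) (he_coord N e y)"

definition he_origin :: "('i, 'j, 'n::finite) network \<Rightarrow> 'j \<times> bool \<Rightarrow> real ^ 'n" where
  "he_origin N e = he_point N e 0"

definition he_sign :: "'j \<times> bool \<Rightarrow> real" where "he_sign e = (if snd e then - 1 else 1)"

locale exit_network =
  fixes N :: "('i, 'j, 'n::finite) network" and i0 :: 'i
  assumes net: "is_network N" and exit: "boundary_idx N = {i0}"
begin

lemma edge_facts:
  assumes "j \<in> edges N"
  shows "0 < len N j" "continuous_on {0..len N j} (param N j)" "inj_on (param N j) {0..len N j}"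
    "arc_of N j \<inter> vertex_points N = {param N j 0, param N j (len N j)}"
proof -
  show "0 < len N j" "inj_on (param N j) {0..len N j}"
    "arc_of N j \<inter> vertex_points N = {param N j 0, param N j (len N j)}"
    using net assms by (auto simp: is_network_def)
  have "smooth_on {0..len N j} (param N j)" using net assms by (auto simp: is_network_def)
  then have "Ck_on 0 {0..len N j} (param N j)" by (simp add: smooth_on_def)
  then show "continuous_on {0..len N j} (param N j)" by (simp add: Ck_on_def iter_deriv_def)
qed

sublocale G: metric_graph "half_edges N" he_flip "he_len N" "he_origin N" "vpos N i0"
proof
  show "finite (half_edges N)" using net by (simp add: half_edges_def is_network_def)
qed (auto simp: half_edges_def he_flip_def he_len_def edge_facts(1))

lemma he_coord_range: "e \<in> half_edges N \<Longrightarrow> y \<in> {0..he_len N e} \<Longrightarrow> he_coord N e y \<in> {0..len N (fst e)}"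
  by (auto simp: he_coord_def he_len_def)

lemma he_point_flip: "he_point N (he_flip e) y = he_point N e (he_len N e - y)"
  by (simp add: he_point_def he_flip_def he_coord_def he_len_def)

lemma arc_in_carrier: "j \<in> edges N \<Longrightarrow> y \<in> {0..len N j} \<Longrightarrow> param N j y \<in> carrier_set N"
  unfolding carrier_set_def arc_of_def by blast

lemma he_point_in_carrier: "e \<in> half_edges N \<Longrightarrow> y \<in> {0..he_len N e} \<Longrightarrow> he_point N e y \<in> carrier_set N"
  unfolding he_point_def using he_coord_range by (intro arc_in_carrier) (auto simp: half_edges_def)

lemma exit_half_edge: obtains e where "e \<in> half_edges N" "he_origin N e = vpos N i0"
proof -
  have "card (Inc N i0) = 1" and i0: "i0 \<in> vertices N" using exit by (auto simp: boundary_idx_def)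
  then obtain j where "j \<in> Inc N i0" by (metis card.empty ex_in_conv zero_neq_one)
  then have j: "j \<in> edges N" "vpos N i0 \<in> arc_of N j" by (auto simp: Inc_def)
  then have "vpos N i0 \<in> {param N j 0, param N j (len N j)}"
    using edge_facts(4)[OF j(1)] i0 by (auto simp: vertex_points_def)
  then have "he_origin N (j, False) = vpos N i0 \<or> he_origin N (j, True) = vpos N i0"
    by (auto simp: he_origin_def he_point_def he_coord_def)
  then show thesis using that j(1) by (auto simp: half_edges_def)
qed

lemma closed_arc: "j \<in> edges N \<Longrightarrow> closed (arc_of N j)"
  unfolding arc_of_def by (intro compact_imp_closed compact_continuous_image edge_facts(2)) auto

text \<open>An isolated vertex would be a closed and open part of the network. Connectedness excludes it, and without
this a solution would not be determined at such a vertex.\<close>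

lemma carrier_eq_arcs: "carrier_set N = (\<Union>j\<in>edges N. arc_of N j)"
proof -
  let ?A = "\<Union>j\<in>edges N. arc_of N j" and ?B = "vertex_points N - (\<Union>j\<in>edges N. arc_of N j)"
  have fin: "finite (edges N)" "finite (vertices N)" and conn: "connected (carrier_set N)"
    using net by (auto simp: is_network_def)
  have "closed ?A" by (intro closed_UN fin ballI closed_arc)
  moreover have "closed ?B" by (rule finite_imp_closed) (use fin in \<open>simp add: vertex_points_def\<close>)
  moreover have "carrier_set N \<subseteq> ?A \<union> ?B" "?A \<inter> ?B \<inter> carrier_set N = {}" by (auto simp: carrier_set_def)
  ultimately have "?A \<inter> carrier_set N = {} \<or> ?B \<inter> carrier_set N = {}"
    by (intro connected_closedD[OF conn]) assumption+
  moreover have "?A \<inter> carrier_set N \<noteq> {}"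
  proof -
    obtain e where "e \<in> half_edges N" by (rule exit_half_edge)
    then have "fst e \<in> edges N" by (auto simp: half_edges_def)
    then show ?thesis using edge_facts(1)[of "fst e"] by (force simp: carrier_set_def arc_of_def)
  qed
  ultimately show ?thesis by (auto simp: carrier_set_def)
qed

lemma carrier_cases:
  assumes "x \<in> carrier_set N"
  obtains j y where "j \<in> edges N" "y \<in> {0..len N j}" "x = param N j y"
  using assms unfolding carrier_eq_arcs arc_of_def by auto

lemma carrier_half_edge_cases:
  assumes "x \<in> carrier_set N"
  obtains e y where "e \<in> half_edges N" "y \<in> {0..he_len N e}" "x = he_point N e y"
proof -
  obtain j y where "j \<in> edges N" "y \<in> {0..len N j}" "x = param N j y" using assms by (rule carrier_cases)
  then show thesis using that[of "(j, False)" y] by (simp add: half_edges_def he_len_def he_point_def he_coord_def)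
qed

lemma coord_param [simp]: "j \<in> edges N \<Longrightarrow> y \<in> {0..len N j} \<Longrightarrow> coord N j (param N j y) = y"
  unfolding coord_def by (rule the_inv_into_f_f[OF edge_facts(3)])

lemma continuous_on_coord: "j \<in> edges N \<Longrightarrow> continuous_on (arc_of N j) (coord N j)"
  unfolding arc_of_def by (rule continuous_on_inv[OF edge_facts(2)]) auto

lemma origin_vertex:
  assumes "e \<in> half_edges N" obtains i where "i \<in> vertices N" "vpos N i = he_origin N e"
proof -
  have "he_origin N e \<in> vertex_points N"
    using edge_facts(4)[of "fst e"] assms by (auto simp: half_edges_def he_origin_def he_point_def he_coord_def)
  then show thesis using that by (auto simp: vertex_points_def)
qed

lemma vertex_on_arc:
  assumes j: "j \<in> edges N" and y: "y \<in> {0..len N j}" and "param N j y \<in> vertex_points N"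
  shows "y = 0 \<or> y = len N j"
proof -
  have "param N j y \<in> arc_of N j" using y by (simp add: arc_of_def)
  then have "param N j y \<in> {param N j 0, param N j (len N j)}"
    using edge_facts(4)[OF j] assms(3) by blast
  then show ?thesis
    using inj_onD[OF edge_facts(3)[OF j], of y 0] inj_onD[OF edge_facts(3)[OF j], of y "len N j"] y edge_facts(1)[OF j]
    by auto
qed

text \<open>The parametrization of an edge is injective, so an edge meets a vertex with exactly one of its two
half-edges, and the incidence coefficient records which one.\<close>

lemma star_inc:
  assumes i: "i \<in> vertices N" and v: "he_origin N e = vpos N i"
  shows "fst ` G.star e = Inc N i" and "inj_on fst (G.star e)"
    and "\<And>e'. e' \<in> G.star e \<Longrightarrow> incidence N i (fst e') = he_sign e'"
    and "\<And>e'. e' \<in> G.star e \<Longrightarrow> coord N (fst e') (vpos N i) = he_coord N e' 0"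
proof -
  have star: "e' \<in> G.star e \<longleftrightarrow> fst e' \<in> edges N \<and> he_origin N e' = vpos N i" for e'
    using v unfolding G.star_def by (cases e') (simp add: half_edges_def)
  have ends: "param N j 0 \<noteq> param N j (len N j)" if "j \<in> edges N" for j
    using inj_onD[OF edge_facts(3)[OF that], of 0 "len N j"] edge_facts(1)[OF that] by auto
  have or: "he_origin N (j, b) = param N j (if b then len N j else 0)" for j b
    by (simp add: he_origin_def he_point_def he_coord_def)
  have in_arc: "param N j 0 \<in> arc_of N j" "param N j (len N j) \<in> arc_of N j" if "j \<in> edges N" for j
    using edge_facts(1)[OF that] by (auto simp: arc_of_def)
  show "fst ` G.star e = Inc N i"
  proof safe
    fix j b assume "(j, b) \<in> G.star e"
    then have "j \<in> edges N" "param N j (if b then len N j else 0) = vpos N i" using or star by auto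
    then show "fst (j, b) \<in> Inc N i" using in_arc[of j] by (auto simp: Inc_def split: if_splits)
  next
    fix j assume "j \<in> Inc N i"
    then have j: "j \<in> edges N" "vpos N i \<in> arc_of N j" by (auto simp: Inc_def)
    then have "vpos N i = param N j 0 \<or> vpos N i = param N j (len N j)"
      using edge_facts(4)[OF j(1)] i by (auto simp: vertex_points_def)
    then have "(j, False) \<in> G.star e \<or> (j, True) \<in> G.star e" using star or j(1) by auto
    then show "j \<in> fst ` G.star e" by force
  qed
  show "inj_on fst (G.star e)"
  proof (rule inj_onI)
    fix a b assume a: "a \<in> G.star e" and b: "b \<in> G.star e" and "fst a = fst b"
    moreover have "he_origin N a = he_origin N b" "fst a \<in> edges N" using a b star by auto
    ultimately show "a = b" using ends[of "fst a"] or
      by (cases a; cases b) (auto split: if_splits)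
  qed
  fix e' assume e': "e' \<in> G.star e"
  then have j: "fst e' \<in> edges N" and o: "param N (fst e') (if snd e' then len N (fst e') else 0) = vpos N i"
    using star or[of "fst e'" "snd e'"] by auto
  show "incidence N i (fst e') = he_sign e'"
    using o in_arc[OF j] ends[OF j] by (auto simp: incidence_def he_sign_def split: if_splits)
  have "he_coord N e' 0 \<in> {0..len N (fst e')}" using edge_facts(1)[OF j] by (simp add: he_coord_def)
  moreover have "vpos N i = param N (fst e') (he_coord N e' 0)" using o by (auto simp: he_coord_def split: if_splits)
  ultimately show "coord N (fst e') (vpos N i) = he_coord N e' 0" using j by simp
qed

lemma transition_origin:
  assumes e: "e \<in> half_edges N" and "he_origin N e \<noteq> vpos N i0"
  obtains i where "i \<in> transition_idx N" "i \<in> vertices N" "he_origin N e = vpos N i"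
  using origin_vertex[OF e] assms exit by (auto simp: transition_idx_def) (metis)

lemma transition_cases:
  assumes i: "i \<in> transition_idx N"
  obtains "Inc N i = {}" | e where "e \<in> half_edges N" "he_origin N e = vpos N i" "he_origin N e \<noteq> vpos N i0" "i \<in> vertices N"
proof (cases "Inc N i = {}")
  case False
  have iv: "i \<in> vertices N" "i \<noteq> i0" using i exit by (auto simp: transition_idx_def)
  have "i0 \<in> vertices N" using exit by (auto simp: boundary_idx_def)
  then have ne: "vpos N i \<noteq> vpos N i0" using net iv by (auto simp: is_network_def dest: inj_onD)
  obtain j where j: "j \<in> edges N" "vpos N i \<in> arc_of N j" using False by (auto simp: Inc_def)
  then have "vpos N i = param N j 0 \<or> vpos N i = param N j (len N j)"
    using edge_facts(4)[OF j(1)] iv by (auto simp: vertex_points_def)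
  then have "he_origin N (j, False) = vpos N i \<or> he_origin N (j, True) = vpos N i"
    by (auto simp: he_origin_def he_point_def he_coord_def)
  then show thesis using that(2) ne iv j(1) by (auto simp: half_edges_def)
qed (rule that)

text \<open>Heat solutions as functions of points. The derivatives are functions of the edge and the edge
coordinate, since at a vertex they depend on the edge.\<close>

definition network_heat ::
    "real \<Rightarrow> (real ^ 'n \<Rightarrow> real \<Rightarrow> real) \<Rightarrow> ('j \<Rightarrow> real \<Rightarrow> real \<Rightarrow> real) \<Rightarrow> ('j \<Rightarrow> real \<Rightarrow> real \<Rightarrow> real) \<Rightarrow> bool" where
  "network_heat T v v1 v2 \<longleftrightarrow>
     continuous_on (carrier_set N \<times> {0..T}) (\<lambda>(x, t). v x t) \<and>
     (\<forall>j\<in>edges N. continuous_on ({0..len N j} \<times> {0<..<T}) (\<lambda>(y, t). v1 j y t)) \<and>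
     (\<forall>j\<in>edges N. continuous_on ({0..len N j} \<times> {0<..<T}) (\<lambda>(y, t). v2 j y t)) \<and>
     (\<forall>j\<in>edges N. \<forall>y\<in>{0..len N j}. \<forall>t\<in>{0<..<T}.
        ((\<lambda>y. v (param N j y) t) has_real_derivative v1 j y t) (at y within {0..len N j}) \<and>
        ((\<lambda>y. v1 j y t) has_real_derivative v2 j y t) (at y within {0..len N j}) \<and>
        ((\<lambda>t. v (param N j y) t) has_real_derivative v2 j y t) (at t)) \<and>
     (\<forall>i\<in>transition_idx N. \<forall>t\<in>{0<..<T}.
        (\<Sum>j\<in>Inc N i. incidence N i j * v1 j (coord N j (vpos N i)) t) = 0)"

lemma reverse_deriv:
  assumes "(f has_real_derivative D) (at (he_coord N e y) within {0..he_len N e})"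
  shows "((\<lambda>y. f (he_coord N e y)) has_real_derivative he_sign e * D) (at y within {0..he_len N e})"
proof -
  have "he_coord N e ` {0..he_len N e} = {0..he_len N e}"
  proof (cases "snd e")
    case True
    have "(\<lambda>y. len N (fst e) - y) ` {0..len N (fst e)} = {0..len N (fst e)}" by simp
    then show ?thesis using True by (simp add: he_coord_def he_len_def image_def)
  qed (simp add: he_coord_def)
  then have "(f has_real_derivative D) (at (he_coord N e y) within he_coord N e ` {0..he_len N e})"
    using assms by simp
  moreover have "(he_coord N e has_real_derivative he_sign e) (at y within {0..he_len N e})"
    by (cases "snd e") (auto simp: he_coord_def[abs_def] he_sign_def intro!: derivative_eq_intros)
  ultimately have "(f \<circ> he_coord N e has_real_derivative D * he_sign e) (at y within {0..he_len N e})"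
    by (rule DERIV_image_chain)
  then show ?thesis by (simp add: o_def mult.commute)
qed

lemma continuous_on_he_coord: "continuous_on S (he_coord N e)"
  unfolding he_coord_def by (cases "snd e") (auto intro!: continuous_intros)

lemma continuous_on_he_point: "e \<in> half_edges N \<Longrightarrow> continuous_on {0..he_len N e} (he_point N e)"
  unfolding he_point_def
  by (rule continuous_on_compose2[OF edge_facts(2) continuous_on_he_coord])
     (use he_coord_range in \<open>auto simp: half_edges_def\<close>)

lemma network_heat_imp_heat_solution:
  assumes v: "network_heat T v v1 v2"
  shows "G.heat_solution T (\<lambda>e y. v (he_point N e y)) (\<lambda>e y t. he_sign e * v1 (fst e) (he_coord N e y) t)
    (\<lambda>e y. v2 (fst e) (he_coord N e y))"
  unfolding G.heat_solution_def
proof (intro conjI ballI impI)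
  fix e assume e: "e \<in> half_edges N"
  then have j: "fst e \<in> edges N" by (auto simp: half_edges_def)
  have v0: "continuous_on (carrier_set N \<times> {0..T}) (\<lambda>(x, t). v x t)"
    and v1: "continuous_on ({0..len N (fst e)} \<times> {0<..<T}) (\<lambda>(y, t). v1 (fst e) y t)"
    and v2: "continuous_on ({0..len N (fst e)} \<times> {0<..<T}) (\<lambda>(y, t). v2 (fst e) y t)"
    using v j by (auto simp: network_heat_def)
  have cc: "continuous_on ({0..he_len N e} \<times> S) (\<lambda>p. he_coord N e (fst p))" for S :: "real set"
    by (rule continuous_on_compose2[OF continuous_on_he_coord[of UNIV] continuous_on_fst]) (auto intro: continuous_intros)
  show "continuous_on ({0..he_len N e} \<times> {0..T}) (\<lambda>(y, t). v (he_point N e y) t)"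
    unfolding case_prod_beta
    by (intro continuous_on_compose2[OF v0, of _ "\<lambda>p. (he_point N e (fst p), snd p)", simplified]
        continuous_on_Pair continuous_on_compose2[OF continuous_on_he_point[OF e]] continuous_on_fst continuous_on_snd continuous_on_id)
       (use he_point_in_carrier[OF e] in auto)
  show "continuous_on ({0..he_len N e} \<times> {0<..<T}) (\<lambda>(y, t). he_sign e * v1 (fst e) (he_coord N e y) t)"
    unfolding case_prod_beta
    by (intro continuous_on_mult continuous_on_const continuous_on_kernel_compose[OF v1] cc continuous_on_snd continuous_on_id)
       (use he_coord_range[OF e] in auto)
  show "continuous_on ({0..he_len N e} \<times> {0<..<T}) (\<lambda>(y, t). v2 (fst e) (he_coord N e y) t)"
    unfolding case_prod_beta
    by (intro continuous_on_kernel_compose[OF v2] cc continuous_on_snd continuous_on_id)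
       (use he_coord_range[OF e] in auto)
  {
    fix y t assume y: "y \<in> {0..he_len N e}" and t: "t \<in> {0<..<T}"
    have D: "((\<lambda>y. v (param N (fst e) y) t) has_real_derivative v1 (fst e) (he_coord N e y) t) (at (he_coord N e y) within {0..he_len N e})"
      "((\<lambda>y. v1 (fst e) y t) has_real_derivative v2 (fst e) (he_coord N e y) t) (at (he_coord N e y) within {0..he_len N e})"
      "((\<lambda>t. v (param N (fst e) (he_coord N e y)) t) has_real_derivative v2 (fst e) (he_coord N e y) t) (at t)"
      using v j he_coord_range[OF e y] t unfolding network_heat_def he_len_def by blast+
    show "((\<lambda>y. v (he_point N e y) t) has_real_derivative he_sign e * v1 (fst e) (he_coord N e y) t) (at y within {0..he_len N e})"
      unfolding he_point_def by (rule reverse_deriv[OF D(1)])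
    have "((\<lambda>y. he_sign e * v1 (fst e) (he_coord N e y) t) has_real_derivative he_sign e * (he_sign e * v2 (fst e) (he_coord N e y) t)) (at y within {0..he_len N e})"
      by (intro DERIV_cmult reverse_deriv[OF D(2)])
    then show "((\<lambda>y. he_sign e * v1 (fst e) (he_coord N e y) t) has_real_derivative v2 (fst e) (he_coord N e y) t) (at y within {0..he_len N e})"
      by (simp add: he_sign_def split: if_splits)
    show "((\<lambda>t. v (he_point N e y) t) has_real_derivative v2 (fst e) (he_coord N e y) t) (at t)"
      unfolding he_point_def by (rule D(3))
  }
  show "v (he_point N (he_flip e) y) t = v (he_point N e (he_len N e - y)) t" for y t by (simp add: he_point_flip)
  show "v (he_point N e' 0) t = v (he_point N e 0) t" if "e' \<in> G.star e" for e' t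
    using G.star_D(2)[OF that] by (simp add: he_origin_def)
  show "(\<Sum>e'\<in>G.star e. he_sign e' * v1 (fst e') (he_coord N e' 0) t) = 0"
    if ne: "he_origin N e \<noteq> vpos N i0" and t: "t \<in> {0<..<T}" for t
  proof -
    obtain i where i: "i \<in> transition_idx N" "i \<in> vertices N" "he_origin N e = vpos N i"
      using transition_origin[OF e ne] .
    note S = star_inc[OF i(2,3)]
    have "0 = (\<Sum>j\<in>fst ` G.star e. incidence N i j * v1 j (coord N j (vpos N i)) t)"
      using v i(1) t unfolding S(1) network_heat_def by simp
    also have "\<dots> = (\<Sum>e'\<in>G.star e. he_sign e' * v1 (fst e') (he_coord N e' 0) t)"
      by (subst sum.reindex[OF S(2)]) (simp add: S(3,4))
    finally show ?thesis by simp
  qed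
qed

text \<open>A family on half-edges that respects \<open>flip\<close> and agrees on stars descends to the points of the network:
two different edges meet only in vertices, and those are end points of both.\<close>

lemma he_point_eq:
  assumes e: "e \<in> half_edges N" and y: "y \<in> {0..he_len N e}" and e': "e' \<in> half_edges N" and y': "y' \<in> {0..he_len N e'}"
    and eq: "he_point N e y = he_point N e' y'"
    and U: "\<And>e y. e \<in> half_edges N \<Longrightarrow> y \<in> {0..he_len N e} \<Longrightarrow> U (he_flip e) y = U e (he_len N e - y)"
    and star: "\<And>e e'. e \<in> half_edges N \<Longrightarrow> e' \<in> G.star e \<Longrightarrow> U e' 0 = U e 0"
  shows "U e y = U e' y'"
proof -
  have norm: "U e y = U (fst e, False) (he_coord N e y)" if "e \<in> half_edges N" "y \<in> {0..he_len N e}" for e y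
    using U[of "(fst e, False)" y] that
    by (cases e; cases "snd e") (auto simp: he_coord_def he_flip_def he_len_def half_edges_def)
  show ?thesis
  proof (cases "fst e = fst e'")
    case True
    have "he_coord N e y = he_coord N e' y'"
      using inj_onD[OF edge_facts(3) eq[unfolded he_point_def True]] he_coord_range[OF e y] he_coord_range[OF e' y'] e' True
      by (auto simp: half_edges_def)
    then show ?thesis using norm[OF e y] norm[OF e' y'] True by simp
  next
    case False
    have j: "fst e \<in> edges N" "fst e' \<in> edges N" using e e' by (auto simp: half_edges_def)
    have "he_point N e y \<in> arc_of N (fst e)" unfolding he_point_def arc_of_def
      by (rule imageI) (rule he_coord_range[OF e y])
    moreover have "he_point N e' y' \<in> arc_of N (fst e')" unfolding he_point_def arc_of_def
      by (rule imageI) (rule he_coord_range[OF e' y'])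
    ultimately have "he_point N e y \<in> arc_of N (fst e) \<inter> arc_of N (fst e')" using eq by simp
    then have vp: "he_point N e y \<in> vertex_points N" using net False j unfolding is_network_def by blast
    have ends: "\<exists>a\<in>half_edges N. he_origin N a = he_point N e y \<and> U e y = U a 0"
      if e: "e \<in> half_edges N" and y: "y \<in> {0..he_len N e}" and vp: "he_point N e y \<in> vertex_points N" for e y
    proof -
      have je: "fst e \<in> edges N" using e by (auto simp: half_edges_def)
      have "he_coord N e y = 0 \<or> he_coord N e y = len N (fst e)"
        using vertex_on_arc[OF je he_coord_range[OF e y]] vp by (simp add: he_point_def)
      then consider "y = 0" | "y = he_len N e" by (auto simp: he_coord_def he_len_def split: if_splits)
      then show ?thesis
      proof cases
        case 1
        then show ?thesis using e by (auto simp: he_origin_def)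
      next
        case 2
        have "U e y = U (he_flip e) 0" using U[OF e, of 0] 2 G.L_pos[OF e] by simp
        moreover have "he_origin N (he_flip e) = he_point N e y" using 2 by (simp add: he_origin_def he_point_flip)
        ultimately show ?thesis using e G.flip_in by blast
      qed
    qed
    obtain a where a: "a \<in> half_edges N" "he_origin N a = he_point N e y" "U e y = U a 0"
      using ends[OF e y vp] by blast
    obtain b where b: "b \<in> half_edges N" "he_origin N b = he_point N e' y'" "U e' y' = U b 0"
      using ends[OF e' y'] vp eq by auto
    have "b \<in> G.star a" using a b eq by (simp add: G.star_def)
    then show ?thesis using star[OF a(1)] a(3) b(3) by simp
  qed
qed

text \<open>A representation of each point by a half-edge and a coordinate is chosen; \<open>he_point_eq\<close> makes the
choice irrelevant. Continuity is checked on the finitely many closed arcs.\<close>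

lemma heat_solution_imp_network_heat:
  assumes U: "G.heat_solution T U Uy Uyy"
  obtains v v1 v2 where "network_heat T v v1 v2"
    "\<And>e y t. e \<in> half_edges N \<Longrightarrow> y \<in> {0..he_len N e} \<Longrightarrow> t \<in> {0..T} \<Longrightarrow> v (he_point N e y) t = U e y t"
proof -
  define sel where "sel = (\<lambda>x. SOME p. fst p \<in> half_edges N \<and> snd p \<in> {0..he_len N (fst p)} \<and> x = he_point N (fst p) (snd p))"
  define v where "v = (\<lambda>x t. U (fst (sel x)) (snd (sel x)) t)"
  have sel: "fst (sel x) \<in> half_edges N" "snd (sel x) \<in> {0..he_len N (fst (sel x))}" "he_point N (fst (sel x)) (snd (sel x)) = x"
    if x: "x \<in> carrier_set N" for x
  proof -
    obtain e y where "e \<in> half_edges N" "y \<in> {0..he_len N e}" "x = he_point N e y"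
      by (rule carrier_half_edge_cases[OF x])
    then have "\<exists>p. fst p \<in> half_edges N \<and> snd p \<in> {0..he_len N (fst p)} \<and> x = he_point N (fst p) (snd p)"
      by (intro exI[of _ "(e, y)"]) simp
    then have "fst (sel x) \<in> half_edges N \<and> snd (sel x) \<in> {0..he_len N (fst (sel x))} \<and> x = he_point N (fst (sel x)) (snd (sel x))"
      unfolding sel_def by (rule someI_ex)
    then show "fst (sel x) \<in> half_edges N" "snd (sel x) \<in> {0..he_len N (fst (sel x))}"
      "he_point N (fst (sel x)) (snd (sel x)) = x" by auto
  qed
  have val: "v (he_point N e y) t = U e y t" if "e \<in> half_edges N" "y \<in> {0..he_len N e}" "t \<in> {0..T}" for e y t
    unfolding v_def
    by (rule he_point_eq[of _ _ _ _ "\<lambda>e y. U e y t"])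
       (use sel[OF he_point_in_carrier[OF that(1,2)]] that G.heat_solution_D(7,8)[OF U] in auto)
  have valp: "v (param N j y) t = U (j, False) y t" if "j \<in> edges N" "y \<in> {0..len N j}" "t \<in> {0..T}" for j y t
    using val[of "(j, False)" y t] that by (simp add: half_edges_def he_len_def he_point_def he_coord_def)
  have hj: "(j, False) \<in> half_edges N" "he_len N (j, False) = len N j" if "j \<in> edges N" for j
    using that by (auto simp: half_edges_def he_len_def)
  have cont: "continuous_on (carrier_set N \<times> {0..T}) (\<lambda>(x, t). v x t)"
  proof -
    have fin: "finite (edges N)" using net by (simp add: is_network_def)
    have "continuous_on (\<Union>j\<in>edges N. arc_of N j \<times> {0..T}) (\<lambda>(x, t). v x t)"
    proof (rule continuous_on_closed_Union[OF fin])
      fix j assume j: "j \<in> edges N"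
      show "closed (arc_of N j \<times> {0..T})" by (intro closed_Times closed_arc[OF j] closed_atLeastAtMost)
      have "continuous_on (arc_of N j \<times> {0..T}) (\<lambda>p. U (j, False) (coord N j (fst p)) (snd p))"
        by (intro continuous_on_kernel_compose[OF G.heat_solution_D(1)[OF U hj(1)[OF j]]]
            continuous_on_compose2[OF continuous_on_coord[OF j]] continuous_on_fst continuous_on_snd continuous_on_id)
           (use j hj in \<open>auto simp: arc_of_def\<close>)
      then show "continuous_on (arc_of N j \<times> {0..T}) (\<lambda>(x, t). v x t)"
        by (rule continuous_on_eq) (use j valp in \<open>auto simp: arc_of_def\<close>)
    qed
    moreover have "(\<Union>j\<in>edges N. arc_of N j \<times> {0..T}) = carrier_set N \<times> {0..T}" by (auto simp: carrier_eq_arcs)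
    ultimately show ?thesis by simp
  qed
  define v1 where "v1 = (\<lambda>j. Uy (j, False))"
  define v2 where "v2 = (\<lambda>j. Uyy (j, False))"
  have Uy_sign: "Uy e 0 t = he_sign e * v1 (fst e) (he_coord N e 0) t" if e: "e \<in> half_edges N" and t: "t \<in> {0<..<T}" for e t
  proof (cases "snd e")
    case False
    then have "(fst e, False) = e" by (cases e) simp
    then show ?thesis using False by (simp add: v1_def he_sign_def he_coord_def)
  next
    case True
    define a where "a = (fst e, False)"
    have a: "a \<in> half_edges N" "e = he_flip a" "he_len N a = he_len N e"
      using e True by (cases e; simp add: a_def half_edges_def he_flip_def he_len_def)+
    have l: "0 < he_len N e" by (rule G.L_pos[OF e])
    have "((\<lambda>y. U a y t) has_real_derivative Uy a (he_coord N e 0) t) (at (he_coord N e 0) within {0..he_len N e})"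
      using G.heat_solution_D(4)[OF U a(1) _ t, of "he_coord N e 0"] l a(3) True by (simp add: he_coord_def he_len_def)
    then have "((\<lambda>y. U a (he_coord N e y) t) has_real_derivative he_sign e * Uy a (he_coord N e 0) t) (at 0 within {0..he_len N e})"
      by (rule reverse_deriv)
    moreover have "U e y t = U a (he_coord N e y) t" if "y \<in> {0..he_len N e}" for y
      using G.heat_solution_D(7)[OF U a(1), of y t] that t a True by (simp add: he_coord_def he_len_def)
    ultimately have "((\<lambda>y. U e y t) has_real_derivative he_sign e * Uy a (he_coord N e 0) t) (at 0 within {0..he_len N e})"
      using l by (subst has_field_derivative_cong_eventually[where g = "\<lambda>y. U a (he_coord N e y) t"]) (auto simp: eventually_at_filter)
    moreover have "((\<lambda>y. U e y t) has_real_derivative Uy e 0 t) (at 0 within {0..he_len N e})"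
      using G.heat_solution_D(4)[OF U e _ t, of 0] l by simp
    ultimately have "he_sign e * Uy a (he_coord N e 0) t = Uy e 0 t"
      by (rule has_field_derivative_unique) (use l in \<open>simp add: trivial_limit_within islimpt_Icc\<close>)
    then show ?thesis by (simp add: v1_def a_def)
  qed
  have "network_heat T v v1 v2"
    unfolding network_heat_def
  proof (intro conjI ballI cont)
    fix j assume j: "j \<in> edges N"
    note D = G.heat_solution_D[OF U hj(1)[OF j], unfolded hj(2)[OF j]]
    show "continuous_on ({0..len N j} \<times> {0<..<T}) (\<lambda>(y, t). v1 j y t)"
      "continuous_on ({0..len N j} \<times> {0<..<T}) (\<lambda>(y, t). v2 j y t)"
      using D(2,3) by (simp_all add: v1_def v2_def)
    fix y t assume y: "y \<in> {0..len N j}" and t: "t \<in> {0<..<T}"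
    show "((\<lambda>y. v (param N j y) t) has_real_derivative v1 j y t) (at y within {0..len N j})"
      unfolding v1_def
      by (rule has_field_derivative_transform_within[OF D(4)[OF y t] zero_less_one y]) (use valp j t in auto)
    show "((\<lambda>y. v1 j y t) has_real_derivative v2 j y t) (at y within {0..len N j})"
      unfolding v1_def v2_def by (rule D(5)[OF y t])
    show "((\<lambda>t. v (param N j y) t) has_real_derivative v2 j y t) (at t)"
      unfolding v2_def
      by (rule has_field_derivative_transform_within_open[OF D(6)[OF y t], of "{0<..<T}"]) (use valp j t y in auto)
  next
    fix i t assume i: "i \<in> transition_idx N" and t: "t \<in> {0<..<T}"
    from i show "(\<Sum>j\<in>Inc N i. incidence N i j * v1 j (coord N j (vpos N i)) t) = 0"
    proof (cases rule: transition_cases)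
      case (2 e)
      note S = star_inc[OF 2(4,2)]
      have "(\<Sum>j\<in>fst ` G.star e. incidence N i j * v1 j (coord N j (vpos N i)) t) = (\<Sum>e'\<in>G.star e. Uy e' 0 t)"
        by (subst sum.reindex[OF S(2)]) (use S(3,4) Uy_sign[OF G.star_D(1) t] in simp)
      then show ?thesis using G.heat_solution_D(9)[OF U 2(1,3) t] S(1) by simp
    qed simp
  qed
  then show thesis using val by (rule that)
qed

lemma network_heat_unique:
  assumes T: "0 < T" and v: "network_heat T v v1 v2" and w: "network_heat T w w1 w2"
    and init: "\<And>x. x \<in> carrier_set N \<Longrightarrow> v x 0 = w x 0"
    and bdry: "\<And>t. t \<in> {0..T} \<Longrightarrow> v (vpos N i0) t = w (vpos N i0) t"
    and x: "x \<in> carrier_set N" and t: "t \<in> {0..T}"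
  shows "v x t = w x t"
proof -
  obtain e y where e: "e \<in> half_edges N" "y \<in> {0..he_len N e}" "x = he_point N e y"
    by (rule carrier_half_edge_cases[OF x])
  show ?thesis unfolding e(3)
    by (rule G.heat_solution_unique[OF T network_heat_imp_heat_solution[OF v] network_heat_imp_heat_solution[OF w]
        _ _ e(1,2) t]) (use init bdry he_point_in_carrier in \<open>auto simp: he_origin_def\<close>)
qed

lemma network_heat_exists_initial:
  assumes T: "0 < T" and f: "continuous_on (carrier_set N) f" and f0: "f (vpos N i0) = 0"
  obtains v v1 v2 where "network_heat T v v1 v2" "\<And>x. x \<in> carrier_set N \<Longrightarrow> v x 0 = f x"
    "\<And>t. t \<in> {0..T} \<Longrightarrow> v (vpos N i0) t = 0"
proof -
  define F where "F = (\<lambda>e y. f (he_point N e y))"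
  have comp: "G.vertex_compatible F"
    unfolding G.vertex_compatible_def F_def
    using f0 G.star_D(2) by (auto simp: he_point_flip he_origin_def)
  have cont: "continuous_on {0..he_len N e} (F e)" if "e \<in> half_edges N" for e
    unfolding F_def
    by (rule continuous_on_compose2[OF f continuous_on_he_point[OF that]]) (use he_point_in_carrier[OF that] in auto)
  obtain U Uy Uyy where U: "G.heat_solution T U Uy Uyy"
    "\<And>e y. e \<in> half_edges N \<Longrightarrow> y \<in> {0..he_len N e} \<Longrightarrow> U e y 0 = F e y"
    "\<And>e t. e \<in> half_edges N \<Longrightarrow> he_origin N e = vpos N i0 \<Longrightarrow> 0 \<le> t \<Longrightarrow> U e 0 t = 0"
    using G.homogeneous_heat_solution_exists[OF comp cont, of T] by blast
  obtain v v1 v2 where v: "network_heat T v v1 v2"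
    "\<And>e y t. e \<in> half_edges N \<Longrightarrow> y \<in> {0..he_len N e} \<Longrightarrow> t \<in> {0..T} \<Longrightarrow> v (he_point N e y) t = U e y t"
    using heat_solution_imp_network_heat[OF U(1)] by blast
  show thesis
  proof (rule that[OF v(1)])
    fix x assume x: "x \<in> carrier_set N"
    obtain e y where e: "e \<in> half_edges N" "y \<in> {0..he_len N e}" "x = he_point N e y"
      by (rule carrier_half_edge_cases[OF x])
    show "v x 0 = f x" using v(2)[OF e(1,2), of 0] U(2)[OF e(1,2)] T by (simp add: e(3) F_def)
  next
    fix t assume t: "t \<in> {0..T}"
    obtain e where e: "e \<in> half_edges N" "he_origin N e = vpos N i0" by (rule exit_half_edge)
    show "v (vpos N i0) t = 0"
      using v(2)[OF e(1) _ t, of 0] U(3)[OF e, of t] t G.L_pos[OF e(1)] by (simp add: he_origin_def e(2)[symmetric])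
  qed
qed

text \<open>The solution with zero initial value, shifted by the constant \<open>\<gamma> 0\<close>. The lower bound is the minimum principle.\<close>

lemma network_heat_exists_boundary:
  assumes T: "0 < T" and h: "continuous_on {0..T} h"
    and \<gamma>: "\<And>t. t \<in> {0..T} \<Longrightarrow> (\<gamma> has_real_derivative h t) (at t within {0..T})"
    and lower: "\<And>t. t \<in> {0..T} \<Longrightarrow> \<kappa> \<le> \<gamma> t"
  obtains v v1 v2 where "network_heat T v v1 v2" "\<And>x. x \<in> carrier_set N \<Longrightarrow> v x 0 = \<gamma> 0"
    "\<And>t. t \<in> {0..T} \<Longrightarrow> v (vpos N i0) t = \<gamma> t"
    "\<And>x t. x \<in> carrier_set N \<Longrightarrow> t \<in> {0..T} \<Longrightarrow> \<kappa> \<le> v x t"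
proof -
  obtain W Wy Wyy where W: "G.heat_solution T W Wy Wyy"
    "\<And>e y. e \<in> half_edges N \<Longrightarrow> y \<in> {0..he_len N e} \<Longrightarrow> W e y 0 = 0"
    "\<And>e t. e \<in> half_edges N \<Longrightarrow> he_origin N e = vpos N i0 \<Longrightarrow> t \<in> {0..T} \<Longrightarrow> W e 0 t = integral {0..t} h"
    using G.boundary_heat_solution_exists[OF T h] by blast
  have int: "integral {0..t} h = \<gamma> t - \<gamma> 0" if "t \<in> {0..T}" for t
  proof (rule integral_unique, rule fundamental_theorem_of_calculus)
    show "0 \<le> t" using that by simp
    fix s assume s: "s \<in> {0..t}"
    have "(\<gamma> has_real_derivative h s) (at s within {0..t})"
      by (rule DERIV_subset[OF \<gamma>]) (use s that in auto)
    then show "(\<gamma> has_vector_derivative h s) (at s within {0..t})"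
      by (simp add: has_real_derivative_iff_has_vector_derivative)
  qed
  note U = G.heat_solution_lincomb[OF W(1) G.heat_solution_const[of T "\<gamma> 0"], of 1 1, simplified]
  obtain v v1 v2 where v: "network_heat T v v1 v2"
    "\<And>e y t. e \<in> half_edges N \<Longrightarrow> y \<in> {0..he_len N e} \<Longrightarrow> t \<in> {0..T} \<Longrightarrow> v (he_point N e y) t = W e y t + \<gamma> 0"
    using heat_solution_imp_network_heat[OF U] by blast
  show thesis
  proof (rule that[OF v(1)])
    fix x assume x: "x \<in> carrier_set N"
    obtain e y where e: "e \<in> half_edges N" "y \<in> {0..he_len N e}" "x = he_point N e y"
      by (rule carrier_half_edge_cases[OF x])
    show "v x 0 = \<gamma> 0" using v(2)[OF e(1,2), of 0] W(2)[OF e(1,2)] T by (simp add: e(3))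
    fix t assume t: "t \<in> {0..T}"
    have "\<kappa> \<le> W e y t + \<gamma> 0"
      by (rule G.heat_solution_minimum[OF T U _ _ e(1,2) t]) (use W(2,3) int lower T in auto)
    then show "\<kappa> \<le> v x t" using v(2)[OF e(1,2) t] by (simp add: e(3))
  next
    fix t assume t: "t \<in> {0..T}"
    obtain e where e: "e \<in> half_edges N" "he_origin N e = vpos N i0" by (rule exit_half_edge)
    show "v (vpos N i0) t = \<gamma> t"
      using v(2)[OF e(1) _ t, of 0] W(3)[OF e t] int[OF t] G.L_pos[OF e(1)] by (simp add: he_origin_def e(2)[symmetric])
  qed
qed

section \<open>Classical regularity in edge coordinates\<close>

text \<open>The regularity of a classical solution on one edge with named derivatives, which can be computed with
by the usual rules.\<close>

definition edge_C21 :: "real \<Rightarrow> (real ^ 'n \<Rightarrow> real \<Rightarrow> real) \<Rightarrow> 'j \<Rightarrow> (real \<Rightarrow> real \<Rightarrow> real) \<Rightarrow> (real \<Rightarrow> real \<Rightarrow> real) \<Rightarrow> (real \<Rightarrow> real \<Rightarrow> real) \<Rightarrow> bool" where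
  "edge_C21 T u j u1 u2 ut \<longleftrightarrow>
     continuous_on ({0..len N j} \<times> {0<..<T}) (\<lambda>(y, t). u (param N j y) t) \<and>
     continuous_on ({0..len N j} \<times> {0<..<T}) (\<lambda>(y, t). u1 y t) \<and>
     continuous_on ({0..len N j} \<times> {0<..<T}) (\<lambda>(y, t). u2 y t) \<and>
     continuous_on ({0..len N j} \<times> {0<..<T}) (\<lambda>(y, t). ut y t) \<and>
     (\<forall>y\<in>{0..len N j}. \<forall>t\<in>{0<..<T}.
        ((\<lambda>y. u (param N j y) t) has_real_derivative u1 y t) (at y within {0..len N j}) \<and>
        ((\<lambda>y. u1 y t) has_real_derivative u2 y t) (at y within {0..len N j}) \<and>
        ((\<lambda>t. u (param N j y) t) has_real_derivative ut y t) (at t))"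

lemma edge_C21_D:
  assumes "edge_C21 T u j u1 u2 ut"
  shows "continuous_on ({0..len N j} \<times> {0<..<T}) (\<lambda>(y, t). u (param N j y) t)"
    and "continuous_on ({0..len N j} \<times> {0<..<T}) (\<lambda>(y, t). u1 y t)"
    and "continuous_on ({0..len N j} \<times> {0<..<T}) (\<lambda>(y, t). u2 y t)"
    and "continuous_on ({0..len N j} \<times> {0<..<T}) (\<lambda>(y, t). ut y t)"
    and "y \<in> {0..len N j} \<Longrightarrow> t \<in> {0<..<T} \<Longrightarrow> ((\<lambda>y. u (param N j y) t) has_real_derivative u1 y t) (at y within {0..len N j})"
    and "y \<in> {0..len N j} \<Longrightarrow> t \<in> {0<..<T} \<Longrightarrow> ((\<lambda>y. u1 y t) has_real_derivative u2 y t) (at y within {0..len N j})"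
    and "y \<in> {0..len N j} \<Longrightarrow> t \<in> {0<..<T} \<Longrightarrow> ((\<lambda>t. u (param N j y) t) has_real_derivative ut y t) (at t)"
  using assms unfolding edge_C21_def by blast+

lemma on_edge_eq: "on_edge N f j = (\<lambda>y. f (param N j y))"
  by (simp add: on_edge_def fun_eq_iff)

lemma edge_deriv_param:
  "j \<in> edges N \<Longrightarrow> y \<in> {0..len N j} \<Longrightarrow> edge_deriv N k j f (param N j y) = iter_deriv {0..len N j} k (\<lambda>y. f (param N j y)) y"
  by (simp add: edge_deriv_def on_edge_eq)

lemma edge_deriv_1_eq:
  assumes "j \<in> edges N" "y \<in> {0..len N j}" "((\<lambda>y. f (param N j y)) has_real_derivative D) (at y within {0..len N j})"
  shows "edge_deriv N 1 j f (param N j y) = D"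
  unfolding edge_deriv_param[OF assms(1,2)] by (rule iter_deriv_1[OF edge_facts(1)[OF assms(1)] assms(2,3)])

lemma edge_C21_derivs:
  assumes j: "j \<in> edges N" and u: "edge_C21 T u j u1 u2 ut" and y: "y \<in> {0..len N j}" and t: "t \<in> {0<..<T}"
  shows "edge_deriv N 1 j (\<lambda>z. u z t) (param N j y) = u1 y t"
    and "edge_deriv N 2 j (\<lambda>z. u z t) (param N j y) = u2 y t"
    and "time_deriv u (param N j y) t = ut y t"
proof -
  note D = edge_C21_D[OF u]
  show "edge_deriv N 1 j (\<lambda>z. u z t) (param N j y) = u1 y t"
    by (rule edge_deriv_1_eq[OF j y D(5)[OF y t]])
  show "edge_deriv N 2 j (\<lambda>z. u z t) (param N j y) = u2 y t"
    unfolding edge_deriv_param[OF j y] by (rule iter_deriv_2[OF edge_facts(1)[OF j] y D(5)[OF _ t] D(6)[OF y t]])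
  show "time_deriv u (param N j y) t = ut y t"
    unfolding time_deriv_def
    by (rule vector_derivative_at) (use D(7)[OF y t] in \<open>simp add: has_real_derivative_iff_has_vector_derivative\<close>)
qed

lemma classicalI:
  assumes cont: "continuous_on (carrier_set N \<times> {0..T}) (\<lambda>(x, t). u x t)"
    and reg: "\<And>j. j \<in> edges N \<Longrightarrow> edge_C21 T u j (u1 j) (u2 j) (ut j)"
  shows "classical N T u"
  unfolding classical_def C21_on_edge_def
proof (intro conjI ballI allI impI cont)
  fix j assume j: "j \<in> edges N"
  note D = edge_C21_D[OF reg[OF j]] and E = edge_C21_derivs[OF j reg[OF j]]
  note l = edge_facts(1)[OF j]
  show "Ck_on 2 {0..len N j} (on_edge N (\<lambda>x. u x s) j)" if s: "s \<in> {0<..<T}" for s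
    unfolding on_edge_eq
  proof (rule Ck_on_2I[OF l D(5)[OF _ s] D(6)[OF _ s]])
    show "continuous_on {0..len N j} (\<lambda>y. u2 j y s)"
      by (rule continuous_on_kernel_compose[OF D(3)]) (use s in \<open>auto intro: continuous_intros\<close>)
  qed
  show "(\<lambda>t. u x t) differentiable (at s)" if x: "x \<in> arc_of N j" and s: "s \<in> {0<..<T}" for x s
  proof -
    obtain y where "y \<in> {0..len N j}" "x = param N j y" using x by (auto simp: arc_of_def)
    then show ?thesis
      using D(7)[of y s] s unfolding has_real_derivative_iff_has_vector_derivative by (auto intro: differentiableI_vector)
  qed
  show "continuous_on ({0..len N j} \<times> {0<..<T}) (\<lambda>(y, s). iter_deriv {0..len N j} k (on_edge N (\<lambda>x. u x s) j) y)"
    if k: "k \<le> 2" for k :: nat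
  proof -
    consider "k = 0" | "k = 1" | "k = 2" using k by linarith
    then show ?thesis
    proof cases
      case 1
      then show ?thesis using D(1) by (simp add: iter_deriv_simps(1) on_edge_eq)
    next
      case 2
      show ?thesis unfolding 2
        by (rule continuous_on_eq[OF D(2)]) (use E(1) j in \<open>auto simp: on_edge_eq edge_deriv_param\<close>)
    next
      case 3
      show ?thesis unfolding 3
        by (rule continuous_on_eq[OF D(3)]) (use E(2) j in \<open>auto simp: on_edge_eq edge_deriv_param\<close>)
    qed
  qed
  show "continuous_on ({0..len N j} \<times> {0<..<T}) (\<lambda>(y, s). time_deriv u (param N j y) s)"
    by (rule continuous_on_eq[OF D(4)]) (use E(3) in auto)
qed

lemma classicalD:
  assumes u: "classical N T u" and j: "j \<in> edges N"
  shows "edge_C21 T u j (\<lambda>y t. edge_deriv N 1 j (\<lambda>z. u z t) (param N j y))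
    (\<lambda>y t. edge_deriv N 2 j (\<lambda>z. u z t) (param N j y)) (\<lambda>y t. time_deriv u (param N j y) t)"
proof -
  have C: "C21_on_edge N T u j" using u j by (simp add: classical_def)
  have ck: "Ck_on 2 {0..len N j} (\<lambda>y. u (param N j y) t)" if "t \<in> {0<..<T}" for t
    using C that by (simp add: C21_on_edge_def on_edge_eq)
  have it: "continuous_on ({0..len N j} \<times> {0<..<T}) (\<lambda>(y, s). iter_deriv {0..len N j} k (\<lambda>y. u (param N j y) s) y)"
    if "k \<le> 2" for k
    using C that by (simp add: C21_on_edge_def on_edge_eq)
  note l = edge_facts(1)[OF j]
  show ?thesis unfolding edge_C21_def
  proof (intro conjI ballI)
    show "continuous_on ({0..len N j} \<times> {0<..<T}) (\<lambda>(y, t). u (param N j y) t)"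
      using it[of 0] by (simp add: iter_deriv_simps(1))
    show "continuous_on ({0..len N j} \<times> {0<..<T}) (\<lambda>(y, t). edge_deriv N 1 j (\<lambda>z. u z t) (param N j y))"
      by (rule continuous_on_eq[OF it[of 1]]) (use j in \<open>auto simp: edge_deriv_param\<close>)
    show "continuous_on ({0..len N j} \<times> {0<..<T}) (\<lambda>(y, t). edge_deriv N 2 j (\<lambda>z. u z t) (param N j y))"
      by (rule continuous_on_eq[OF it[of 2]]) (use j in \<open>auto simp: edge_deriv_param\<close>)
    show "continuous_on ({0..len N j} \<times> {0<..<T}) (\<lambda>(y, t). time_deriv u (param N j y) t)"
      using C by (simp add: C21_on_edge_def)
    fix y t assume y: "y \<in> {0..len N j}" and t: "t \<in> {0<..<T}"
    show "((\<lambda>y. u (param N j y) t) has_real_derivative edge_deriv N 1 j (\<lambda>z. u z t) (param N j y)) (at y within {0..len N j})"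
      unfolding edge_deriv_param[OF j y] by (rule Ck_on_2_derivs(1)[OF l ck[OF t] y])
    show "((\<lambda>y. edge_deriv N 1 j (\<lambda>z. u z t) (param N j y)) has_real_derivative edge_deriv N 2 j (\<lambda>z. u z t) (param N j y)) (at y within {0..len N j})"
      unfolding edge_deriv_param[OF j y]
      by (rule has_field_derivative_transform_within[OF Ck_on_2_derivs(2)[OF l ck[OF t] y] zero_less_one y])
         (simp add: edge_deriv_param j)
    have "(\<lambda>t. u (param N j y) t) differentiable (at t)"
      using C y t by (simp add: C21_on_edge_def arc_of_def)
    then show "((\<lambda>t. u (param N j y) t) has_real_derivative time_deriv u (param N j y) t) (at t)"
      by (simp add: time_deriv_def vector_derivative_works has_real_derivative_iff_has_vector_derivative)
  qed
qed

lemma vertex_coord: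
  assumes "i \<in> vertices N" "j \<in> Inc N i"
  shows "j \<in> edges N" "coord N j (vpos N i) \<in> {0..len N j}" "param N j (coord N j (vpos N i)) = vpos N i"
proof -
  show j: "j \<in> edges N" using assms by (simp add: Inc_def)
  obtain y where "y \<in> {0..len N j}" "vpos N i = param N j y" using assms by (auto simp: Inc_def arc_of_def)
  then show "coord N j (vpos N i) \<in> {0..len N j}" "param N j (coord N j (vpos N i)) = vpos N i" using j by auto
qed

lemma transition_vertex: "i \<in> transition_idx N \<Longrightarrow> i \<in> vertices N"
  by (simp add: transition_idx_def)

section \<open>The Hopf-Cole transformation\<close>

text \<open>Time is reversed in the first function because \<open>exp (u / 2)\<close> solves a backward equation.\<close>

lemma solution_imp_heat:
  assumes sol: "mfg_solution N i0 T cT m0 u m"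
  obtains w1 w2 p1 p2 where
    "network_heat T (\<lambda>x t. exp (u x (T - t) / 2)) w1 w2"
    "network_heat T (\<lambda>x t. m x t * exp (- (u x t / 2))) p1 p2"
proof -
  have cu: "classical N T u" and cm: "classical N T m"
    and pde_u: "\<And>j x s. j \<in> edges N \<Longrightarrow> x \<in> arc_of N j \<Longrightarrow> s \<in> {0<..<T} \<Longrightarrow>
        time_deriv u x s + edge_deriv N 2 j (\<lambda>z. u z s) x + 1 / 2 * \<bar>edge_deriv N 1 j (\<lambda>z. u z s) x\<bar>\<^sup>2 = 0"
    and pde_m: "\<And>j x s. j \<in> edges N \<Longrightarrow> x \<in> arc_of N j \<Longrightarrow> s \<in> {0<..<T} \<Longrightarrow>
        time_deriv m x s - edge_deriv N 2 j (\<lambda>z. m z s) x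
          + edge_deriv N 1 j (\<lambda>z. edge_deriv N 1 j (\<lambda>z'. u z' s) z * m z s) x = 0"
    and kir_u: "\<And>i s. i \<in> transition_idx N \<Longrightarrow> s \<in> {0<..<T} \<Longrightarrow>
        (\<Sum>j\<in>Inc N i. incidence N i j * edge_deriv N 1 j (\<lambda>z. u z s) (vpos N i)) = 0"
    and kir_m: "\<And>i s. i \<in> transition_idx N \<Longrightarrow> s \<in> {0<..<T} \<Longrightarrow>
        (\<Sum>j\<in>Inc N i. incidence N i j * (edge_deriv N 1 j (\<lambda>z. m z s) (vpos N i)
             - m (vpos N i) s * edge_deriv N 1 j (\<lambda>z. u z s) (vpos N i))) = 0"
    using sol unfolding mfg_solution_def by blast+
  define u1 where "u1 = (\<lambda>j y t. edge_deriv N 1 j (\<lambda>z. u z t) (param N j y))"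
  define u2 where "u2 = (\<lambda>j y t. edge_deriv N 2 j (\<lambda>z. u z t) (param N j y))"
  define ut where "ut = (\<lambda>j y t. time_deriv u (param N j y) t)"
  define m1 where "m1 = (\<lambda>j y t. edge_deriv N 1 j (\<lambda>z. m z t) (param N j y))"
  define m2 where "m2 = (\<lambda>j y t. edge_deriv N 2 j (\<lambda>z. m z t) (param N j y))"
  define mt where "mt = (\<lambda>j y t. time_deriv m (param N j y) t)"
  have regu: "edge_C21 T u j (u1 j) (u2 j) (ut j)" if "j \<in> edges N" for j
    using classicalD[OF cu that] by (simp only: u1_def u2_def ut_def)
  have regm: "edge_C21 T m j (m1 j) (m2 j) (mt j)" if "j \<in> edges N" for j
    using classicalD[OF cm that] by (simp only: m1_def m2_def mt_def)
  note U = edge_C21_D[OF regu] and M = edge_C21_D[OF regm]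
  have ut: "ut j y t = - u2 j y t - (u1 j y t)\<^sup>2 / 2" if "j \<in> edges N" "y \<in> {0..len N j}" "t \<in> {0<..<T}" for j y t
    using pde_u[OF that(1) _ that(3), of "param N j y"] that(2) by (simp add: arc_of_def ut_def u2_def u1_def)
  have mt: "mt j y t = m2 j y t - (u2 j y t * m (param N j y) t + u1 j y t * m1 j y t)"
    if j: "j \<in> edges N" and y: "y \<in> {0..len N j}" and t: "t \<in> {0<..<T}" for j y t
  proof -
    have "((\<lambda>y. u1 j y t * m (param N j y) t) has_real_derivative
        u2 j y t * m (param N j y) t + m1 j y t * u1 j y t) (at y within {0..len N j})"
      by (rule DERIV_mult[OF U(6)[OF j y t] M(5)[OF j y t]])
    then have "edge_deriv N 1 j (\<lambda>z. edge_deriv N 1 j (\<lambda>z'. u z' t) z * m z t) (param N j y) =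
        u2 j y t * m (param N j y) t + m1 j y t * u1 j y t"
      unfolding u1_def by (rule edge_deriv_1_eq[OF j y])
    then show ?thesis
      using pde_m[OF j _ t, of "param N j y"] y by (simp add: arc_of_def mt_def m2_def mult.commute)
  qed
  define E where "E = (\<lambda>x t. exp (u x t / 2))"
  define w1 where "w1 = (\<lambda>j y t. E (param N j y) (T - t) * (u1 j y (T - t) / 2))"
  define w2 where "w2 = (\<lambda>j y t. E (param N j y) (T - t) * (u2 j y (T - t) / 2 + (u1 j y (T - t))\<^sup>2 / 4))"
  have cont_u: "continuous_on (carrier_set N \<times> {0..T}) (\<lambda>(x, t). u x t)"
    and cont_m: "continuous_on (carrier_set N \<times> {0..T}) (\<lambda>(x, t). m x t)"
    using cu cm by (auto simp: classical_def)
  have "network_heat T (\<lambda>x t. E x (T - t)) w1 w2"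
    unfolding network_heat_def
  proof (intro conjI ballI)
    have "continuous_on (carrier_set N \<times> {0..T}) (\<lambda>p. (\<lambda>(x, t). u x t) (fst p, T - snd p))"
      by (rule continuous_on_compose2[OF cont_u]) (auto intro!: continuous_intros)
    then show "continuous_on (carrier_set N \<times> {0..T}) (\<lambda>(x, t). E x (T - t))"
      unfolding E_def case_prod_beta by (intro continuous_intros) auto
    fix j assume j: "j \<in> edges N"
    have rev: "continuous_on ({0..len N j} \<times> {0<..<T}) (\<lambda>p. f (fst p) (T - snd p))"
      if "continuous_on ({0..len N j} \<times> {0<..<T}) (\<lambda>(y, t). f y t)" for f :: "real \<Rightarrow> real \<Rightarrow> real"
      by (intro continuous_on_kernel_compose[OF that] continuous_intros) auto
    show "continuous_on ({0..len N j} \<times> {0<..<T}) (\<lambda>(y, t). w1 j y t)"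
      unfolding w1_def E_def case_prod_beta
      by (intro continuous_intros rev[OF U(1)[OF j]] rev[OF U(2)[OF j]]) auto
    show "continuous_on ({0..len N j} \<times> {0<..<T}) (\<lambda>(y, t). w2 j y t)"
      unfolding w2_def E_def case_prod_beta
      by (intro continuous_intros rev[OF U(1)[OF j]] rev[OF U(2)[OF j]] rev[OF U(3)[OF j]]) auto
    fix y t assume y: "y \<in> {0..len N j}" and "t \<in> {0<..<T}"
    then have t: "T - t \<in> {0<..<T}" by auto
    have Ed: "((\<lambda>y. E (param N j y) (T - t)) has_real_derivative E (param N j y) (T - t) * (u1 j y (T - t) / 2)) (at y within {0..len N j})"
      unfolding E_def
      by (rule DERIV_cong[OF DERIV_chain'[OF DERIV_cdivide[OF U(5)[OF j y t]] DERIV_exp]]) simp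
    then show "((\<lambda>y. E (param N j y) (T - t)) has_real_derivative w1 j y t) (at y within {0..len N j})"
      by (simp add: w1_def)
    show "((\<lambda>y. w1 j y t) has_real_derivative w2 j y t) (at y within {0..len N j})"
      unfolding w1_def w2_def
      by (rule DERIV_cong[OF DERIV_mult[OF Ed DERIV_cdivide[OF U(6)[OF j y t]]]])
         (simp add: algebra_simps power2_eq_square)
    have tr: "((\<lambda>t. T - t) has_real_derivative - 1) (at t)" by (auto intro!: derivative_eq_intros)
    have "((\<lambda>t. u (param N j y) t / 2) has_real_derivative ut j y (T - t) / 2) (at (T - t))"
      by (rule DERIV_cdivide[OF U(7)[OF j y t]])
    then have "((\<lambda>t. u (param N j y) (T - t) / 2) has_real_derivative - 1 * (ut j y (T - t) / 2)) (at t)"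
      by (intro DERIV_cong[OF DERIV_chain'[OF tr]]) auto
    then show "((\<lambda>t. E (param N j y) (T - t)) has_real_derivative w2 j y t) (at t)"
      unfolding E_def w2_def ut[OF j y t]
      by (intro DERIV_cong[OF DERIV_chain'[OF _ DERIV_exp]]) (auto simp: algebra_simps add_divide_distrib diff_divide_distrib)
  next
    fix i t assume i: "i \<in> transition_idx N" and "t \<in> {0<..<T}"
    then have t: "T - t \<in> {0<..<T}" by auto
    have "incidence N i j * w1 j (coord N j (vpos N i)) t =
        E (vpos N i) (T - t) / 2 * (incidence N i j * edge_deriv N 1 j (\<lambda>z. u z (T - t)) (vpos N i))"
      if "j \<in> Inc N i" for j
      using vertex_coord[OF transition_vertex[OF i] that] by (simp add: w1_def u1_def)
    then have "(\<Sum>j\<in>Inc N i. incidence N i j * w1 j (coord N j (vpos N i)) t) =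
        E (vpos N i) (T - t) / 2 * (\<Sum>j\<in>Inc N i. incidence N i j * edge_deriv N 1 j (\<lambda>z. u z (T - t)) (vpos N i))"
      unfolding sum_distrib_left by (rule sum.cong[OF refl])
    then show "(\<Sum>j\<in>Inc N i. incidence N i j * w1 j (coord N j (vpos N i)) t) = 0"
      using kir_u[OF i t] by simp
  qed
  moreover define F where "F = (\<lambda>x t. exp (- (u x t / 2)))"
  define p1 where "p1 = (\<lambda>j y t. F (param N j y) t * (m1 j y t - m (param N j y) t * u1 j y t / 2))"
  define p2 where "p2 = (\<lambda>j y t. F (param N j y) t *
    (m2 j y t - m1 j y t * u1 j y t - m (param N j y) t * u2 j y t / 2 + m (param N j y) t * (u1 j y t)\<^sup>2 / 4))"
  have "network_heat T (\<lambda>x t. m x t * F x t) p1 p2"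
    unfolding network_heat_def
  proof (intro conjI ballI)
    show "continuous_on (carrier_set N \<times> {0..T}) (\<lambda>(x, t). m x t * F x t)"
      using cont_u cont_m unfolding F_def case_prod_beta by (intro continuous_intros) auto
    fix j assume j: "j \<in> edges N"
    note c = U(1-3)[OF j] M(1-3)[OF j]
    show "continuous_on ({0..len N j} \<times> {0<..<T}) (\<lambda>(y, t). p1 j y t)"
      using c unfolding p1_def F_def case_prod_beta by (intro continuous_intros) auto
    show "continuous_on ({0..len N j} \<times> {0<..<T}) (\<lambda>(y, t). p2 j y t)"
      using c unfolding p2_def F_def case_prod_beta by (intro continuous_intros) auto
    fix y t assume y: "y \<in> {0..len N j}" and t: "t \<in> {0<..<T}"
    have Fd: "((\<lambda>y. F (param N j y) t) has_real_derivative F (param N j y) t * (- (u1 j y t / 2))) (at y within {0..len N j})"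
      unfolding F_def
      by (rule DERIV_cong[OF DERIV_chain'[OF DERIV_minus[OF DERIV_cdivide[OF U(5)[OF j y t]]] DERIV_exp]]) simp
    show "((\<lambda>y. m (param N j y) t * F (param N j y) t) has_real_derivative p1 j y t) (at y within {0..len N j})"
      unfolding p1_def
      by (rule DERIV_cong[OF DERIV_mult[OF M(5)[OF j y t] Fd]]) (simp add: algebra_simps)
    have "((\<lambda>y. m1 j y t - m (param N j y) t * u1 j y t / 2) has_real_derivative
        m2 j y t - (m1 j y t * u1 j y t + u2 j y t * m (param N j y) t) / 2) (at y within {0..len N j})"
      by (intro DERIV_diff DERIV_cdivide DERIV_mult U M j y t)
    from DERIV_mult[OF Fd this] show "((\<lambda>y. p1 j y t) has_real_derivative p2 j y t) (at y within {0..len N j})"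
      unfolding p1_def p2_def by (rule DERIV_cong) (simp add: field_simps power2_eq_square)
    have Ft: "((\<lambda>t. F (param N j y) t) has_real_derivative F (param N j y) t * (- (ut j y t / 2))) (at t)"
      unfolding F_def
      by (rule DERIV_cong[OF DERIV_chain'[OF DERIV_minus[OF DERIV_cdivide[OF U(7)[OF j y t]]] DERIV_exp]]) simp
    show "((\<lambda>t. m (param N j y) t * F (param N j y) t) has_real_derivative p2 j y t) (at t)"
      unfolding p2_def
      by (rule DERIV_cong[OF DERIV_mult[OF M(7)[OF j y t] Ft]])
         (simp add: ut[OF j y t] mt[OF j y t] field_simps power2_eq_square)
  next
    fix i t assume i: "i \<in> transition_idx N" and t: "t \<in> {0<..<T}"
    let ?x = "vpos N i"
    have "incidence N i j * p1 j (coord N j ?x) t =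
        F ?x t * (incidence N i j * (edge_deriv N 1 j (\<lambda>z. m z t) ?x - m ?x t * edge_deriv N 1 j (\<lambda>z. u z t) ?x))
        + F ?x t * m ?x t / 2 * (incidence N i j * edge_deriv N 1 j (\<lambda>z. u z t) ?x)"
      if "j \<in> Inc N i" for j
      using vertex_coord[OF transition_vertex[OF i] that] by (simp add: p1_def u1_def m1_def field_simps)
    then have "(\<Sum>j\<in>Inc N i. incidence N i j * p1 j (coord N j ?x) t) =
        F ?x t * (\<Sum>j\<in>Inc N i. incidence N i j * (edge_deriv N 1 j (\<lambda>z. m z t) ?x - m ?x t * edge_deriv N 1 j (\<lambda>z. u z t) ?x))
        + F ?x t * m ?x t / 2 * (\<Sum>j\<in>Inc N i. incidence N i j * edge_deriv N 1 j (\<lambda>z. u z t) ?x)"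
      by (simp add: sum.distrib sum_distrib_left del: distrib_left)
    then show "(\<Sum>j\<in>Inc N i. incidence N i j * p1 j (coord N j ?x) t) = 0"
      using kir_u[OF i t] kir_m[OF i t] by simp
  qed
  ultimately show thesis using that unfolding E_def F_def by blast
qed

text \<open>The first heat problem has the same data for both solutions and determines \<open>u\<close>. Then the data of the
second one agree as well.\<close>

theorem mfg_solution_unique:
  assumes T: "0 < T" and sol: "mfg_solution N i0 T cT m0 u m" and sol': "mfg_solution N i0 T cT m0 u' m'"
    and x: "x \<in> carrier_set N" and s: "s \<in> {0..T}"
  shows "u x s = u' x s \<and> m x s = m' x s"
proof -
  have data: "m x 0 = m' x 0" "u x T = u' x T" if "x \<in> carrier_set N" for x
    using sol sol' that unfolding mfg_solution_def by simp_all
  have bdry: "m (vpos N i0) s = m' (vpos N i0) s" "u (vpos N i0) s = u' (vpos N i0) s" if "s \<in> {0..T}" for s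
    using sol sol' that unfolding mfg_solution_def by simp_all
  obtain w1 w2 p1 p2 where h: "network_heat T (\<lambda>x t. exp (u x (T - t) / 2)) w1 w2"
    "network_heat T (\<lambda>x t. m x t * exp (- (u x t / 2))) p1 p2"
    using solution_imp_heat[OF sol] by blast
  obtain w1' w2' p1' p2' where h': "network_heat T (\<lambda>x t. exp (u' x (T - t) / 2)) w1' w2'"
    "network_heat T (\<lambda>x t. m' x t * exp (- (u' x t / 2))) p1' p2'"
    using solution_imp_heat[OF sol'] by blast
  have u: "u x s = u' x s" if "x \<in> carrier_set N" "s \<in> {0..T}" for x s
  proof -
    have "exp (u x (T - (T - s)) / 2) = exp (u' x (T - (T - s)) / 2)"
      by (rule network_heat_unique[OF T h(1) h'(1) _ _ that(1)]) (use data bdry that(2) in auto)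
    then show ?thesis by simp
  qed
  have "m x s * exp (- (u x s / 2)) = m' x s * exp (- (u' x s / 2))"
    by (rule network_heat_unique[OF T h(2) h'(2) _ _ x s]) (use data bdry u T in auto)
  then show ?thesis using u[OF x s] by simp
qed

text \<open>The first heat problem has boundary value \<open>exp (cT / 2)\<close>, reversed in time. It is at least \<open>1\<close> because \<open>cT\<close> is
nonnegative, so the logarithm and the quotient \<open>m0 / w\<close> are defined.\<close>

theorem mfg_solution_exists:
  assumes T: "0 < T" and c: "Ck_on 1 {0..T} cT" and c0: "\<And>s. s \<in> {0..T} \<Longrightarrow> 0 \<le> cT s"
    and m0: "continuous_on (carrier_set N) m0" and m00: "m0 (vpos N i0) = 0"
  shows "\<exists>u m. mfg_solution N i0 T cT m0 u m"
proof -
  define c' where "c' = iter_deriv {0..T} 1 cT"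
  have c': "continuous_on {0..T} c'" using c by (simp add: Ck_on_def c'_def)
  have cd: "(cT has_real_derivative c' s) (at s within {0..T})" if "s \<in> {0..T}" for s
  proof -
    have "cT differentiable (at s within {0..T})" using c that by (simp add: Ck_on_def iter_deriv_simps(1))
    then show ?thesis
      by (simp add: c'_def iter_deriv_simps vector_derivative_works has_real_derivative_iff_has_vector_derivative)
  qed
  define \<gamma> where "\<gamma> = (\<lambda>t. exp (cT (T - t) / 2))"
  define h where "h = (\<lambda>t. - (exp (cT (T - t) / 2) * (c' (T - t) / 2)))"
  have c_cont: "continuous_on {0..T} cT" by (rule DERIV_continuous_on[OF cd])
  have hc: "continuous_on {0..T} h"
    unfolding h_def
    by (intro continuous_intros continuous_on_compose2[OF c_cont] continuous_on_compose2[OF c']) auto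
  have gd: "(\<gamma> has_real_derivative h t) (at t within {0..T})" if "t \<in> {0..T}" for t
  proof -
    have im: "(\<lambda>t. T - t) ` {0..T} = {0..T}" by simp
    have "(cT has_real_derivative c' (T - t)) (at (T - t) within (\<lambda>t. T - t) ` {0..T})"
      unfolding im by (rule cd) (use that in auto)
    moreover have "((\<lambda>t. T - t) has_real_derivative - 1) (at t within {0..T})" by (auto intro!: derivative_eq_intros)
    ultimately have "(cT \<circ> (\<lambda>t. T - t) has_real_derivative c' (T - t) * - 1) (at t within {0..T})"
      by (rule DERIV_image_chain)
    from DERIV_cdivide[OF this, of 2]
    have "((\<lambda>t. cT (T - t) / 2) has_real_derivative c' (T - t) * - 1 / 2) (at t within {0..T})"
      by (simp add: o_def)
    then show ?thesis unfolding \<gamma>_def h_def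
      by (intro DERIV_cong[OF DERIV_chain'[OF _ DERIV_exp]]) auto
  qed
  have g1: "1 \<le> \<gamma> t" if "t \<in> {0..T}" for t using c0[of "T - t"] that by (simp add: \<gamma>_def)
  obtain v v1 v2 where v: "network_heat T v v1 v2" "\<And>x. x \<in> carrier_set N \<Longrightarrow> v x 0 = \<gamma> 0"
    "\<And>t. t \<in> {0..T} \<Longrightarrow> v (vpos N i0) t = \<gamma> t"
    "\<And>x t. x \<in> carrier_set N \<Longrightarrow> t \<in> {0..T} \<Longrightarrow> 1 \<le> v x t"
    using network_heat_exists_boundary[OF T hc gd g1] by blast
  have v_cont: "continuous_on (carrier_set N \<times> {0..T}) (\<lambda>(x, t). v x t)" using v(1) by (simp add: network_heat_def)
  have vT: "continuous_on (carrier_set N) (\<lambda>x. v x T)"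
    by (intro continuous_on_kernel_compose[OF v_cont] continuous_on_id continuous_on_const) (use T in auto)
  have vT_nz: "v x T \<noteq> 0" if "x \<in> carrier_set N" for x using v(4)[OF that, of T] T by auto
  have f: "continuous_on (carrier_set N) (\<lambda>x. m0 x / v x T)"
    by (intro continuous_on_divide m0 vT) (use vT_nz in blast)
  obtain p p1 p2 where p: "network_heat T p p1 p2" "\<And>x. x \<in> carrier_set N \<Longrightarrow> p x 0 = m0 x / v x T"
    "\<And>t. t \<in> {0..T} \<Longrightarrow> p (vpos N i0) t = 0"
    using network_heat_exists_initial[OF T f] m00 by auto
  have p_cont: "continuous_on (carrier_set N \<times> {0..T}) (\<lambda>(x, t). p x t)" using p(1) by (simp add: network_heat_def)
  define w where "w = (\<lambda>x s. v x (T - s))"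
  define u where "u = (\<lambda>x s. 2 * ln (w x s))"
  define m where "m = (\<lambda>x s. w x s * p x s)"
  define w1 where "w1 = (\<lambda>j y s. v1 j y (T - s))"
  define w2 where "w2 = (\<lambda>j y s. v2 j y (T - s))"
  define u1 where "u1 = (\<lambda>j y s. 2 * (w1 j y s / w (param N j y) s))"
  define u2 where "u2 = (\<lambda>j y s. 2 * (w2 j y s / w (param N j y) s - (w1 j y s / w (param N j y) s)\<^sup>2))"
  define ut where "ut = (\<lambda>j y s. - 2 * (w2 j y s / w (param N j y) s))"
  define m1 where "m1 = (\<lambda>j y s. w1 j y s * p (param N j y) s + w (param N j y) s * p1 j y s)"
  define m2 where "m2 = (\<lambda>j y s. w2 j y s * p (param N j y) s + 2 * (w1 j y s * p1 j y s) + w (param N j y) s * p2 j y s)"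
  define mt where "mt = (\<lambda>j y s. w (param N j y) s * p2 j y s - w2 j y s * p (param N j y) s)"
  have wpos: "0 < w x s" if "x \<in> carrier_set N" "s \<in> {0..T}" for x s
    using v(4)[OF that(1), of "T - s"] that(2) by (simp add: w_def)
  have w_cont: "continuous_on (carrier_set N \<times> {0..T}) (\<lambda>p. w (fst p) (snd p))"
    unfolding w_def by (intro continuous_on_kernel_compose[OF v_cont] continuous_intros) auto
  have restr: "continuous_on ({0..len N j} \<times> {0<..<T}) (\<lambda>q. f (param N j (fst q)) (snd q))"
    if j: "j \<in> edges N" and f: "continuous_on (carrier_set N \<times> {0..T}) (\<lambda>(x, s). f x s)"
    for j and f :: "real ^ 'n \<Rightarrow> real \<Rightarrow> real"
    by (intro continuous_on_kernel_compose[OF f] continuous_on_compose2[OF edge_facts(2)[OF j] continuous_on_fst]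
        continuous_on_snd continuous_on_id) (use arc_in_carrier[OF j] in auto)
  have wj: "continuous_on ({0..len N j} \<times> {0<..<T}) (\<lambda>q. w (param N j (fst q)) (snd q))"
    and w1j: "continuous_on ({0..len N j} \<times> {0<..<T}) (\<lambda>q. w1 j (fst q) (snd q))"
    and w2j: "continuous_on ({0..len N j} \<times> {0<..<T}) (\<lambda>q. w2 j (fst q) (snd q))"
    and pj: "continuous_on ({0..len N j} \<times> {0<..<T}) (\<lambda>q. p (param N j (fst q)) (snd q))"
    and p1j: "continuous_on ({0..len N j} \<times> {0<..<T}) (\<lambda>q. p1 j (fst q) (snd q))"
    and p2j: "continuous_on ({0..len N j} \<times> {0<..<T}) (\<lambda>q. p2 j (fst q) (snd q))"
    if j: "j \<in> edges N" for j
  proof -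
    have c1: "continuous_on ({0..len N j} \<times> {0<..<T}) (\<lambda>(y, t). v1 j y t)"
      and c2: "continuous_on ({0..len N j} \<times> {0<..<T}) (\<lambda>(y, t). v2 j y t)"
      and c3: "continuous_on ({0..len N j} \<times> {0<..<T}) (\<lambda>(y, t). p1 j y t)"
      and c4: "continuous_on ({0..len N j} \<times> {0<..<T}) (\<lambda>(y, t). p2 j y t)"
      using v(1) p(1) j by (auto simp: network_heat_def)
    show "continuous_on ({0..len N j} \<times> {0<..<T}) (\<lambda>q. w1 j (fst q) (snd q))" unfolding w1_def
      by (intro continuous_on_kernel_compose[OF c1] continuous_intros) auto
    show "continuous_on ({0..len N j} \<times> {0<..<T}) (\<lambda>q. w2 j (fst q) (snd q))" unfolding w2_def
      by (intro continuous_on_kernel_compose[OF c2] continuous_intros) auto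
    show "continuous_on ({0..len N j} \<times> {0<..<T}) (\<lambda>q. p1 j (fst q) (snd q))"
      "continuous_on ({0..len N j} \<times> {0<..<T}) (\<lambda>q. p2 j (fst q) (snd q))"
      using c3 c4 by (simp_all add: case_prod_beta)
    show "continuous_on ({0..len N j} \<times> {0<..<T}) (\<lambda>q. w (param N j (fst q)) (snd q))" by (rule restr[OF j]) (use w_cont in \<open>simp add: case_prod_beta\<close>)
    show "continuous_on ({0..len N j} \<times> {0<..<T}) (\<lambda>q. p (param N j (fst q)) (snd q))"
      by (rule restr[OF j p_cont])
  qed
  have wj_pos: "0 < w (param N j y) s" if "j \<in> edges N" "y \<in> {0..len N j}" "s \<in> {0<..<T}" for j y s
    using that by (intro wpos arc_in_carrier) auto
  have D: "((\<lambda>y. w (param N j y) s) has_real_derivative w1 j y s) (at y within {0..len N j})"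
    "((\<lambda>y. w1 j y s) has_real_derivative w2 j y s) (at y within {0..len N j})"
    "((\<lambda>s. w (param N j y) s) has_real_derivative - w2 j y s) (at s)"
    "((\<lambda>y. p (param N j y) s) has_real_derivative p1 j y s) (at y within {0..len N j})"
    "((\<lambda>y. p1 j y s) has_real_derivative p2 j y s) (at y within {0..len N j})"
    "((\<lambda>s. p (param N j y) s) has_real_derivative p2 j y s) (at s)"
    if j: "j \<in> edges N" and y: "y \<in> {0..len N j}" and s: "s \<in> {0<..<T}" for j y s
  proof -
    have s': "T - s \<in> {0<..<T}" using s by auto
    have V: "((\<lambda>y. v (param N j y) (T - s)) has_real_derivative v1 j y (T - s)) (at y within {0..len N j})"
      "((\<lambda>y. v1 j y (T - s)) has_real_derivative v2 j y (T - s)) (at y within {0..len N j})"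
      "((\<lambda>t. v (param N j y) t) has_real_derivative v2 j y (T - s)) (at (T - s))"
      using v(1) j y s' unfolding network_heat_def by blast+
    show "((\<lambda>y. w (param N j y) s) has_real_derivative w1 j y s) (at y within {0..len N j})"
      "((\<lambda>y. w1 j y s) has_real_derivative w2 j y s) (at y within {0..len N j})"
      using V(1,2) by (simp_all add: w_def w1_def w2_def)
    have "((\<lambda>s. T - s) has_real_derivative - 1) (at s)" by (auto intro!: derivative_eq_intros)
    from DERIV_chain'[OF this V(3)] show "((\<lambda>s. w (param N j y) s) has_real_derivative - w2 j y s) (at s)"
      by (simp add: w_def w2_def)
    show "((\<lambda>y. p (param N j y) s) has_real_derivative p1 j y s) (at y within {0..len N j})"
      "((\<lambda>y. p1 j y s) has_real_derivative p2 j y s) (at y within {0..len N j})"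
      "((\<lambda>s. p (param N j y) s) has_real_derivative p2 j y s) (at s)"
      using p(1) j y s unfolding network_heat_def by blast+
  qed
  have regu: "edge_C21 T u j (u1 j) (u2 j) (ut j)" if j: "j \<in> edges N" for j
    unfolding edge_C21_def
  proof (intro conjI ballI)
    have nz: "\<forall>q\<in>{0..len N j} \<times> {0<..<T}. w (param N j (fst q)) (snd q) \<noteq> 0"
      using wj_pos[OF j] by fastforce
    show "continuous_on ({0..len N j} \<times> {0<..<T}) (\<lambda>(y, t). u (param N j y) t)"
      "continuous_on ({0..len N j} \<times> {0<..<T}) (\<lambda>(y, t). u1 j y t)"
      "continuous_on ({0..len N j} \<times> {0<..<T}) (\<lambda>(y, t). u2 j y t)"
      "continuous_on ({0..len N j} \<times> {0<..<T}) (\<lambda>(y, t). ut j y t)"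
      unfolding u_def u1_def u2_def ut_def case_prod_beta
      using wj_pos[OF j] nz by (auto intro!: continuous_intros wj[OF j] w1j[OF j] w2j[OF j])
    fix y s assume y: "y \<in> {0..len N j}" and s: "s \<in> {0<..<T}"
    note D = D[OF j y s] and pos = wj_pos[OF j y s]
    show "((\<lambda>y. u (param N j y) s) has_real_derivative u1 j y s) (at y within {0..len N j})"
      unfolding u_def u1_def
      by (rule DERIV_cong[OF DERIV_cmult[OF DERIV_chain'[OF D(1) DERIV_ln[OF pos]]]]) (simp add: divide_inverse mult.commute)
    show "((\<lambda>y. u1 j y s) has_real_derivative u2 j y s) (at y within {0..len N j})"
      unfolding u1_def u2_def
      by (rule DERIV_cong[OF DERIV_cmult[OF DERIV_divide[OF D(2) D(1)]]])
         (use pos in \<open>auto simp: field_simps power2_eq_square\<close>)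
    show "((\<lambda>s. u (param N j y) s) has_real_derivative ut j y s) (at s)"
      unfolding u_def ut_def
      by (rule DERIV_cong[OF DERIV_cmult[OF DERIV_chain'[OF D(3) DERIV_ln[OF pos]]]]) (simp add: divide_inverse mult.commute)
  qed
  have regm: "edge_C21 T m j (m1 j) (m2 j) (mt j)" if j: "j \<in> edges N" for j
    unfolding edge_C21_def
  proof (intro conjI ballI)
    show "continuous_on ({0..len N j} \<times> {0<..<T}) (\<lambda>(y, t). m (param N j y) t)"
      "continuous_on ({0..len N j} \<times> {0<..<T}) (\<lambda>(y, t). m1 j y t)"
      "continuous_on ({0..len N j} \<times> {0<..<T}) (\<lambda>(y, t). m2 j y t)"
      "continuous_on ({0..len N j} \<times> {0<..<T}) (\<lambda>(y, t). mt j y t)"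
      unfolding m_def m1_def m2_def mt_def case_prod_beta
      by (auto intro!: continuous_intros wj[OF j] w1j[OF j] w2j[OF j] pj[OF j] p1j[OF j] p2j[OF j])
    fix y s assume y: "y \<in> {0..len N j}" and s: "s \<in> {0<..<T}"
    note D = D[OF j y s]
    show "((\<lambda>y. m (param N j y) s) has_real_derivative m1 j y s) (at y within {0..len N j})"
      unfolding m_def m1_def by (rule DERIV_cong[OF DERIV_mult[OF D(1) D(4)]]) (simp add: algebra_simps)
    show "((\<lambda>y. m1 j y s) has_real_derivative m2 j y s) (at y within {0..len N j})"
      unfolding m1_def m2_def
      by (rule DERIV_cong[OF DERIV_add[OF DERIV_mult[OF D(2) D(4)] DERIV_mult[OF D(1) D(5)]]]) (simp add: algebra_simps)
    show "((\<lambda>s. m (param N j y) s) has_real_derivative mt j y s) (at s)"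
      unfolding m_def mt_def by (rule DERIV_cong[OF DERIV_mult[OF D(3) D(6)]]) (simp add: algebra_simps)
  qed
  have "mfg_solution N i0 T cT m0 u m"
    unfolding mfg_solution_def
  proof (intro conjI ballI)
    show "classical N T u"
    proof (rule classicalI[OF _ regu])
      show "continuous_on (carrier_set N \<times> {0..T}) (\<lambda>(x, t). u x t)"
        unfolding u_def case_prod_beta
        using wpos by (auto intro!: continuous_intros w_cont simp: less_le)
    qed
    show "classical N T m"
    proof (rule classicalI[OF _ regm])
      show "continuous_on (carrier_set N \<times> {0..T}) (\<lambda>(x, t). m x t)"
        unfolding m_def case_prod_beta
        using p_cont by (auto intro!: continuous_intros w_cont simp: case_prod_beta)
    qed
  next
    fix j x s assume j: "j \<in> edges N" and x: "x \<in> arc_of N j" and s: "s \<in> {0<..<T}"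
    obtain y where y: "y \<in> {0..len N j}" "x = param N j y" using x by (auto simp: arc_of_def)
    note du = edge_C21_derivs[OF j regu[OF j] y(1) s] and dm = edge_C21_derivs[OF j regm[OF j] y(1) s]
    have pos: "0 < w x s" using wj_pos[OF j y(1) s] y(2) by simp
    show "time_deriv u x s + edge_deriv N 2 j (\<lambda>z. u z s) x + 1 / 2 * \<bar>edge_deriv N 1 j (\<lambda>z. u z s) x\<bar>\<^sup>2 = 0"
      unfolding y(2) du by (simp add: ut_def u2_def u1_def power2_eq_square)
    have "((\<lambda>y. edge_deriv N 1 j (\<lambda>z'. u z' s) (param N j y) * m (param N j y) s) has_real_derivative
        u2 j y s * m x s + m1 j y s * u1 j y s) (at y within {0..len N j})"
    proof (rule has_field_derivative_transform_within[OF _ zero_less_one y(1)])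
      show "((\<lambda>y. u1 j y s * m (param N j y) s) has_real_derivative u2 j y s * m x s + m1 j y s * u1 j y s) (at y within {0..len N j})"
        unfolding y(2) by (rule DERIV_mult[OF edge_C21_D(6)[OF regu[OF j] y(1) s] edge_C21_D(5)[OF regm[OF j] y(1) s]])
    qed (simp add: edge_C21_derivs(1)[OF j regu[OF j] _ s] del: One_nat_def)
    then have flux: "edge_deriv N 1 j (\<lambda>z. edge_deriv N 1 j (\<lambda>z'. u z' s) z * m z s) x = u2 j y s * m x s + m1 j y s * u1 j y s"
      unfolding y(2) by (rule edge_deriv_1_eq[OF j y(1)])
    show "time_deriv m x s - edge_deriv N 2 j (\<lambda>z. m z s) x
        + edge_deriv N 1 j (\<lambda>z. edge_deriv N 1 j (\<lambda>z'. u z' s) z * m z s) x = 0"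
      unfolding flux unfolding y(2) dm using pos
      by (simp add: y(2) m_def m1_def m2_def mt_def u1_def u2_def field_simps power2_eq_square)
  next
    fix i s assume i: "i \<in> transition_idx N" and s: "s \<in> {0<..<T}"
    note iv = transition_vertex[OF i]
    let ?x = "vpos N i"
    have s': "T - s \<in> {0<..<T}" using s by auto
    have kv: "(\<Sum>j\<in>Inc N i. incidence N i j * w1 j (coord N j ?x) s) = 0"
      using v(1) i s' unfolding network_heat_def w1_def by blast
    have kp: "(\<Sum>j\<in>Inc N i. incidence N i j * p1 j (coord N j ?x) s) = 0"
      using p(1) i s unfolding network_heat_def by blast
    have du: "edge_deriv N 1 j (\<lambda>z. u z s) ?x = 2 * (w1 j (coord N j ?x) s / w ?x s)" if "j \<in> Inc N i" for j
      using edge_C21_derivs(1)[OF vertex_coord(1)[OF iv that] regu[OF vertex_coord(1)[OF iv that]] vertex_coord(2)[OF iv that] s]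
      by (simp add: vertex_coord(3)[OF iv that] u1_def)
    have dm: "edge_deriv N 1 j (\<lambda>z. m z s) ?x = w1 j (coord N j ?x) s * p ?x s + w ?x s * p1 j (coord N j ?x) s"
      if "j \<in> Inc N i" for j
      using edge_C21_derivs(1)[OF vertex_coord(1)[OF iv that] regm[OF vertex_coord(1)[OF iv that]] vertex_coord(2)[OF iv that] s]
      by (simp add: vertex_coord(3)[OF iv that] m1_def)
    have "(\<Sum>j\<in>Inc N i. incidence N i j * edge_deriv N 1 j (\<lambda>z. u z s) ?x) =
        2 / w ?x s * (\<Sum>j\<in>Inc N i. incidence N i j * w1 j (coord N j ?x) s)"
      unfolding sum_distrib_left by (rule sum.cong) (use du in auto)
    then show "(\<Sum>j\<in>Inc N i. incidence N i j * edge_deriv N 1 j (\<lambda>z. u z s) ?x) = 0"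
      using kv by simp
    show "(\<Sum>j\<in>Inc N i. incidence N i j * (edge_deriv N 1 j (\<lambda>z. m z s) ?x - m ?x s * edge_deriv N 1 j (\<lambda>z. u z s) ?x)) = 0"
    proof (cases "Inc N i = {}")
      case False
      then obtain j where "j \<in> Inc N i" by auto
      then have "0 < w ?x s" using wj_pos vertex_coord[OF iv] s by metis
      then have "incidence N i j * (edge_deriv N 1 j (\<lambda>z. m z s) ?x - m ?x s * edge_deriv N 1 j (\<lambda>z. u z s) ?x) =
          w ?x s * (incidence N i j * p1 j (coord N j ?x) s) - p ?x s * (incidence N i j * w1 j (coord N j ?x) s)"
        if "j \<in> Inc N i" for j
        using du[OF that] dm[OF that] by (simp add: m_def algebra_simps)
      then have "(\<Sum>j\<in>Inc N i. incidence N i j * (edge_deriv N 1 j (\<lambda>z. m z s) ?x - m ?x s * edge_deriv N 1 j (\<lambda>z. u z s) ?x)) =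
          w ?x s * (\<Sum>j\<in>Inc N i. incidence N i j * p1 j (coord N j ?x) s) - p ?x s * (\<Sum>j\<in>Inc N i. incidence N i j * w1 j (coord N j ?x) s)"
        by (simp add: sum_subtractf sum_distrib_left)
      then show ?thesis using kv kp by simp
    qed simp
  next
    fix x assume x: "x \<in> carrier_set N"
    show "m x 0 = m0 x" using p(2)[OF x] wpos[OF x, of 0] T by (simp add: m_def w_def)
    show "u x T = cT T" using v(2)[OF x] by (simp add: u_def w_def \<gamma>_def)
  next
    fix s assume s: "s \<in> {0..T}"
    show "m (vpos N i0) s = 0" using p(3)[OF s] by (simp add: m_def)
    show "u (vpos N i0) s = cT s" using v(3)[of "T - s"] s by (simp add: u_def w_def \<gamma>_def)
  qed
  then show ?thesis by blast
qed

end

theorem corollary3p1: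
  fixes N :: "('i, 'j, 'n::finite) network" and i0 :: 'i
    and T \<alpha> :: real and cT :: "real \<Rightarrow> real" and m0 :: "real ^ 'n \<Rightarrow> real"
  assumes "is_network N"
    and "boundary_idx N = {i0}"
    and "0 < T"
    and "0 < \<alpha>" and "\<alpha> < 1"
    and "holder 1 (\<alpha> / 2) {0..T} cT"
    and "\<forall>s\<in>{0..T}. 0 \<le> cT s"
    and "holder_network 2 \<alpha> N m0"
    and "m0 (vpos N i0) = 0"
  shows "(\<exists>u m. mfg_solution N i0 T cT m0 u m) \<and>
    (\<forall>u m u' m'. mfg_solution N i0 T cT m0 u m \<longrightarrow> mfg_solution N i0 T cT m0 u' m' \<longrightarrow>
       (\<forall>x\<in>carrier_set N. \<forall>s\<in>{0..T}. u x s = u' x s \<and> m x s = m' x s))"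
proof -
  interpret exit_network N i0 by unfold_locales (fact assms)+
  have "Ck_on 1 {0..T} cT" using assms(6) by (simp add: holder_def)
  moreover have "continuous_on (carrier_set N) m0" using assms(8) by (simp add: holder_network_def)
  ultimately show ?thesis
    using mfg_solution_exists[OF \<open>0 < T\<close>, of cT m0] mfg_solution_unique[OF \<open>0 < T\<close>] assms by blast
qed

end
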